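(* Assume hypothesis (P) of the context, and let $\tilde\nu=1-g_\kappa^{\{1\}}(R)>0$. Then for each $m\in\mathbb N$, under the measures $\mathbb P_N$, $$\frac{1}{N\tilde\nu}(L_1,\dots,L_m)\longrightarrow(X_1,\dots,X_m)\quad\text{in distribution as }N\to\infty,$$ where $(X_n)$ is the random sequence defined in the context. In particular, $L_1/(N\tilde\nu)$ converges in distribution to a random variable with an atom of mass $1-\tilde\nu$ at zero and an absolutely continuous component on $(0,1)$ with density $\tilde\nu\,\theta^*(1-x)^{\theta^*-1}$.
   Context: Model: for $N\in\mathbb N$, $S_N$ is the symmetric group on $\{1,\dots,N\}$; for $\sigma\in S_N$, $C_j(\sigma)$ is the number of cycles of length $j$. Given nonnegative sequences $(\theta_j)_{j\ge1},(\kappa_j)_{j\ge1}$, $\mathbb P_N(\sigma)=\frac{1}{N!H_N}\prod_{j=1}^N(\theta_j+N\kappa_j)^{C_j}$, $H_N=\frac1{N!}\sum_{\sigma\in S_N}\prod_{j=1}^N(\theta_j+N\kappa_j)^{C_j}$. Lexicographic ordering: $L_1(\sigma)$ is the length of the cycle containing $1$, $L_2(\sigma)$ the length of the cycle containing the smallest element not in the first cycle, etc. $g_\theta(z)=\sum_{j\ge1}\theta_jz^j/j$, $g_\kappa(z)=\sum_{j\ge1}\kappa_jz^j/j$; $g^{\{n\}}(z):=z^ng^{(n)}(z)$; $R$ is the radius of convergence of $g_\kappa$ and $g_\kappa^{\{n\}}(R)=\lim_{r\uparrow R}g_\kappa^{\{n\}}(r)\in[0,\infty]$. Standing assumption: $(\kappa_j)$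 is non-arithmetic (no integer $j_0>1$ such that $\kappa_j\ne0$ implies $j_0\mid j$) and $\kappa_j>0$ for some $j\ge2$. $\Delta_0=\{z:|z|<R|1+\eta e^{i\varphi}|,\ z\neq R,\ |\arg(z-R)|>\varphi\}$ for some $\eta>0$, $\varphi\in(0,\pi/2)$. Principal branches are used for logs and powers. Hypothesis (P): $g_\theta,g_\kappa$ both have radius of convergence $R>0$ and are holomorphic in some $\Delta_0$; $g_\kappa^{\{1\}}(R)<1$; as $z\to R$, $z\in\Delta_0$, $g_\theta(z)=-\theta^*\log(1-z/R)+O((1-z/R)^\delta)$ and $g_\kappa(z)=g_\kappa(R)-g_\kappa^{\{1\}}(R)(1-z/R)+O((1-z/R)^{1+\delta})$ with $\theta^*>0$, $\delta>0$; there is a non-integer $s>1$ with $g_\kappa^{\{n\}}(R)<\infty$ for integers $n<s$ and $g_\kappa^{\{n\}}(R)=\infty$ for $n>s$, and there exist $a_s>0$ and $\delta_n>0$ such that, as $z\to R$, $z\in\Delta_0$: $g_\kappa^{\{n\}}(z)=g_\kappa^{\{n\}}(R)\{1+O((1-z/R)^{\delta_n})\}$ for $n<s$; $g_\kappa^{\{n\}}(z)=\frac{\Gamma(n-s)a_s}{\Gamma(-s)}(1-z/R)^{s-n}\{1+O((1-z/R)^{\delta_n})\}$ for $n>s$; and $g_\theta^{\{n\}}(z)=\frac{\theta^*(n-1)!}{(1-z/R)^n}\{1+O((1-z/R)^{\delta_n})\}$ for all $n\in\mathbb N$. The sequence $(X_n)$: let $(U_n)$ be i.i.d. uniform on $[0,1]$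 and $(B_n)$ i.i.d. with Beta$(1,\theta^* )$ distribution (density $\theta^*(1-x)^{\theta^*-1}$ on $[0,1]$), the two sequences independent. Put $u^*(x)=\tilde\nu x/(1-\tilde\nu+\tilde\nu x)$, $\eta_0=1$ and inductively for $n\ge1$: $\xi_n=\mathbf 1_{\{U_n\le u^*(\eta_{n-1})\}}$, $D_n=\xi_nB_n$, $\eta_n=\prod_{j=1}^n(1-D_j)$, and $X_n=\eta_{n-1}D_n$. *)

theory Defs
  imports "HOL-Probability.Probability" "HOL-Complex_Analysis.Complex_Analysis"
    "HOL-Library.Landau_Symbols" "HOL-Combinatorics.Permutations"
begin

definition perms :: "nat \<Rightarrow> (nat \<Rightarrow> nat) set" where
  "perms N = {\<sigma>. \<sigma> permutes {1..N}}"

definition cyc :: "(nat \<Rightarrow> nat) \<Rightarrow> nat \<Rightarrow> nat set" where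
  "cyc \<sigma> i = range (\<lambda>k. (\<sigma> ^^ k) i)"

definition cycles :: "nat \<Rightarrow> (nat \<Rightarrow> nat) \<Rightarrow> nat set set" where
  "cycles N \<sigma> = cyc \<sigma> ` {1..N}"

definition Ccount :: "nat \<Rightarrow> (nat \<Rightarrow> nat) \<Rightarrow> nat \<Rightarrow> nat" where
  "Ccount N \<sigma> j = card {c \<in> cycles N \<sigma>. card c = j}"

definition weight :: "(nat \<Rightarrow> real) \<Rightarrow> (nat \<Rightarrow> real) \<Rightarrow> nat \<Rightarrow> (nat \<Rightarrow> nat) \<Rightarrow> real" where
  "weight \<theta> \<kappa> N \<sigma> = (\<Prod>j\<in>{1..N}. (\<theta> j + real N * \<kappa> j) ^ Ccount N \<sigma> j)"

definition HN :: "(nat \<Rightarrow> real) \<Rightarrow> (nat \<Rightarrow> real) \<Rightarrow> nat \<Rightarrow> real" where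
  "HN \<theta> \<kappa> N = (1 / fact N) * (\<Sum>\<sigma>\<in>perms N. weight \<theta> \<kappa> N \<sigma>)"

definition PN :: "(nat \<Rightarrow> real) \<Rightarrow> (nat \<Rightarrow> real) \<Rightarrow> nat \<Rightarrow> (nat \<Rightarrow> nat) \<Rightarrow> real" where
  "PN \<theta> \<kappa> N \<sigma> = weight \<theta> \<kappa> N \<sigma> / (fact N * HN \<theta> \<kappa> N)"

text \<open>Lexicographic ordering of cycles: covered N sigma k is the union of the
  first k cycles (cycle of 1, cycle of the smallest element not yet covered, ...).\<close>
fun covered :: "nat \<Rightarrow> (nat \<Rightarrow> nat) \<Rightarrow> nat \<Rightarrow> nat set" where
  "covered N \<sigma> 0 = {}"
| "covered N \<sigma> (Suc k) =
     (if {1..N} - covered N \<sigma> k = {} then covered N \<sigma> k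
      else covered N \<sigma> k \<union> cyc \<sigma> (Min ({1..N} - covered N \<sigma> k)))"

text \<open>L_k(sigma) for k >= 1 (equal to 0 once all cycles are exhausted).\<close>
definition Lcyc :: "nat \<Rightarrow> (nat \<Rightarrow> nat) \<Rightarrow> nat \<Rightarrow> nat" where
  "Lcyc N \<sigma> k = card (covered N \<sigma> k) - card (covered N \<sigma> (k - 1))"

definition gcoef :: "(nat \<Rightarrow> real) \<Rightarrow> nat \<Rightarrow> complex" where
  "gcoef a j = complex_of_real (a j / real j)"

definition Delta0 :: "real \<Rightarrow> real \<Rightarrow> real \<Rightarrow> complex set" where
  "Delta0 R \<eta> \<phi> = {z. cmod z < R * cmod (1 + complex_of_real \<eta> * cis \<phi>)
       \<and> z \<noteq> complex_of_real R \<and> \<phi> < \<bar>Arg (z - complex_of_real R)\<bar>}"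

definition nearR :: "real \<Rightarrow> real \<Rightarrow> real \<Rightarrow> complex filter" where
  "nearR R \<eta> \<phi> = at (complex_of_real R) within Delta0 R \<eta> \<phi>"

definition gbrace :: "nat \<Rightarrow> (complex \<Rightarrow> complex) \<Rightarrow> complex \<Rightarrow> complex" where
  "gbrace n G z = z ^ n * (deriv ^^ n) G z"

definition gbraceR :: "nat \<Rightarrow> (complex \<Rightarrow> complex) \<Rightarrow> real \<Rightarrow> ereal" where
  "gbraceR n G R = Lim (at_left R) (\<lambda>r. ereal (Re (gbrace n G (complex_of_real r))))"

definition ustar :: "real \<Rightarrow> real \<Rightarrow> real" where
  "ustar \<nu> x = \<nu> * x / (1 - \<nu> + \<nu> * x)"

text \<open>omega n = (U_n, B_n).\<close>
fun etaX :: "real \<Rightarrow> (nat \<Rightarrow> real \<times> real) \<Rightarrow> nat \<Rightarrow> real" where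
  "etaX \<nu> \<omega> 0 = 1"
| "etaX \<nu> \<omega> (Suc n) =
     etaX \<nu> \<omega> n * (1 - (if fst (\<omega> (Suc n)) \<le> ustar \<nu> (etaX \<nu> \<omega> n) then 1 else 0)
                          * snd (\<omega> (Suc n)))"

definition xiX :: "real \<Rightarrow> (nat \<Rightarrow> real \<times> real) \<Rightarrow> nat \<Rightarrow> real" where
  "xiX \<nu> \<omega> n = (if fst (\<omega> n) \<le> ustar \<nu> (etaX \<nu> \<omega> (n - 1)) then 1 else 0)"

definition DX :: "real \<Rightarrow> (nat \<Rightarrow> real \<times> real) \<Rightarrow> nat \<Rightarrow> real" where
  "DX \<nu> \<omega> n = xiX \<nu> \<omega> n * snd (\<omega> n)"

definition XX :: "real \<Rightarrow> (nat \<Rightarrow> real \<times> real) \<Rightarrow> nat \<Rightarrow> real" where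
  "XX \<nu> \<omega> n = etaX \<nu> \<omega> (n - 1) * DX \<nu> \<omega> n"

definition unif01 :: "real measure" where
  "unif01 = uniform_measure lborel {0..1}"

definition beta1 :: "real \<Rightarrow> real measure" where
  "beta1 \<theta>s = density lborel (\<lambda>x. ennreal (indicator {0<..<1} x * \<theta>s * (1 - x) powr (\<theta>s - 1)))"

definition UBspace :: "real \<Rightarrow> nat \<Rightarrow> (nat \<Rightarrow> real \<times> real) measure" where
  "UBspace \<theta>s m = PiM {1..m} (\<lambda>_. unif01 \<Otimes>\<^sub>M beta1 \<theta>s)"

text \<open>Subspace of nat => real identified with R^m (coordinates 1..m).\<close>
definition Rm :: "nat \<Rightarrow> (nat \<Rightarrow> real) set" where
  "Rm m = {x. \<forall>i. i \<notin> {1..m} \<longrightarrow> x i = 0}"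

end

theory Submission
  imports Defs "HOL-Real_Asymp.Real_Asymp" "HOL-Combinatorics.Cycles"
begin

text \<open>
  Put \<open>c\<^sub>l = \<kappa>\<^sub>l R\<^sup>l\<close> and \<open>t\<^sub>l = \<theta>\<^sub>l R\<^sup>l\<close>, so that \<open>\<mu> = \<Sum>\<^sub>l c\<^sub>l = 1 - \<nu>\<close>. The cycle
  lengths in lexicographic order form a Markov chain on the number \<open>n\<close> of remaining points: the
  next cycle has length \<open>l\<close> with probability \<open>(t\<^sub>l + N c\<^sub>l) / n \<cdot> q\<^sub>n\<^sub>-\<^sub>l / q\<^sub>n\<close>, where
  \<open>q\<^sub>n = [z\<^sup>n] exp (g\<^sub>\<theta>(R z) + N g\<^sub>\<kappa>(R z))\<close>. Up to a factor depending on \<open>N\<close> only, \<open>q\<^sub>n\<close> is the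
  expectation of \<open>b\<^sub>n\<^sub>-\<^sub>S\<close>, where \<open>b\<^sub>k = [z\<^sup>k] exp (g\<^sub>\<theta>(R z)) \<sim> C k\<^bsup>\<theta>* - 1\<^esup>\<close> and \<open>S\<close> is a compound
  Poisson variable of mean \<open>N \<mu>\<close>. The law of large numbers for \<open>S\<close>, together with a bound on its
  point probabilities beyond \<open>(\<mu> + \<epsilon>) N\<close>, gives \<open>q\<^sub>n \<approx> C (n - \<mu> N)\<^bsup>\<theta>* - 1\<^esup>\<close> uniformly for
  \<open>n \<ge> (\<mu> + \<epsilon>) N\<close>. So from \<open>n = (\<mu> + \<nu> \<eta>) N\<close> the chain takes a microscopic step with probability
  \<open>\<mu> / (\<mu> + \<nu> \<eta>) = 1 - u*(\<eta>)\<close> and otherwise removes a Beta distributed fraction of \<open>\<eta>\<close>; these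
  masses add up to one, hence states with \<open>n\<close> close to or below \<open>\<mu> N\<close> need not be examined.

  The bounds \<open>c\<^sub>l = O(l\<^bsup>-s\<^esup>)\<close> and \<open>t\<^sub>l - \<theta>* = O(l\<^bsup>-\<delta>\<^esup>)\<close> on the coefficients follow by integrating the
  singular expansion of a high enough derivative over the circle of radius \<open>(1 - 1/l) R\<close>, which
  stays inside the disc of convergence.
\<close>

text \<open>The point-probability bound is forced by small k when \<theta>s < 1: values of S within
  o(N) of n meet b_k far larger than N^(\<theta>s - 1), and a law of large numbers alone does not
  control E b_(n-S). Since b_0 + ... + b_n = O(n^\<theta>s), it is enough that N P(S = j) tends to 0
  uniformly over those j, and c_l = O(l^(-s)) with s > 1 gives this with room for logarithms. As S
  need not have a variance when s < 2, everything about it rests on its mean and on Laplace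
  transforms at t \<ge> 0.

  Because of the indicators, the limit functional is not continuous in the underlying variables
  (U_i, B_i). Convergence is therefore tested along integer sequences whose rescaled values converge
  to the coordinates X_i. This form of the hypothesis survives integrating out one coordinate, which
  is what the induction on m needs.\<close>

subsection \<open>The exponential of a sequence\<close>

text \<open>The coefficient of z^n in E = exp(\<Sum> a_l z^l / l). The recursion is z E' = (\<Sum>
  a_l z^l) E compared at z^n, so no composition of power series enters.\<close>

fun expseq :: "(nat \<Rightarrow> real) \<Rightarrow> nat \<Rightarrow> real" where
  "expseq a n = (if n = 0 then 1 else (\<Sum>l\<in>{1..n}. a l * expseq a (n - l)) / real n)"

declare expseq.simps [simp del]

lemma expseq_0 [simp]: "expseq a 0 = 1"
  by (simp add: expseq.simps)

lemma expseq_rec: "real n * expseq a n = (\<Sum>l\<in>{1..n}. a l * expseq a (n - l))"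
  by (subst expseq.simps) auto

lemma expseq_unique:
  assumes "e 0 = 1" "\<And>n. n > 0 \<Longrightarrow> real n * e n = (\<Sum>l\<in>{1..n}. a l * e (n - l))"
  shows "e n = expseq a n"
proof (induction n rule: less_induct)
  case (less n)
  show ?case
  proof (cases "n = 0")
    case False
    have "real n * e n = (\<Sum>l\<in>{1..n}. a l * e (n - l))" using assms False by simp
    also have "\<dots> = (\<Sum>l\<in>{1..n}. a l * expseq a (n - l))"
      using less by (intro sum.cong) auto
    also have "\<dots> = real n * expseq a n" by (simp add: expseq_rec)
    finally show ?thesis using False by simp
  qed (use assms in auto)
qed

lemma expseq_nonneg:
  assumes "\<And>l. l \<ge> 1 \<Longrightarrow> a l \<ge> 0"
  shows "expseq a n \<ge> 0"
proof (induction n rule: less_induct)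
  case (less n)
  then show ?case
    by (subst expseq.simps) (auto intro!: divide_nonneg_nonneg sum_nonneg mult_nonneg_nonneg assms)
qed

lemma expseq_abs_le:
  assumes "\<And>l. l \<ge> 1 \<Longrightarrow> \<bar>a l\<bar> \<le> b l"
  shows "\<bar>expseq a n\<bar> \<le> expseq b n"
proof (induction n rule: less_induct)
  case (less n)
  have "\<bar>\<Sum>l\<in>{1..n}. a l * expseq a (n - l)\<bar> \<le> (\<Sum>l\<in>{1..n}. \<bar>a l * expseq a (n - l)\<bar>)"
    by (rule sum_abs)
  also have "\<dots> \<le> (\<Sum>l\<in>{1..n}. b l * expseq b (n - l))"
  proof (intro sum_mono)
    fix l assume "l \<in> {1..n}"
    then show "\<bar>a l * expseq a (n - l)\<bar> \<le> b l * expseq b (n - l)"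
      unfolding abs_mult using assms[of l] less[of "n - l"] by (intro mult_mono) auto
  qed
  finally show ?case by (cases "n = 0") (auto simp: expseq.simps[of _ n] abs_mult divide_right_mono)
qed

lemma expseq_cong:
  assumes "\<And>l. 1 \<le> l \<Longrightarrow> l \<le> n \<Longrightarrow> a l = b l"
  shows "expseq a n = expseq b n"
  using assms
proof (induction n rule: less_induct)
  case (less n)
  then have "(\<Sum>l\<in>{1..n}. a l * expseq a (n - l)) = (\<Sum>l\<in>{1..n}. b l * expseq b (n - l))"
    by (intro sum.cong refl arg_cong2[where f="(*)"]) auto
  then show ?case by (simp add: expseq.simps[of _ n])
qed

lemma expseq_scale: "expseq (\<lambda>l. a l * x ^ l) n = x ^ n * expseq a n"
proof (rule expseq_unique[symmetric])
  fix n :: nat assume "n > 0"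
  have "real n * (x ^ n * expseq a n) = x ^ n * (\<Sum>l\<in>{1..n}. a l * expseq a (n - l))"
    by (subst expseq_rec[symmetric]) simp
  also have "\<dots> = (\<Sum>l = 1..n. a l * x ^ l * (x ^ (n - l) * expseq a (n - l)))"
    unfolding sum_distrib_left
    by (intro sum.cong refl) (auto simp: power_add[symmetric] mult_ac)
  finally show "real n * (x ^ n * expseq a n) = (\<Sum>l = 1..n. a l * x ^ l * (x ^ (n - l) * expseq a (n - l)))" .
qed auto

text \<open>In this differential form the recursion is compatible with the product rule, which is
  what \<open>expseq_add\<close> needs.\<close>

lemma fps_expseq_deriv:
  "fps_X * fps_deriv (Abs_fps (expseq a)) = Abs_fps (\<lambda>n. if n = 0 then 0 else a n) * Abs_fps (expseq a)"
proof (rule fps_ext)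
  fix n
  have "(\<Sum>i=0..n. (if i = 0 then 0 else a i) * expseq a (n - i)) = (\<Sum>l\<in>{1..n}. a l * expseq a (n - l))"
    by (intro sum.mono_neutral_cong_right) auto
  also have "\<dots> = real n * expseq a n" by (simp add: expseq_rec)
  finally have "(\<Sum>i=0..n. (if i = 0 then 0 else a i) * expseq a (n - i)) = real n * expseq a n" .
  then show "fps_nth (fps_X * fps_deriv (Abs_fps (expseq a))) n =
     fps_nth (Abs_fps (\<lambda>n. if n = 0 then 0 else a n) * Abs_fps (expseq a)) n"
    by (cases n) (simp_all only: fps_mult_nth[of "Abs_fps (\<lambda>n. if n = 0 then 0 else a n)"] fps_X_mult_nth fps_nth_Abs_fps fps_deriv_nth, auto)
qed

text \<open>The exponential turns sums into products: the product of the two series solves the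
  differential equation belonging to a + b and has constant term 1, so \<open>expseq_unique\<close>
  identifies it.\<close>

lemma expseq_add:
  "expseq (\<lambda>l. a l + b l) n = (\<Sum>k\<le>n. expseq a k * expseq b (n - k))"
proof -
  define A where "A = Abs_fps (\<lambda>n. if n = 0 then 0 else a n)"
  define B where "B = Abs_fps (\<lambda>n. if n = 0 then 0 else b n)"
  define Ea where "Ea = Abs_fps (expseq a)"
  define Eb where "Eb = Abs_fps (expseq b)"
  have "fps_X * fps_deriv (Ea * Eb) = (fps_X * fps_deriv Ea) * Eb + Ea * (fps_X * fps_deriv Eb)"
    by (simp add: algebra_simps)
  also have "\<dots> = (A + B) * (Ea * Eb)"
    using fps_expseq_deriv[of a] fps_expseq_deriv[of b]
    by (simp add: Ea_def Eb_def A_def B_def algebra_simps)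
  finally have eq: "fps_X * fps_deriv (Ea * Eb) = (A + B) * (Ea * Eb)" .
  have "fps_nth (Ea * Eb) n = expseq (\<lambda>l. a l + b l) n"
  proof (rule expseq_unique)
    show "fps_nth (Ea * Eb) 0 = 1" by (simp add: Ea_def Eb_def)
    fix n :: nat assume n: "n > 0"
    have "real n * fps_nth (Ea * Eb) n = fps_nth (fps_X * fps_deriv (Ea * Eb)) n"
      using n by (cases n) (auto simp only: fps_X_mult_nth fps_deriv_nth, auto)
    also have "\<dots> = (\<Sum>i=0..n. (if i = 0 then 0 else a i + b i) * fps_nth (Ea * Eb) (n - i))"
      unfolding eq fps_mult_nth[of "A + B"] by (intro sum.cong) (auto simp: A_def B_def)
    also have "\<dots> = (\<Sum>l = 1..n. (a l + b l) * fps_nth (Ea * Eb) (n - l))"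
      by (intro sum.mono_neutral_cong_right) auto
    finally show "real n * fps_nth (Ea * Eb) n = \<dots>" .
  qed
  then show ?thesis by (simp add: fps_mult_nth Ea_def Eb_def atLeast0AtMost)
qed

lemma expseq_single:
  assumes "d > 0"
  shows "expseq (\<lambda>l. if l = d then x else 0) n = (if d dvd n then (x / d) ^ (n div d) / fact (n div d) else 0)"
proof (rule expseq_unique[symmetric])
  fix n :: nat assume n: "n > 0"
  define e where "e n = (if d dvd n then (x / d) ^ (n div d) / fact (n div d) else 0)" for n
  have "(\<Sum>l = 1..n. (if l = d then x else 0) * e (n - l)) = (\<Sum>l = 1..n. if l = d then x * e (n - d) else 0)"
    by (intro sum.cong) auto
  also have "\<dots> = (if d \<le> n then x * e (n - d) else 0)"
    using assms by (simp add: sum.delta)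
  also have "\<dots> = real n * e n"
  proof (cases "d dvd n")
    case True
    then obtain k where k: "n = d * k" by auto
    with n obtain j where "k = Suc j" by (cases k) auto
    with k assms show ?thesis
      by (simp add: e_def divide_simps del: of_nat_add of_nat_mult) (simp add: algebra_simps)
  next
    case False
    then show ?thesis using n by (auto simp: e_def dvd_minus_self)
  qed
  finally show "real n * e n = (\<Sum>l = 1..n. (if l = d then x else 0) * e (n - l))" by simp
qed (use assms in auto)

lemma expseq_single_sums:
  assumes "d > 0"
  shows "expseq (\<lambda>l. if l = d then x else 0) sums exp (x / d)"
proof -
  have "(\<lambda>k. expseq (\<lambda>l. if l = d then x else 0) (d * k)) sums exp (x / d)"
    using exp_converges[of "x / d"] assms by (simp add: expseq_single field_simps)
  moreover have "strict_mono (\<lambda>k. d * k)" using assms by (auto simp: strict_mono_def)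
  moreover have "expseq (\<lambda>l. if l = d then x else 0) n = 0" if "n \<notin> range (\<lambda>k. d * k)" for n
    using that assms by (auto simp: expseq_single dvd_def)
  ultimately show ?thesis
    using sums_mono_reindex[of "\<lambda>k. d * k" "expseq (\<lambda>l. if l = d then x else 0)"] by blast
qed

text \<open>Each new index multiplies the series by the explicit exponential of
  \<open>expseq_single\<close>. Absolute summability is carried along because the Cauchy product
  needs it.\<close>

lemma expseq_finite:
  "summable (\<lambda>n. \<bar>expseq (\<lambda>l. if l \<le> M then a l else 0) n\<bar>) \<and>
   expseq (\<lambda>l. if l \<le> M then a l else 0) sums exp (\<Sum>l\<in>{1..M}. a l / l)"
proof (induction M)
  case 0
  have "expseq (\<lambda>l. if l \<le> 0 then a l else 0) n = (if n = 0 then 1 else 0)" for n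
    by (rule expseq_unique[symmetric]) (auto intro!: sum.neutral[symmetric])
  then have "expseq (\<lambda>l. if l \<le> 0 then a l else 0) = (\<lambda>n. if n = 0 then 1 else 0)" by auto
  then show ?case using sums_single[of 0 "\<lambda>_. 1::real"] by (simp add: sums_iff if_distrib cong: if_cong)
next
  case (Suc M)
  let ?A = "expseq (\<lambda>l. if l \<le> M then a l else 0)"
  let ?B = "expseq (\<lambda>l. if l = Suc M then a (Suc M) else 0)"
  have "(\<lambda>l. if l \<le> Suc M then a l else 0) = (\<lambda>l. (if l \<le> M then a l else 0) + (if l = Suc M then a (Suc M) else 0))"
    by (auto simp: fun_eq_iff)
  then have eq: "expseq (\<lambda>l. if l \<le> Suc M then a l else 0) = (\<lambda>n. \<Sum>k\<le>n. ?A k * ?B (n - k))"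
    using expseq_add by auto
  have B: "summable (\<lambda>n. \<bar>?B n\<bar>)"
  proof (rule summable_comparison_test')
    show "summable (expseq (\<lambda>l. if l = Suc M then \<bar>a (Suc M)\<bar> else 0))"
      using expseq_single_sums[of "Suc M"] by (auto simp: sums_iff)
    show "norm \<bar>?B n\<bar> \<le> expseq (\<lambda>l. if l = Suc M then \<bar>a (Suc M)\<bar> else 0) n" for n
      by (auto intro!: expseq_abs_le)
  qed
  have "(\<lambda>n. \<Sum>k\<le>n. ?A k * ?B (n - k)) sums ((\<Sum>n. ?A n) * (\<Sum>n. ?B n))"
    using Suc B by (intro Cauchy_product_sums) auto
  also have "(\<Sum>n. ?A n) * (\<Sum>n. ?B n) = exp (\<Sum>l = 1..Suc M. a l / real l)"
    using Suc expseq_single_sums[of "Suc M" "a (Suc M)"] by (simp add: sums_iff exp_add)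
  finally have 1: "(\<lambda>n. \<Sum>k\<le>n. ?A k * ?B (n - k)) sums exp (\<Sum>l = 1..Suc M. a l / real l)" .
  have "summable (\<lambda>n. \<Sum>k\<le>n. \<bar>?A k\<bar> * \<bar>?B (n - k)\<bar>)"
    using Suc B by (intro summable_Cauchy_product) auto
  then have "summable (\<lambda>n. \<bar>\<Sum>k\<le>n. ?A k * ?B (n - k)\<bar>)"
    by (rule summable_comparison_test'[where N=0]) (auto intro!: order_trans[OF sum_abs] simp: abs_mult)
  with 1 show ?case by (simp add: eq)
qed

text \<open>The value at z = 1 is reached by truncating \<open>a\<close>. The exponential of the
  absolute values dominates, and its summability again comes from the finite case.\<close>

lemma expseq_sums:
  assumes "summable (\<lambda>l. \<bar>a l / l\<bar>)"
  shows "summable (\<lambda>n. \<bar>expseq a n\<bar>)" "expseq a sums exp (\<Sum>l. a l / l)"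
proof -
  let ?t = "\<lambda>a M l. if l \<le> M then a l else (0::real)"
  let ?b = "\<lambda>l::nat. \<bar>a l\<bar>"
  have sb: "summable (expseq ?b)"
  proof (rule bounded_imp_summable)
    show "0 \<le> expseq ?b n" for n by (rule expseq_nonneg) auto
    fix n
    \<comment> \<open>Coefficients up to \<open>n\<close> see only indices up to \<open>n\<close>,
      so truncation at \<open>n\<close> leaves them unchanged.\<close>
    have "sum (expseq ?b) {..n} = sum (expseq (?t ?b n)) {..n}"
      by (intro sum.cong expseq_cong) auto
    also have "\<dots> \<le> (\<Sum>k. expseq (?t ?b n) k)"
      using expseq_finite[of n ?b] by (intro sum_le_suminf) (auto simp: sums_iff intro!: expseq_nonneg)
    also have "\<dots> = exp (\<Sum>l\<in>{1..n}. \<bar>a l\<bar> / l)" using expseq_finite[of n ?b] by (simp add: sums_iff)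
    also have "\<dots> \<le> exp (\<Sum>l. \<bar>a l / l\<bar>)"
      using sum_le_suminf[OF assms, of "{1..n}"] by simp
    finally show "sum (expseq ?b) {..n} \<le> exp (\<Sum>l. \<bar>a l / l\<bar>)" .
  qed
  show sa: "summable (\<lambda>n. \<bar>expseq a n\<bar>)"
    by (rule summable_comparison_test'[OF sb, of 0]) (auto intro!: expseq_abs_le)
  have "(\<lambda>M. \<Sum>n. expseq (?t a M) n) \<longlonglongrightarrow> (\<Sum>n. expseq a n)"
  proof (rule tannerys_theorem[where M = "expseq ?b", THEN conjunct2, THEN conjunct2])
    fix n
    have "eventually (\<lambda>M. expseq (?t a M) n = expseq a n) sequentially"
      using eventually_ge_at_top[of n] by eventually_elim (auto intro!: expseq_cong)
    then show "(\<lambda>M. expseq (?t a M) n) \<longlonglongrightarrow> expseq a n" by (rule tendsto_eventually)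
  next
    show "\<forall>\<^sub>F (k, n) in at_top \<times>\<^sub>F sequentially. norm (expseq (?t a n) k) \<le> expseq ?b k"
      by (intro always_eventually) (auto intro!: expseq_abs_le)
  qed (use sb in auto)
  then have "(\<lambda>M. exp (\<Sum>l\<in>{1..M}. a l / l)) \<longlonglongrightarrow> (\<Sum>n. expseq a n)"
    using expseq_finite[of _ a] by (simp add: sums_iff)
  moreover have "(\<lambda>M. \<Sum>l\<in>{1..M}. a l / l) \<longlonglongrightarrow> (\<Sum>l. a l / l)"
  proof -
    have "(\<lambda>M. \<Sum>l\<le>M. a l / l) \<longlonglongrightarrow> (\<Sum>l. a l / l)"
      using summable_LIMSEQ'[OF summable_rabs_cancel[OF assms]] .
    moreover have "(\<Sum>l\<le>M. a l / l) = (\<Sum>l\<in>{1..M}. a l / l)" for M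
      by (rule sum.mono_neutral_right) auto
    ultimately show ?thesis by simp
  qed
  then have "(\<lambda>M. exp (\<Sum>l\<in>{1..M}. a l / l)) \<longlonglongrightarrow> exp (\<Sum>l. a l / l)"
    by (intro tendsto_exp)
  ultimately have "(\<Sum>n. expseq a n) = exp (\<Sum>l. a l / l)" by (rule LIMSEQ_unique)
  then show "expseq a sums exp (\<Sum>l. a l / l)"
    using summable_rabs_cancel[OF sa] by (simp add: sums_iff)
qed

subsection \<open>Compound Poisson weights\<close>

text \<open>Supplies the domination hypothesis of \<open>tannerys_theorem\<close>, an eventuality in
  a product filter, when the bound holds for every index \<open>k\<close> at once.\<close>

lemma eventually_all_prod:
  assumes "eventually (\<lambda>y. \<forall>k. P k y) F"
  shows "eventually (\<lambda>(k, y). P k y) (at_top \<times>\<^sub>F F)"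
  unfolding eventually_prod_filter
  by (rule exI[of _ "\<lambda>_. True"], rule exI[of _ "\<lambda>y. \<forall>k. P k y"]) (use assms in auto)

locale compound_poisson =
  fixes c :: "nat \<Rightarrow> real"
  assumes c_0: "c 0 = 0" and c_nonneg: "\<And>l. c l \<ge> 0" and c_summable: "summable c"
begin

definition \<mu> :: real where "\<mu> = (\<Sum>l. c l)"
definition g1 :: real where "g1 = (\<Sum>l. c l / l)"
text \<open>The law of S, the sum over l of l times independent Poisson variables of mean N c_l / l;
  \<open>N * g1\<close> is the total jump rate.\<close>

definition p :: "nat \<Rightarrow> nat \<Rightarrow> real" where
  "p N n = expseq (\<lambda>l. N * c l) n * exp (- (N * g1))"

lemma mu_nonneg: "\<mu> \<ge> 0"
  unfolding \<mu>_def by (intro suminf_nonneg c_summable c_nonneg)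

lemma c_div_le: "c l / l \<le> c l"
  using c_nonneg[of l] c_0 by (cases "l = 0") (auto simp: divide_le_eq mult_le_cancel_left1)

lemma c_div_summable: "summable (\<lambda>l. c l / l)"
  by (rule summable_comparison_test'[OF c_summable, of 0]) (use c_div_le c_nonneg in auto)

lemma p_nonneg: "p N n \<ge> 0"
  unfolding p_def by (intro mult_nonneg_nonneg expseq_nonneg) (auto simp: c_nonneg)

text \<open>\<open>expseq_scale\<close> with x = exp(-t) tilts the coefficients, and
  \<open>expseq_sums\<close> evaluates the tilted series. For t \<ge> 0 summability of c_l / l
  suffices.\<close>

lemma p_laplace:
  fixes t :: real
  assumes "t \<ge> 0"
  shows "(\<lambda>n. p N n * exp (- t * n)) sums exp (N * ((\<Sum>l. c l / l * exp (- t * l)) - g1))"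
proof -
  have le: "c l / l * exp (- t * l) \<le> c l / l" for l
    using assms c_nonneg[of l] by (intro mult_right_le_one_le) auto
  have s: "summable (\<lambda>l. c l / l * exp (- t * l))"
    by (rule summable_comparison_test'[OF c_div_summable, of 0]) (use le c_nonneg in auto)
  have e: "exp (- (t * real l)) = exp (-t) ^ l" for l by (metis exp_of_nat2_mult mult_minus_left)
  have "expseq (\<lambda>l. real N * c l * exp (-t) ^ l) sums exp (\<Sum>l. real N * c l * exp (-t) ^ l / l)"
    using summable_mult[OF s, of "real N"] c_nonneg
    by (intro expseq_sums) (simp add: e abs_mult abs_of_nonneg mult_ac abs_divide)
  also have "(\<Sum>l. real N * c l * exp (-t) ^ l / l) = N * (\<Sum>l. c l / l * exp (- t * l))"
    using suminf_mult[OF s, of "real N"] by (simp add: e mult_ac)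
  finally have "(\<lambda>n. expseq (\<lambda>l. real N * c l * exp (-t) ^ l) n * exp (- (N * g1))) sums
     (exp (N * (\<Sum>l. c l / l * exp (- t * l))) * exp (- (N * g1)))"
    by (rule sums_mult2)
  then show ?thesis
    unfolding expseq_scale by (simp add: p_def e exp_add[symmetric] algebra_simps)
qed

lemma p_sums: "p N sums 1"
  using p_laplace[of 0 N] by (simp add: g1_def)

lemma p_summable: "summable (p N)" and p_suminf: "(\<Sum>n. p N n) = 1"
  using p_sums by (auto simp: sums_iff)

lemma p_sum_le_1:
  assumes "finite A" shows "sum (p N) A \<le> 1"
  using sum_le_suminf[OF p_summable assms, of N] p_nonneg p_suminf by auto

text \<open>Size-biasing: weighting the law of S by its value amounts to adding an independent jump
  l with weight N c_l. Summed over n, this gives the mean.\<close>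

lemma p_rec: "real n * p N n = N * (\<Sum>l\<in>{1..n}. c l * p N (n - l))"
proof -
  have "real n * p N n = (real n * expseq (\<lambda>l. N * c l) n) * exp (- (N * g1))"
    by (simp add: p_def)
  also have "\<dots> = N * (\<Sum>l\<in>{1..n}. c l * p N (n - l))"
    unfolding expseq_rec by (simp add: p_def sum_distrib_left sum_distrib_right mult_ac)
  finally show ?thesis .
qed

lemma p_mean: "(\<lambda>n. real n * p N n) sums (N * \<mu>)"
proof -
  have "(\<lambda>n. \<Sum>l\<le>n. c l * p N (n - l)) sums ((\<Sum>l. c l) * (\<Sum>n. p N n))"
    using c_summable p_summable c_nonneg p_nonneg by (intro Cauchy_product_sums) auto
  then have "(\<lambda>n. N * (\<Sum>l\<le>n. c l * p N (n - l))) sums (N * \<mu>)"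
    by (intro sums_mult) (simp add: p_suminf \<mu>_def)
  moreover have "(\<Sum>l\<le>n. c l * p N (n - l)) = (\<Sum>l\<in>{1..n}. c l * p N (n - l))" for n
    by (rule sum.mono_neutral_right) (auto simp: c_0 not_le)
  ultimately show ?thesis by (simp add: p_rec)
qed

text \<open>The mean as the derivative of the Laplace exponent at 0. Since (1 - exp(-t l)) / t \<le>
  l cancels the denominator in c_l / l, the sequence \<open>c\<close> itself is a majorant.\<close>

lemma laplace_slope:
  "((\<lambda>t::real. (g1 - (\<Sum>l. c l / l * exp (- t * l))) / t) \<longlongrightarrow> \<mu>) (at_right 0)"
proof -
  have "((\<lambda>t::real. \<Sum>l. c l / l * ((1 - exp (- t * l)) / t)) \<longlongrightarrow> (\<Sum>l. c l)) (at_right 0)"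
  proof (rule tannerys_theorem[where M = c, THEN conjunct2, THEN conjunct2])
    fix l :: nat
    have "((\<lambda>t::real. (1 - exp (- t * real l)) / t) \<longlongrightarrow> real l) (at_right 0)"
      by (cases "l = 0") (simp, real_asymp)
    then have "((\<lambda>t::real. c l / l * ((1 - exp (- t * l)) / t)) \<longlongrightarrow> c l / l * l) (at_right 0)"
      by (intro tendsto_intros)
    then show "((\<lambda>t::real. c l / l * ((1 - exp (- t * l)) / t)) \<longlongrightarrow> c l) (at_right 0)"
      using c_0 by (cases "l = 0") auto
  next
    have "norm (c l / l * ((1 - exp (- t * l)) / t)) \<le> c l" if "t > 0" for l :: nat and t :: real
    proof -
      have "(1 - exp (- t * l)) / t \<le> l" "(1 - exp (- t * l)) / t \<ge> 0"
        using that exp_ge_add_one_self[of "- t * l"] by (auto simp: divide_simps mult_ac)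
      then have "c l / l * ((1 - exp (- t * l)) / t) \<le> c l / l * l" "0 \<le> c l / l * ((1 - exp (- t * l)) / t)"
        using c_nonneg[of l] by (auto intro!: mult_left_mono mult_nonneg_nonneg simp del: times_divide_eq_left times_divide_eq_right)
      then show ?thesis using c_0 by (cases "l = 0") auto
    qed
    then have "eventually (\<lambda>x::real. \<forall>k. norm (c k / k * ((1 - exp (- x * k)) / x)) \<le> c k) (at_right 0)"
      using eventually_at_right_less[of 0] by (auto elim!: eventually_mono)
    then show "\<forall>\<^sub>F (k, t) in at_top \<times>\<^sub>F at_right 0. norm (c k / real k * ((1 - exp (- t * real k)) / t)) \<le> c k"
      by (rule eventually_all_prod)
  qed (use c_summable in auto)
  moreover have "eventually (\<lambda>t::real. (\<Sum>l. c l / l * ((1 - exp (- t * l)) / t)) = (g1 - (\<Sum>l. c l / l * exp (- t * l))) / t) (at_right 0)"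
    using eventually_at_right_less[of 0]
  proof eventually_elim
    case (elim t)
    have le: "c l / l * exp (- t * l) \<le> c l / l" for l
      using elim c_nonneg[of l] by (intro mult_right_le_one_le) auto
    have s: "summable (\<lambda>l. c l / l * exp (- t * l))"
      by (rule summable_comparison_test'[OF c_div_summable, of 0]) (use le c_nonneg in auto)
    have "(g1 - (\<Sum>l. c l / l * exp (- t * l))) / t = (\<Sum>l. (c l / l - c l / l * exp (- t * l)) / t)"
      unfolding g1_def using suminf_divide[OF summable_diff[OF c_div_summable s], of t]
        suminf_diff[OF c_div_summable s] by simp
    then show ?case by (simp add: right_diff_distrib diff_divide_distrib)
  qed
  ultimately show ?thesis
    unfolding \<mu>_def by (rule Lim_transform_eventually)
qed

text \<open>Chernoff bound at one small t > 0 for which the slope of the Laplace exponent exceeds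
  \<mu> - \<gamma>. The upper tail would need exponential moments, which summability of
  \<open>c\<close> does not provide.\<close>

lemma p_lower_tail:
  assumes "\<gamma> > 0"
  obtains d where "d > 0" "\<And>N. (\<Sum>n. if n \<le> (\<mu> - \<gamma>) * N then p N n else 0) \<le> exp (- (d * N))"
proof -
  have "eventually (\<lambda>t::real. (g1 - (\<Sum>l. c l / l * exp (- t * l))) / t > \<mu> - \<gamma>) (at_right 0)"
    using laplace_slope assms by (intro order_tendstoD(1)) auto
  with eventually_at_right_less[of 0]
  have "eventually (\<lambda>t::real. t > 0 \<and> (g1 - (\<Sum>l. c l / l * exp (- t * l))) / t > \<mu> - \<gamma>) (at_right 0)"
    by eventually_elim auto
  from eventually_happens'[OF _ this] obtain t :: real
    where t: "t > 0" "(g1 - (\<Sum>l. c l / l * exp (- t * l))) / t > \<mu> - \<gamma>"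
    by auto
  define d where "d = g1 - (\<Sum>l. c l / l * exp (- t * l)) - t * (\<mu> - \<gamma>)"
  have "d > 0" using t by (simp add: d_def field_simps)
  moreover have "(\<Sum>n. if n \<le> (\<mu> - \<gamma>) * N then p N n else 0) \<le> exp (- (d * N))" for N
  proof -
    let ?f = "\<lambda>n. p N n * exp (- t * n) * exp (t * (\<mu> - \<gamma>) * N)"
    have f: "?f sums (exp (N * ((\<Sum>l. c l / l * exp (- t * l)) - g1)) * exp (t * (\<mu> - \<gamma>) * N))"
      using t by (intro sums_mult2 p_laplace) auto
    have le: "(if n \<le> (\<mu> - \<gamma>) * N then p N n else 0) \<le> ?f n" for n
    proof (cases "n \<le> (\<mu> - \<gamma>) * N")
      case True
      have "t * (\<mu> - \<gamma>) * N - t * n \<ge> 0" using mult_left_mono[OF True, of t] t by (simp add: mult_ac)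
      then have "exp (- t * n) * exp (t * (\<mu> - \<gamma>) * N) \<ge> 1"
        unfolding exp_add[symmetric] by (simp add: one_le_exp_iff)
      from mult_left_mono[OF this p_nonneg[of N n]] True show ?thesis by (simp add: mult_ac)
    qed (simp add: p_nonneg)
    have "(\<Sum>n. if n \<le> (\<mu> - \<gamma>) * N then p N n else 0) \<le> (\<Sum>n. ?f n)"
    proof (rule suminf_le[OF le _ sums_summable[OF f]])
      show "summable (\<lambda>n. if n \<le> (\<mu> - \<gamma>) * N then p N n else 0)"
        using p_nonneg by (intro summable_comparison_test'[OF p_summable[of N], of 0]) auto
    qed
    also have "\<dots> = exp (- (d * N))"
      using f by (simp add: sums_iff exp_add[symmetric] d_def algebra_simps)
    finally show ?thesis .
  qed
  ultimately show ?thesis using that by blast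
qed

text \<open>The mean is \<open>N \<mu>\<close>, so the mean absolute deviation is twice the mean lower deviation,
  which \<open>p_lower_tail\<close> controls; no second moment is available when \<open>s < 2\<close>.\<close>
lemma p_lln:
  fixes \<gamma> e :: real
  assumes "\<gamma> > 0" "e > 0"
  shows "\<forall>\<^sub>F N in sequentially. (\<Sum>n. if \<bar>n - \<mu> * N\<bar> > \<gamma> * N then p N n else 0) < e"
proof -
  \<comment> \<open>Chosen so that 2 \<gamma>' and the bound e \<gamma> / 2 on the exponential term
    add up to e \<gamma>.\<close>
  define \<gamma>' where "\<gamma>' = e * \<gamma> / 4"
  have g': "\<gamma>' > 0" using assms by (simp add: \<gamma>'_def)
  obtain d where d: "d > 0" "\<And>N. (\<Sum>n. if n \<le> (\<mu> - \<gamma>') * N then p N n else 0) \<le> exp (- (d * N))"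
    using p_lower_tail[OF g'] by blast
  have "(\<lambda>N. exp (- (d * real N))) \<longlonglongrightarrow> 0" using d(1) by real_asymp
  then have "(\<lambda>N. 2 * \<mu> * exp (- (d * real N))) \<longlonglongrightarrow> 0" by (rule tendsto_mult_right_zero)
  then have "\<forall>\<^sub>F N in sequentially. 2 * \<mu> * exp (- (d * real N)) < e * \<gamma> / 2"
    using assms by (intro order_tendstoD(2)) auto
  with eventually_gt_at_top[of 0] show ?thesis
  proof eventually_elim
    case (elim N)
    define w where "w = \<mu> * N"
    have w: "w \<ge> 0" using mu_nonneg by (simp add: w_def)
    let ?low = "\<lambda>n::nat. if n \<le> (\<mu> - \<gamma>') * N then p N n else 0"
    have slow: "summable ?low"
      using p_nonneg by (intro summable_comparison_test'[OF p_summable[of N], of 0]) auto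
    have s0: "(\<lambda>n. (real n - w) * p N n) sums (N * \<mu> - w * 1)"
      using sums_diff[OF p_mean sums_mult[OF p_sums]] by (simp add: left_diff_distrib)
    have s: "(\<lambda>n. (real n - w) * p N n + 2 * \<gamma>' * N * p N n + 2 * w * ?low n) sums
       ((N * \<mu> - w * 1) + 2 * \<gamma>' * N * 1 + 2 * w * (\<Sum>n. ?low n))"
      by (intro sums_add sums_mult s0 p_sums summable_sums slow)
    have le: "\<gamma> * N * (if \<bar>n - \<mu> * N\<bar> > \<gamma> * N then p N n else 0) \<le>
        (real n - w) * p N n + 2 * \<gamma>' * N * p N n + 2 * w * ?low n" for n
    proof -
      have "\<gamma> * N * (if \<bar>n - \<mu> * N\<bar> > \<gamma> * N then 1 else 0) \<le> \<bar>n - w\<bar>"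
        using assms by (auto simp: w_def)
      \<comment> \<open>|n - w| = (n - w) + 2 max(0, w - n). The first term has mean zero; w - n
        reaches \<gamma>' N only on the lower tail, where it is at most w.\<close>
      also have "\<bar>n - w\<bar> \<le> (real n - w) + 2 * \<gamma>' * N + 2 * w * (if n \<le> (\<mu> - \<gamma>') * N then 1 else 0)"
        using g' w mu_nonneg by (auto simp: abs_if w_def algebra_simps)
      finally have *: "\<gamma> * N * (if \<bar>n - \<mu> * N\<bar> > \<gamma> * N then 1 else 0) \<le> (real n - w) + 2 * \<gamma>' * N + 2 * w * (if n \<le> (\<mu> - \<gamma>') * N then 1 else 0)" .
      show ?thesis using mult_right_mono[OF * p_nonneg[of N n]] by (auto simp: algebra_simps split: if_splits)
    qed
    have sl: "summable (\<lambda>n. if \<bar>n - \<mu> * N\<bar> > \<gamma> * N then p N n else 0)"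
      using p_nonneg by (intro summable_comparison_test'[OF p_summable[of N], of 0]) auto
    have "\<gamma> * N * (\<Sum>n. if \<bar>n - \<mu> * N\<bar> > \<gamma> * N then p N n else 0) =
       (\<Sum>n. \<gamma> * N * (if \<bar>n - \<mu> * N\<bar> > \<gamma> * N then p N n else 0))"
      by (rule suminf_mult[symmetric, OF sl])
    also have "\<dots> \<le> (\<Sum>n. (real n - w) * p N n + 2 * \<gamma>' * N * p N n + 2 * w * ?low n)"
      using s by (intro suminf_le le summable_mult sl) (auto simp: sums_iff)
    also have "\<dots> = 2 * \<gamma>' * N + 2 * w * (\<Sum>n. ?low n)" using s by (simp add: sums_iff w_def)
    also have "\<dots> \<le> 2 * \<gamma>' * N + 2 * w * exp (- (d * N))"
      using d(2)[of N] w by (intro add_left_mono mult_left_mono) auto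
    also have "\<dots> = N * (2 * \<gamma>' + 2 * \<mu> * exp (- (d * N)))" by (simp add: w_def algebra_simps)
    also have "\<dots> < N * (2 * \<gamma>' + e * \<gamma> / 2)"
      using elim by (intro mult_strict_left_mono add_strict_left_mono) auto
    also have "\<dots> = \<gamma> * N * e" by (simp add: \<gamma>'_def)
    finally show ?case using assms elim by (simp add: mult_less_cancel_left_pos)
  qed
qed

text \<open>In \<open>j p\<^sub>j = N \<Sum>\<^sub>l c\<^sub>l p\<^sub>j\<^sub>-\<^sub>l\<close> a jump \<open>l \<le> L\<close> leads to a point to which the induction hypothesis
  applies, with total weight at most \<open>\<mu>\<close>, while for longer jumps \<open>c\<^sub>l\<close> is small.\<close>
lemma p_local_step:
  fixes L N k j :: nat and a b \<rho> :: real
  assumes A: "\<And>l. l > L \<Longrightarrow> c l \<le> a" and N: "N > 0" and b: "b > 0" "\<rho> < 1" "\<mu> \<le> \<rho> * b" "a \<ge> 0"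
  shows "real j \<ge> b * N + real k * real L \<Longrightarrow> p N j \<le> \<rho> ^ k + a / b / (1 - \<rho>)"
proof (induction k arbitrary: j)
  case 0
  have "p N j \<le> 1" using p_sum_le_1[of "{j}" N] by simp
  moreover have "a / b / (1 - \<rho>) \<ge> 0" using b by auto
  ultimately show ?case by simp
next
  case (Suc k)
  \<comment> \<open>\<open>D\<close> solves \<rho> b D + a = b D, so the error made by long jumps is
    a fixed point and does not accumulate over the \<open>k\<close> steps.\<close>
  define D where "D = a / b / (1 - \<rho>)"
  have "\<rho> * b \<ge> 0" using mu_nonneg b by linarith
  then have rho: "\<rho> \<ge> 0" using b by (simp add: zero_le_mult_iff)
  have D: "D \<ge> 0" using b by (auto simp: D_def)
  have "0 \<le> real (Suc k) * real L" by simp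
  with Suc.prems have bj: "b * N \<le> j" by linarith
  moreover have "0 < b * N" using b N by simp
  ultimately have j: "real j > 0" by linarith
  have "(\<Sum>l\<in>{1..j}. c l * p N (j - l)) \<le> (\<Sum>l\<in>{1..j}. c l * (\<rho> ^ k + D) + a * p N (j - l))"
  proof (intro sum_mono)
    fix l assume l: "l \<in> {1..j}"
    show "c l * p N (j - l) \<le> c l * (\<rho> ^ k + D) + a * p N (j - l)"
    proof (cases "l \<le> L")
      case True
      have "real l \<le> real L" using True by simp
      then have "p N (j - l) \<le> \<rho> ^ k + D"
        unfolding D_def using Suc.prems l True by (intro Suc.IH) (auto simp: algebra_simps)
      then show ?thesis
        using c_nonneg[of l] p_nonneg[of N "j - l"] b by (auto intro!: add_increasing2 mult_left_mono)
    next
      case False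
      then have "c l * p N (j - l) \<le> a * p N (j - l)" using A p_nonneg by (intro mult_right_mono) auto
      then show ?thesis
        using c_nonneg[of l] rho D by (auto intro!: add_increasing mult_nonneg_nonneg add_nonneg_nonneg)
    qed
  qed
  also have "\<dots> = (\<Sum>l\<in>{1..j}. c l) * (\<rho> ^ k + D) + a * (\<Sum>l\<in>{1..j}. p N (j - l))"
    by (simp add: sum.distrib sum_distrib_left sum_distrib_right)
  also have "(\<Sum>l\<in>{1..j}. p N (j - l)) = sum (p N) {..<j}"
    by (rule sum.reindex_bij_witness[of _ "\<lambda>i. j - i" "\<lambda>i. j - i"]) auto
  also have "(\<Sum>l\<in>{1..j}. c l) * (\<rho> ^ k + D) + a * sum (p N) {..<j} \<le> \<mu> * (\<rho> ^ k + D) + a * 1"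
    using sum_le_suminf[OF c_summable, of "{1..j}"] c_nonneg b rho D p_sum_le_1[of "{..<j}" N] mu_nonneg
    by (intro add_mono mult_mono) (auto simp: \<mu>_def[symmetric] intro!: sum_nonneg p_nonneg)
  also have "\<dots> \<le> \<rho> * b * (\<rho> ^ k + D) + a * 1"
    using b rho D by (intro add_mono mult_right_mono) auto
  also have "\<dots> = b * (\<rho> ^ Suc k + D)" using b by (simp add: D_def divide_simps) (simp add: algebra_simps)
  finally have *: "(\<Sum>l\<in>{1..j}. c l * p N (j - l)) \<le> b * (\<rho> ^ Suc k + D)" .
  have "j * p N j = N * (\<Sum>l\<in>{1..j}. c l * p N (j - l))" by (rule p_rec)
  also have "\<dots> \<le> N * (b * (\<rho> ^ Suc k + D))" by (intro mult_left_mono *) auto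
  also have "\<dots> = (b * N) * (\<rho> ^ Suc k + D)" by simp
  also have "\<dots> \<le> j * (\<rho> ^ Suc k + D)" using bj rho D by (intro mult_right_mono) auto
  finally show ?case using j by (simp add: D_def)
qed

text \<open>\<open>p_local_step\<close> is applied with about (ln N)^2 jumps of length at most L,
  where L is of order N / (ln N)^2. Then \<rho>^((ln N)^2) decays faster than any power of N, and N
  L^(-s) tends to 0 because s > 1.\<close>

lemma p_local:
  fixes A s \<epsilon> e :: real
  assumes A: "\<And>l. l \<ge> 1 \<Longrightarrow> c l \<le> A * real l powr (-s)" and s: "s > 1" and eps: "\<epsilon> > 0" and e: "e > 0"
  shows "\<forall>\<^sub>F N in sequentially. \<forall>j. real j \<ge> (\<mu> + \<epsilon>) * N \<longrightarrow> N * p N j \<le> e"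
proof -
  define A' where "A' = \<bar>A\<bar>"
  \<comment> \<open>Half of \<epsilon> N is reserved for the \<open>K N\<close> jumps of length up
    to \<open>L N\<close>. The product \<rho> b = \<mu> + \<epsilon> / 4 still exceeds \<mu> and is
    positive even if \<mu> = 0.\<close>
  define b where "b = \<mu> + \<epsilon> / 2"
  define \<rho> where "\<rho> = (\<mu> + \<epsilon> / 4) / b"
  have b: "b > 0" and \<rho>: "0 < \<rho>" "\<rho> < 1" "\<mu> \<le> \<rho> * b"
    using eps mu_nonneg by (auto simp: b_def \<rho>_def field_simps)
  define K where "K N = nat \<lceil>(ln (real N))\<^sup>2\<rceil>" for N
  \<comment> \<open>A lower bound for \<open>L N\<close> without rounding, on which asymptotics can
    be computed directly.\<close>
  define x where "x N = \<epsilon> * N / (2 * ((ln (real N))\<^sup>2 + 1)) - 1" for N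
  define L where "L N = nat \<lfloor>\<epsilon> * N / (2 * ((ln (real N))\<^sup>2 + 1))\<rfloor>" for N
  define B where "B = A' / b / (1 - \<rho>)"
  have lim1: "(\<lambda>N. real N * \<rho> powr ((ln (real N))\<^sup>2) + B * (N * (x N) powr (-s))) \<longlonglongrightarrow> 0"
  proof -
    have 1: "(\<lambda>N. real N * \<rho> powr ((ln (real N))\<^sup>2)) \<longlonglongrightarrow> 0" using \<rho> by real_asymp
    have 2: "(\<lambda>N. real N * (x N) powr (-s)) \<longlonglongrightarrow> 0" unfolding x_def using s eps by real_asymp
    show ?thesis using tendsto_add[OF 1 tendsto_mult_left[OF 2, of B]] by simp
  qed
  have "\<forall>\<^sub>F N in sequentially. x N > 0" unfolding x_def using eps by real_asymp
  with order_tendstoD(2)[OF lim1 e] eventually_gt_at_top[of 0] show ?thesis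
  proof eventually_elim
    case (elim N)
    show ?case
    proof (intro allI impI)
      fix j :: nat assume j: "(\<mu> + \<epsilon>) * N \<le> j"
      have "y - 1 \<le> nat \<lfloor>y\<rfloor>" for y :: real by linarith
      then have xL: "x N \<le> L N"
        unfolding x_def L_def by blast
      have "real (K N) \<le> (ln (real N))\<^sup>2 + 1" unfolding K_def
        by (simp add: of_nat_nat)
      moreover have "real (L N) \<le> \<epsilon> * N / (2 * ((ln (real N))\<^sup>2 + 1))"
        unfolding L_def using eps by (intro of_nat_floor) (auto intro!: divide_nonneg_nonneg)
      ultimately have "real (K N) * L N \<le> ((ln (real N))\<^sup>2 + 1) * (\<epsilon> * N / (2 * ((ln (real N))\<^sup>2 + 1)))"
        by (intro mult_mono) auto
      also have "\<dots> = \<epsilon> / 2 * N"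
        by (simp add: field_simps add_nonneg_eq_0_iff)
      finally have KL: "real (K N) * L N \<le> \<epsilon> / 2 * N" .
      have cl: "c l \<le> A' * x N powr (-s)" if l: "L N < l" for l
      proof -
        have "c l \<le> A * real l powr (-s)" using A l by auto
        also have "\<dots> \<le> A' * real l powr (-s)" by (auto simp: A'_def intro!: mult_right_mono)
        also have "\<dots> \<le> A' * x N powr (-s)"
          using xL l elim s by (intro mult_left_mono powr_mono2') (auto simp: A'_def)
        finally show ?thesis .
      qed
      have bj: "b * real N + real (K N) * real (L N) \<le> j" using KL j by (simp add: b_def algebra_simps)
      have a0: "A' * x N powr (-s) \<ge> 0" by (simp add: A'_def)
      have "p N j \<le> \<rho> ^ K N + (A' * x N powr (-s)) / b / (1 - \<rho>)"
        using p_local_step[OF cl elim(2) b \<rho>(2,3) a0 bj] .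
      also have "\<rho> ^ K N \<le> \<rho> powr ((ln (real N))\<^sup>2)"
      proof -
        have "\<rho> ^ K N = \<rho> powr (K N)" using \<rho> by (simp add: powr_realpow)
        also have "\<dots> \<le> \<rho> powr ((ln (real N))\<^sup>2)"
          using \<rho> unfolding K_def by (intro powr_mono') (auto simp: real_nat_ceiling_ge)
        finally show ?thesis .
      qed
      finally have "N * p N j \<le> N * (\<rho> powr ((ln (real N))\<^sup>2) + (A' * x N powr (-s)) / b / (1 - \<rho>))"
        by (intro mult_left_mono) auto
      also have "\<dots> = N * \<rho> powr ((ln (real N))\<^sup>2) + B * (N * (x N) powr (-s))"
        by (simp add: B_def algebra_simps)
      finally show "N * p N j \<le> e" using elim by simp
    qed
  qed
qed

end

subsection \<open>Asymptotics of exponentials of sequences\<close>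

lemma LIMSEQ_abs_bounded:
  fixes f :: "nat \<Rightarrow> real"
  assumes "f \<longlonglongrightarrow> L"
  shows "\<exists>M. \<forall>n. \<bar>f n\<bar> \<le> M"
  using convergent_imp_Bseq[OF convergentI[OF assms]] by (auto simp: Bseq_def)

text \<open>These are the coefficients of (1 - z)^(-x), the model singularity. Comparing the
  recursion at n + 1 and at n leaves a two-term recurrence.\<close>

lemma expseq_const: "expseq (\<lambda>_. x) n = pochhammer x n / fact n"
proof (induction n)
  case (Suc n)
  have "real (Suc n) * expseq (\<lambda>_. x) (Suc n) = x * (\<Sum>l\<in>{1..Suc n}. expseq (\<lambda>_. x) (Suc n - l))"
    unfolding expseq_rec by (rule sum_distrib_left[symmetric])
  also have "(\<Sum>l\<in>{1..Suc n}. expseq (\<lambda>_. x) (Suc n - l)) = expseq (\<lambda>_. x) n + (\<Sum>l\<in>{1..n}. expseq (\<lambda>_. x) (n - l))"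
    using sum.atLeast_Suc_atMost_Suc_shift[of "\<lambda>l. expseq (\<lambda>_. x) (Suc n - l)" 0 n]
      sum.atLeast_Suc_atMost[of 0 n "\<lambda>l. expseq (\<lambda>_. x) (n - l)"] by simp
  also have "x * \<dots> = x * expseq (\<lambda>_. x) n + real n * expseq (\<lambda>_. x) n"
    unfolding expseq_rec by (simp add: algebra_simps sum_distrib_left)
  finally have "real (Suc n) * expseq (\<lambda>_. x) (Suc n) = (x + real n) * (pochhammer x n / fact n)"
    using Suc by (simp only: distrib_right)
  then have "expseq (\<lambda>_. x) (Suc n) = (x + real n) * (pochhammer x n / fact n) / real (Suc n)"
    by (simp only: nonzero_eq_divide_eq[OF of_nat_neq_0] mult.commute)
  then show ?case by (simp add: pochhammer_Suc mult_ac)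
qed auto

text \<open>For a constant sequence the right-hand side of the recursion is itself a partial
  sum.\<close>

lemma sum_expseq_const:
  "x * (\<Sum>k\<le>n. expseq (\<lambda>_. x) k) = real (Suc n) * expseq (\<lambda>_. x) (Suc n)"
proof -
  have "(\<Sum>k\<le>n. expseq (\<lambda>_. x) k) = (\<Sum>l\<in>{1..Suc n}. expseq (\<lambda>_. x) (Suc n - l))"
    by (rule sum.reindex_bij_witness[of _ "\<lambda>i. Suc n - i" "\<lambda>i. Suc n - i"]) auto
  then show ?thesis unfolding expseq_rec by (simp only: sum_distrib_left)
qed

text \<open>\<open>Gamma_series\<close> is Gauss's product for Gamma; up to the factor n / (x + n)
  its reciprocal is the normalised coefficient.\<close>

lemma expseq_const_asymp:
  fixes x :: real
  assumes "x > 0"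
  shows "(\<lambda>n. expseq (\<lambda>_. x) n / real n powr (x - 1)) \<longlonglongrightarrow> 1 / Gamma x"
proof -
  have "(\<lambda>n. (real n / (x + real n)) / Gamma_series x n) \<longlonglongrightarrow> 1 / Gamma x"
  proof (intro tendsto_divide Gamma_series_LIMSEQ)
    show "(\<lambda>n. real n / (x + real n)) \<longlonglongrightarrow> 1" by real_asymp
    show "Gamma x \<noteq> 0" using Gamma_real_pos[OF assms] by simp
  qed
  moreover have "\<forall>\<^sub>F n in sequentially. (real n / (x + real n)) / Gamma_series x n = expseq (\<lambda>_. x) n / real n powr (x - 1)"
    using eventually_gt_at_top[of 0]
  proof eventually_elim
    case (elim n)
    have "real n powr (x - 1) = exp (x * ln n) / n"
      using elim by (simp add: powr_def powr_diff field_simps exp_diff left_diff_distrib)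
    then show ?case using elim assms pochhammer_pos[OF assms, of n]
      by (simp add: expseq_const Gamma_series_def pochhammer_Suc divide_simps) (simp add: field_simps)
  qed
  ultimately show ?thesis by (rule Lim_transform_eventually)
qed

lemma expseq_const_pos: "x > 0 \<Longrightarrow> expseq (\<lambda>_. x) n > 0"
  by (simp add: expseq_const pochhammer_pos)

lemma expseq_const_asymp_shift:
  fixes x :: real
  assumes "x > 0"
  shows "(\<lambda>n. expseq (\<lambda>_. x) (n - l) / real n powr (x - 1)) \<longlonglongrightarrow> 1 / Gamma x"
proof -
  have "(\<lambda>n. expseq (\<lambda>_. x) (n - l) / real (n - l) powr (x - 1)) \<longlonglongrightarrow> 1 / Gamma x"
    using expseq_const_asymp[OF assms] filterlim_minus_const_nat_at_top by (rule filterlim_compose)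
  moreover have "(\<lambda>n. (real n - real l) powr (x - 1) / real n powr (x - 1)) \<longlonglongrightarrow> 1"
    by real_asymp
  ultimately have "(\<lambda>n. expseq (\<lambda>_. x) (n - l) / real (n - l) powr (x - 1) * ((real n - real l) powr (x - 1) / real n powr (x - 1))) \<longlonglongrightarrow> 1 / Gamma x * 1"
    by (rule tendsto_mult)
  moreover have "\<forall>\<^sub>F n in sequentially. expseq (\<lambda>_. x) (n - l) / real (n - l) powr (x - 1) * ((real n - real l) powr (x - 1) / real n powr (x - 1)) = expseq (\<lambda>_. x) (n - l) / real n powr (x - 1)"
    using eventually_gt_at_top[of l] by eventually_elim (simp add: of_nat_diff)
  ultimately show ?thesis by (simp add: tendsto_cong)
qed

text \<open>n times the coefficient is the convolution of the null sequence \<open>r\<close> with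
  the absolutely summable \<open>expseq r\<close>.\<close>

lemma expseq_null:
  assumes r: "r \<longlonglongrightarrow> 0" and s: "summable (\<lambda>l. \<bar>r l / l\<bar>)"
  shows "(\<lambda>n. real n * expseq r n) \<longlonglongrightarrow> 0"
proof -
  obtain M where M: "\<And>l. \<bar>r l\<bar> \<le> M"
    using LIMSEQ_abs_bounded[OF r] by blast
  have M0: "M \<ge> 0" using M[of 0] by linarith
  let ?f = "\<lambda>k n. if k < n then r (n - k) * expseq r k else 0"
  have "(\<lambda>n. \<Sum>k. ?f k n) \<longlonglongrightarrow> (\<Sum>k. 0)"
  proof (rule tannerys_theorem[where M = "\<lambda>k. M * \<bar>expseq r k\<bar>", THEN conjunct2, THEN conjunct2])
    fix k
    have "(\<lambda>n. r (n - k)) \<longlonglongrightarrow> 0"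
      using r filterlim_minus_const_nat_at_top by (rule filterlim_compose)
    then have "(\<lambda>n. r (n - k) * expseq r k) \<longlonglongrightarrow> 0" by (rule tendsto_mult_left_zero)
    moreover have "\<forall>\<^sub>F n in sequentially. r (n - k) * expseq r k = ?f k n"
      using eventually_gt_at_top[of k] by eventually_elim auto
    ultimately show "?f k \<longlonglongrightarrow> 0" by (rule Lim_transform_eventually)
  next
    show "\<forall>\<^sub>F (k, n) in at_top \<times>\<^sub>F sequentially. norm (?f k n) \<le> M * \<bar>expseq r k\<bar>"
      using M M0 by (intro always_eventually) (auto simp: abs_mult intro!: mult_right_mono)
  qed (use expseq_sums(1)[OF s] in \<open>auto intro!: summable_mult\<close>)
  moreover have "(\<Sum>k. ?f k n) = real n * expseq r n" for n
  proof -
    have "(\<Sum>k. ?f k n) = (\<Sum>k<n. ?f k n)" by (rule suminf_finite) auto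
    also have "\<dots> = (\<Sum>l\<in>{1..n}. r l * expseq r (n - l))"
      by (rule sum.reindex_bij_witness[of _ "\<lambda>i. n - i" "\<lambda>i. n - i"]) auto
    finally show ?thesis by (simp add: expseq_rec)
  qed
  ultimately show ?thesis by simp
qed

text \<open>The series is (1 - z)^(-x) times the exponential of r_l = t_l - x, whose coefficients
  are absolutely summable with sum exp(\<Sum> r_l / l). For l \<le> n/2 the model coefficient of
  index n - l has the right order and dominated convergence applies. For l > n/2 that index may be
  small, but there \<open>expseq r l\<close> is o(1/n) by \<open>expseq_null\<close>, while the
  model coefficients sum to O(n^x).\<close>

lemma expseq_asymp:
  fixes x :: real
  assumes x: "x > 0" and r: "(\<lambda>l. t l - x) \<longlonglongrightarrow> 0" and s: "summable (\<lambda>l. \<bar>(t l - x) / l\<bar>)"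
  shows "(\<lambda>n. expseq t n / real n powr (x - 1)) \<longlonglongrightarrow> exp (\<Sum>l. (t l - x) / l) / Gamma x"
proof -
  define r where "r = (\<lambda>l. t l - x)"
  let ?P = "expseq (\<lambda>_. x)"
  have dec: "expseq t n = (\<Sum>l\<le>n. expseq r l * ?P (n - l))" for n
    using expseq_add[of r "\<lambda>_. x" n] by (simp add: r_def)
  have sr: "summable (\<lambda>l. \<bar>r l / l\<bar>)" and r0: "r \<longlonglongrightarrow> 0" using assms by (auto simp: r_def)
  have Ppos: "?P n > 0" for n using x by (rule expseq_const_pos)
  obtain P where P: "\<And>n. \<bar>?P n / real n powr (x - 1)\<bar> \<le> P"
    using LIMSEQ_abs_bounded[OF expseq_const_asymp[OF x]] by blast
  have P0: "P \<ge> 0" using P[of 0] by linarith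
  \<comment> \<open>For l \<le> n/2 the index n - l lies between n/2 and n; which end is worst for
    the power x - 1 depends on its sign.\<close>
  define M where "M = max 1 (2 powr (1 - x))"
  have half: "?P (n - l) / real n powr (x - 1) \<le> P * M" if "2 * l \<le> n" for n l
  proof (cases "n = 0")
    case False
    have k: "n - l > 0" "n - l \<le> n" "real (n - l) \<ge> n / 2" using that False by (auto simp: of_nat_diff)
    have "real (n - l) powr (x - 1) \<le> M * real n powr (x - 1)"
    proof (cases "x \<ge> 1")
      case True
      then have "real (n - l) powr (x - 1) \<le> real n powr (x - 1)" using k by (intro powr_mono2) auto
      also have "\<dots> \<le> M * real n powr (x - 1)"
        using mult_right_mono[of 1 M "real n powr (x - 1)"] by (simp add: M_def)
      finally show ?thesis .
    next
      case False
      then have "real (n - l) powr (x - 1) \<le> (real n / 2) powr (x - 1)"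
        using k \<open>n \<noteq> 0\<close> by (intro powr_mono2') auto
      also have "\<dots> = 2 powr (1 - x) * real n powr (x - 1)"
        by (simp add: powr_divide powr_diff)
      also have "\<dots> \<le> M * real n powr (x - 1)" by (intro mult_right_mono) (auto simp: M_def)
      finally show ?thesis .
    qed
    then have "P * real (n - l) powr (x - 1) \<le> P * (M * real n powr (x - 1))"
      using P0 by (rule mult_left_mono)
    moreover have "?P (n - l) \<le> P * real (n - l) powr (x - 1)"
      using P[of "n - l"] k by (simp add: divide_le_eq)
    ultimately show ?thesis using False by (simp add: divide_le_eq mult_ac)
  qed (use P0 in \<open>auto simp: M_def\<close>)
  let ?f = "\<lambda>l n. if 2 * l \<le> n then expseq r l * (?P (n - l) / real n powr (x - 1)) else 0"
  have 1: "(\<lambda>n. \<Sum>l. ?f l n) \<longlonglongrightarrow> (\<Sum>l. expseq r l * (1 / Gamma x))"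
  proof (rule tannerys_theorem[where M = "\<lambda>l. \<bar>expseq r l\<bar> * (P * M)", THEN conjunct2, THEN conjunct2])
    fix l
    have "(\<lambda>n. expseq r l * (?P (n - l) / real n powr (x - 1))) \<longlonglongrightarrow> expseq r l * (1 / Gamma x)"
      by (intro tendsto_mult_left expseq_const_asymp_shift x)
    moreover have "\<forall>\<^sub>F n in sequentially. expseq r l * (?P (n - l) / real n powr (x - 1)) = ?f l n"
      using eventually_ge_at_top[of "2 * l"] by eventually_elim auto
    ultimately show "?f l \<longlonglongrightarrow> expseq r l * (1 / Gamma x)" by (rule Lim_transform_eventually)
  next
    have "norm (?f l n) \<le> \<bar>expseq r l\<bar> * (P * M)" for l n
    proof (cases "2 * l \<le> n")
      case True
      have "\<bar>?P (n - l) / real n powr (x - 1)\<bar> \<le> P * M"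
        using half[OF True] Ppos[of "n - l"] by (simp add: less_imp_le)
      then show ?thesis using True unfolding if_P[OF True] real_norm_def
        by (subst abs_mult) (rule mult_left_mono, auto)
    qed (use P0 in \<open>auto simp: M_def\<close>)
    then show "\<forall>\<^sub>F (l, n) in at_top \<times>\<^sub>F sequentially. norm (?f l n) \<le> \<bar>expseq r l\<bar> * (P * M)"
      by (intro always_eventually) auto
  qed (use expseq_sums(1)[OF sr] in \<open>auto intro!: summable_mult2\<close>)
  have 2: "(\<lambda>n. (\<Sum>l | l \<le> n \<and> n < 2 * l. expseq r l * (?P (n - l) / real n powr (x - 1)))) \<longlonglongrightarrow> 0"
  proof (rule LIMSEQ_I)
    fix e :: real assume e: "e > 0"
    have "(\<lambda>n. (2 / real n) * (real (Suc n) * ?P (Suc n) / x) / real n powr (x - 1)) \<longlonglongrightarrow> 2 * (1 / Gamma x) * 1 / x"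
    proof -
      have "(\<lambda>n. 2 * (?P (Suc n) / real (Suc n) powr (x - 1)) * (real (Suc n) powr x / real n powr x) / x) \<longlonglongrightarrow> 2 * (1 / Gamma x) * 1 / x"
        using x by (intro tendsto_intros filterlim_compose[OF expseq_const_asymp[OF x] filterlim_Suc]) (auto, real_asymp)
      moreover have "\<forall>\<^sub>F n in sequentially. 2 * (?P (Suc n) / real (Suc n) powr (x - 1)) * (real (Suc n) powr x / real n powr x) / x
         = (2 / real n) * (real (Suc n) * ?P (Suc n) / x) / real n powr (x - 1)"
        using eventually_gt_at_top[of 0] by eventually_elim (use x in \<open>simp add: powr_diff field_simps del: of_nat_Suc\<close>)
      ultimately show ?thesis by (rule Lim_transform_eventually)
    qed
    then obtain S where S: "\<And>n. \<bar>(2 / real n) * (real (Suc n) * ?P (Suc n) / x) / real n powr (x - 1)\<bar> \<le> S"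
      by (blast dest: LIMSEQ_abs_bounded)
    have S0: "S \<ge> 0" using order_trans[OF abs_ge_zero S[of 0]] .
    define e' where "e' = e / (S + 1)"
    have e': "e' > 0" using e S0 by (simp add: e'_def)
    obtain L where L: "\<And>l. l \<ge> L \<Longrightarrow> \<bar>real l * expseq r l\<bar> < e'"
      using LIMSEQ_D[OF expseq_null[OF r0 sr] e'] by auto
    have "norm ((\<Sum>l | l \<le> n \<and> n < 2 * l. expseq r l * (?P (n - l) / real n powr (x - 1))) - 0) < e" if n: "n \<ge> 2 * L + 1" for n
    proof -
      have "\<bar>\<Sum>l | l \<le> n \<and> n < 2 * l. expseq r l * (?P (n - l) / real n powr (x - 1))\<bar> \<le>
         (\<Sum>l | l \<le> n \<and> n < 2 * l. \<bar>expseq r l * (?P (n - l) / real n powr (x - 1))\<bar>)" by (rule sum_abs)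
      also have "\<dots> \<le> (\<Sum>l | l \<le> n \<and> n < 2 * l. (2 / real n) * e' * (?P (n - l) / real n powr (x - 1)))"
      proof (intro sum_mono)
        fix l assume l: "l \<in> {l. l \<le> n \<and> n < 2 * l}"
        then have "\<bar>real l * expseq r l\<bar> < e'" using n by (intro L) auto
        then have "\<bar>expseq r l\<bar> \<le> e' / l" using l by (auto simp: abs_mult field_simps)
        also have "\<dots> \<le> e' * (2 / n)" using l n e' unfolding divide_inverse
          by (intro mult_left_mono) (auto simp: field_simps)
        finally have "\<bar>expseq r l\<bar> \<le> (2 / real n) * e'" by (simp add: mult_ac)
        then show "\<bar>expseq r l * (?P (n - l) / real n powr (x - 1))\<bar> \<le> (2 / real n) * e' * (?P (n - l) / real n powr (x - 1))"
          unfolding abs_mult using Ppos[of "n - l"] by (intro mult_mono) (auto simp: less_imp_le)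
      qed
      also have "\<dots> \<le> (\<Sum>l\<le>n. (2 / real n) * e' * (?P (n - l) / real n powr (x - 1)))"
        using e' Ppos by (intro sum_mono2) (auto intro!: divide_nonneg_nonneg mult_nonneg_nonneg simp: less_imp_le)
      also have "\<dots> = (2 / real n) * e' * ((\<Sum>l\<le>n. ?P (n - l)) / real n powr (x - 1))"
        by (simp add: sum_distrib_left sum_divide_distrib)
      also have "(\<Sum>l\<le>n. ?P (n - l)) = (\<Sum>k\<le>n. ?P k)"
        by (rule sum.reindex_bij_witness[of _ "\<lambda>i. n - i" "\<lambda>i. n - i"]) auto
      also have "\<dots> = real (Suc n) * ?P (Suc n) / x"
        using sum_expseq_const[of x n] x by (simp add: field_simps)
      also have "(2 / real n) * e' * (real (Suc n) * ?P (Suc n) / x / real n powr (x - 1))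
         = e' * ((2 / real n) * (real (Suc n) * ?P (Suc n) / x) / real n powr (x - 1))" by (simp add: mult_ac)
      also have "\<dots> \<le> e' * S" using order_trans[OF abs_ge_self S[of n]] e' by (intro mult_left_mono) auto
      also have "\<dots> < e" using e S0 by (simp add: e'_def field_simps)
      finally show ?thesis by simp
    qed
    then show "\<exists>no. \<forall>n\<ge>no. norm ((\<Sum>l | l \<le> n \<and> n < 2 * l. expseq r l * (?P (n - l) / real n powr (x - 1))) - 0) < e"
      by blast
  qed
  have "(\<Sum>l. ?f l n) + (\<Sum>l | l \<le> n \<and> n < 2 * l. expseq r l * (?P (n - l) / real n powr (x - 1))) = expseq t n / real n powr (x - 1)" for n
  proof -
    have "(\<Sum>l. ?f l n) = (\<Sum>l | l \<le> n \<and> 2 * l \<le> n. ?f l n)" by (rule suminf_finite) auto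
    also have "\<dots> = (\<Sum>l | l \<le> n \<and> 2 * l \<le> n. expseq r l * (?P (n - l) / real n powr (x - 1)))"
      by (intro sum.cong) auto
    finally have "(\<Sum>l. ?f l n) + (\<Sum>l | l \<le> n \<and> n < 2 * l. expseq r l * (?P (n - l) / real n powr (x - 1)))
      = (\<Sum>l\<le>n. expseq r l * (?P (n - l) / real n powr (x - 1)))"
    proof -
      have eq: "{..n} = {l. l \<le> n \<and> 2 * l \<le> n} \<union> {l. l \<le> n \<and> n < 2 * l}" by auto
      assume "(\<Sum>l. ?f l n) = (\<Sum>l | l \<le> n \<and> 2 * l \<le> n. expseq r l * (?P (n - l) / real n powr (x - 1)))"
      then show ?thesis unfolding eq by (subst sum.union_disjoint) auto
    qed
    then show ?thesis by (simp add: dec sum_divide_distrib)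
  qed
  then have "(\<lambda>n. expseq t n / real n powr (x - 1)) \<longlonglongrightarrow> (\<Sum>l. expseq r l * (1 / Gamma x)) + 0"
    using tendsto_add[OF 1 2] by simp
  also have "(\<Sum>l. expseq r l * (1 / Gamma x)) = exp (\<Sum>l. r l / l) / Gamma x"
    using sums_mult2[OF expseq_sums(2)[OF sr], of "1 / Gamma x"] by (simp add: sums_iff)
  finally show ?thesis by (simp add: r_def)
qed

text \<open>The bound has to include small indices, so \<open>expseq t\<close> is compared with the
  coefficients of (1 - z)^(-x), which never vanish and have explicit partial sums.\<close>

lemma expseq_partial_sums:
  fixes x :: real
  assumes x: "x > 0" and r: "(\<lambda>l. t l - x) \<longlonglongrightarrow> 0" and s: "summable (\<lambda>l. \<bar>(t l - x) / l\<bar>)"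
  obtains S where "S > 0" "\<And>n. n \<ge> 1 \<Longrightarrow> (\<Sum>k\<le>n. expseq t k) \<le> S * real n powr x"
proof -
  let ?P = "expseq (\<lambda>_. x)"
  have G: "Gamma x > 0" using x by (rule Gamma_real_pos)
  have "(\<lambda>n. (expseq t n / real n powr (x - 1)) / (?P n / real n powr (x - 1))) \<longlonglongrightarrow> exp (\<Sum>l. (t l - x) / l) / Gamma x / (1 / Gamma x)"
    using G by (intro tendsto_divide expseq_asymp expseq_const_asymp assms) auto
  moreover have "\<forall>\<^sub>F n in sequentially. (expseq t n / real n powr (x - 1)) / (?P n / real n powr (x - 1)) = expseq t n / ?P n"
    using eventually_gt_at_top[of 0] by eventually_elim simp
  ultimately have "(\<lambda>n. expseq t n / ?P n) \<longlonglongrightarrow> exp (\<Sum>l. (t l - x) / l) / Gamma x / (1 / Gamma x)"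
    by (rule Lim_transform_eventually)
  then obtain Q where Q: "\<And>n. \<bar>expseq t n / ?P n\<bar> \<le> Q"
    by (blast dest: LIMSEQ_abs_bounded)
  have Q0: "Q \<ge> 0" using Q[of 0] by linarith
  have Ppos: "?P n > 0" for n using x by (rule expseq_const_pos)
  have "(\<lambda>n. (?P (Suc n) / real (Suc n) powr (x - 1)) * (real (Suc n) powr x / real n powr x) / x) \<longlonglongrightarrow> (1 / Gamma x) * 1 / x"
    using x by (intro tendsto_intros filterlim_compose[OF expseq_const_asymp[OF x] filterlim_Suc]) (auto, real_asymp)
  then obtain S where S: "\<And>n. \<bar>(?P (Suc n) / real (Suc n) powr (x - 1)) * (real (Suc n) powr x / real n powr x) / x\<bar> \<le> S"
    by (blast dest: LIMSEQ_abs_bounded)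
  have S0: "S \<ge> 0" using order_trans[OF abs_ge_zero S[of 0]] .
  have "(\<Sum>k\<le>n. expseq t k) \<le> (Q * S + 1) * real n powr x" if n: "n \<ge> 1" for n
  proof -
    have "expseq t k \<le> Q * ?P k" for k
      using Q[of k] Ppos[of k] by (simp add: abs_le_iff divide_le_eq)
    then have "(\<Sum>k\<le>n. expseq t k) \<le> (\<Sum>k\<le>n. Q * ?P k)" by (rule sum_mono)
    also have "\<dots> = Q * (real (Suc n) * ?P (Suc n) / x)"
      using sum_expseq_const[of x n] x by (simp add: sum_distrib_left[symmetric] field_simps)
    also have "real (Suc n) * ?P (Suc n) / x = (?P (Suc n) / real (Suc n) powr (x - 1)) * (real (Suc n) powr x / real n powr x) / x * real n powr x"
      using n x by (simp add: powr_diff del: of_nat_Suc)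
    also have "Q * \<dots> \<le> Q * (S * real n powr x)"
      using order_trans[OF abs_ge_self S[of n]] Q0 by (intro mult_left_mono mult_right_mono) auto
    also have "\<dots> \<le> (Q * S + 1) * real n powr x" by (simp add: algebra_simps)
    finally show ?thesis .
  qed
  then show ?thesis using that[of "Q * S + 1"] Q0 S0 by (auto simp: add_nonneg_pos)
qed

subsection \<open>Asymptotics of the partition functions\<close>

lemma powr_bounded_on:
  fixes a b e :: real assumes "a > 0"
  shows "\<exists>B>0. \<forall>x\<in>{a..b}. x powr e \<le> B"
proof -
  have "x powr e \<le> a powr e + b powr e" if "x \<in> {a..b}" for x
  proof (cases "e \<ge> 0")
    case True
    then have "x powr e \<le> b powr e" using that assms by (intro powr_mono2) auto
    then show ?thesis by (simp add: add_increasing)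
  next
    case False
    then have "x powr e \<le> a powr e" using that assms by (intro powr_mono2') auto
    then show ?thesis by (simp add: add_increasing2)
  qed
  then show ?thesis using assms by (intro exI[of _ "a powr e + b powr e"]) (auto intro!: add_pos_nonneg)
qed

locale condensation = compound_poisson +
  fixes t :: "nat \<Rightarrow> real" and \<theta>s A s :: real
  assumes t_nonneg: "\<And>l. t l \<ge> 0" and ths_pos: "\<theta>s > 0"
    and t_lim: "(\<lambda>l. t l - \<theta>s) \<longlonglongrightarrow> 0" and t_summable: "summable (\<lambda>l. \<bar>(t l - \<theta>s) / l\<bar>)"
    and c_bound: "\<And>l. l \<ge> 1 \<Longrightarrow> c l \<le> A * real l powr (-s)" and s_gt: "s > 1"
    and mu_less: "\<mu> < 1"
begin

definition C :: real where "C = exp (\<Sum>l. (t l - \<theta>s) / l) / Gamma \<theta>s"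
definition q :: "nat \<Rightarrow> nat \<Rightarrow> real" where "q N = expseq (\<lambda>l. t l + N * c l)"
text \<open>The factors taken out depend on \<open>N\<close> only and cancel in ratios; what remains
  is close to C (n/N - \<mu>)^(\<theta>s - 1) above the critical size \<mu> N.\<close>

definition qn :: "nat \<Rightarrow> nat \<Rightarrow> real" where "qn N n = q N n * exp (- (N * g1)) / N powr (\<theta>s - 1)"

lemma C_pos: "C > 0"
  using Gamma_real_pos[OF ths_pos] by (simp add: C_def)

lemma expseq_t_asymp: "(\<lambda>n. expseq t n / real n powr (\<theta>s - 1)) \<longlonglongrightarrow> C"
  unfolding C_def by (rule expseq_asymp[OF ths_pos t_lim t_summable])

lemma expseq_t_nonneg: "expseq t n \<ge> 0"
  by (rule expseq_nonneg) (rule t_nonneg)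

text \<open>This is E b_(n-S) with S of law \<open>p N\<close> and b = \<open>expseq t\<close>, set
  to 0 at negative indices.\<close>

lemma q_conv: "q N n * exp (- (N * g1)) = (\<Sum>j\<le>n. p N j * expseq t (n - j))"
proof -
  have "q N n = (\<Sum>j\<le>n. expseq (\<lambda>l. N * c l) j * expseq t (n - j))"
    unfolding q_def using expseq_add[of "\<lambda>l. N * c l" t n] by (simp add: add.commute)
  then show ?thesis by (simp add: p_def sum_distrib_left mult_ac)
qed

text \<open>Uniform continuity of the power on a compact interval away from 0 gives uniformity in
  \<open>y\<close>. It is meant for S near its mean, with k = n - S and y = n/N - \<mu>.\<close>

lemma expseq_t_uniform:
  fixes \<epsilon> e :: real
  assumes eps: "\<epsilon> > 0" and e: "e > 0"
  shows "\<exists>\<gamma>>0. \<gamma> \<le> \<epsilon> / 2 \<and> (\<forall>\<^sub>F N in sequentially. \<forall>k y. \<epsilon> \<le> y \<and> y \<le> 1 \<and> \<bar>real k / N - y\<bar> \<le> \<gamma> \<longrightarrow>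
           \<bar>expseq t k / N powr (\<theta>s - 1) - C * y powr (\<theta>s - 1)\<bar> \<le> e)"
proof -
  obtain B where B: "B > 0" "\<And>x. x \<in> {\<epsilon>/2..1+\<epsilon>} \<Longrightarrow> x powr (\<theta>s - 1) \<le> B"
    using powr_bounded_on[of "\<epsilon>/2" "1+\<epsilon>" "\<theta>s - 1"] eps by auto
  define e1 where "e1 = e / (2 * B)"
  define e2 where "e2 = e / (2 * C)"
  have e12: "e1 > 0" "e2 > 0" using e B C_pos by (auto simp: e1_def e2_def)
  have "continuous_on {\<epsilon>/2..1+\<epsilon>} (\<lambda>x. x powr (\<theta>s - 1))"
    using eps by (intro continuous_intros) auto
  then have "uniformly_continuous_on {\<epsilon>/2..1+\<epsilon>} (\<lambda>x. x powr (\<theta>s - 1))"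
    by (rule compact_uniformly_continuous) auto
  with e12 obtain d where d: "d > 0" "\<And>x y. x \<in> {\<epsilon>/2..1+\<epsilon>} \<Longrightarrow> y \<in> {\<epsilon>/2..1+\<epsilon>} \<Longrightarrow> \<bar>x - y\<bar> < d \<Longrightarrow> \<bar>x powr (\<theta>s - 1) - y powr (\<theta>s - 1)\<bar> < e2"
    unfolding uniformly_continuous_on_def dist_real_def by metis
  define \<gamma> where "\<gamma> = min (d / 2) (\<epsilon> / 2)"
  obtain K where K: "\<And>k. k \<ge> K \<Longrightarrow> \<bar>expseq t k / real k powr (\<theta>s - 1) - C\<bar> < e1"
    using LIMSEQ_D[OF expseq_t_asymp e12(1)] by auto
  have "\<forall>\<^sub>F N in sequentially. \<epsilon> / 2 * real N \<ge> K + 1" using eps by real_asymp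
  then have "\<forall>\<^sub>F N in sequentially. \<forall>k y. \<epsilon> \<le> y \<and> y \<le> 1 \<and> \<bar>real k / N - y\<bar> \<le> \<gamma> \<longrightarrow>
           \<bar>expseq t k / N powr (\<theta>s - 1) - C * y powr (\<theta>s - 1)\<bar> \<le> e"
    using eventually_gt_at_top[of 0]
  proof eventually_elim
    case (elim N)
    show ?case
    proof (intro allI impI)
      fix k :: nat and y :: real
      assume *: "\<epsilon> \<le> y \<and> y \<le> 1 \<and> \<bar>real k / N - y\<bar> \<le> \<gamma>"
      define x where "x = real k / N"
      have xy: "x \<in> {\<epsilon>/2..1+\<epsilon>}" "y \<in> {\<epsilon>/2..1+\<epsilon>}" "\<bar>x - y\<bar> < d"
        using * eps d by (auto simp: x_def[symmetric] \<gamma>_def min_def abs_le_iff split: if_splits)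
      have kx: "real k = x * N" using elim by (simp add: x_def)
      have "\<epsilon> / 2 * N \<le> x * N" using xy by (intro mult_right_mono) auto
      then have kK: "k \<ge> K" "k > 0" using elim kx by linarith+
      have "expseq t k / N powr (\<theta>s - 1) = (expseq t k / real k powr (\<theta>s - 1)) * x powr (\<theta>s - 1)"
        using kK elim unfolding x_def by (simp add: powr_divide)
      then have "expseq t k / N powr (\<theta>s - 1) - C * y powr (\<theta>s - 1) =
        (expseq t k / real k powr (\<theta>s - 1) - C) * x powr (\<theta>s - 1) + C * (x powr (\<theta>s - 1) - y powr (\<theta>s - 1))"
        by (simp add: algebra_simps)
      also have "\<bar>\<dots>\<bar> \<le> \<bar>expseq t k / real k powr (\<theta>s - 1) - C\<bar> * x powr (\<theta>s - 1) + C * \<bar>x powr (\<theta>s - 1) - y powr (\<theta>s - 1)\<bar>"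
        using C_pos by (intro order_trans[OF abs_triangle_ineq]) (simp add: abs_mult)
      also have "\<dots> \<le> e1 * B + C * e2"
        using K[OF kK(1)] d(2)[OF xy] B(2)[OF xy(1)] C_pos e12
        by (intro add_mono mult_mono) auto
      also have "\<dots> = e" using B C_pos by (simp add: e1_def e2_def field_simps)
      finally show "\<bar>expseq t k / N powr (\<theta>s - 1) - C * y powr (\<theta>s - 1)\<bar> \<le> e" .
    qed
  qed
  then show ?thesis using eps d by (intro exI[of _ \<gamma>]) (auto simp: \<gamma>_def)
qed

lemma expseq_t_bounded:
  fixes a :: real
  assumes a: "a > 0"
  shows "\<exists>B>0. \<forall>\<^sub>F N in sequentially. \<forall>k. a * real N \<le> k \<and> k \<le> N \<longrightarrow> expseq t k / N powr (\<theta>s - 1) \<le> B"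
proof -
  obtain M where M: "\<And>n. \<bar>expseq t n / real n powr (\<theta>s - 1)\<bar> \<le> M"
    using LIMSEQ_abs_bounded[OF expseq_t_asymp] by blast
  obtain B where B: "B > 0" "\<And>x. x \<in> {a..1} \<Longrightarrow> x powr (\<theta>s - 1) \<le> B"
    using powr_bounded_on[of a 1 "\<theta>s - 1"] a by auto
  have "\<forall>\<^sub>F N in sequentially. \<forall>k. a * real N \<le> k \<and> k \<le> N \<longrightarrow> expseq t k / N powr (\<theta>s - 1) \<le> (M + 1) * B"
    using eventually_gt_at_top[of 0]
  proof eventually_elim
    case (elim N)
    show ?case
    proof (intro allI impI)
      fix k :: nat assume k: "a * real N \<le> k \<and> k \<le> N"
      define x where "x = real k / N"
      have "0 < a * real N" using a elim by simp
      then have k0: "k > 0" using k by linarith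
      have x: "x \<in> {a..1}" using k elim by (auto simp: x_def field_simps)
      have "expseq t k / N powr (\<theta>s - 1) = (expseq t k / real k powr (\<theta>s - 1)) * x powr (\<theta>s - 1)"
        using k0 elim unfolding x_def by (simp add: powr_divide)
      also have "\<dots> \<le> (M + 1) * B"
        using order_trans[OF abs_ge_self M[of k]] order_trans[OF abs_ge_zero M[of k]] B(2)[OF x] B(1) by (intro mult_mono) auto
      finally show "expseq t k / N powr (\<theta>s - 1) \<le> (M + 1) * B" .
    qed
  qed
  moreover have "M \<ge> 0" using order_trans[OF abs_ge_zero M[of 0]] .
  ultimately show ?thesis using B by (intro exI[of _ "(M + 1) * B"]) auto
qed

text \<open>The values j of S fall into three ranges. Within \<gamma> N of \<mu> N, b_(n-j) is
  uniformly close to its target. Outside, but with n - j \<ge> \<epsilon> N / 2, it is bounded on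
  the scale N^(\<theta>s - 1), and the law of large numbers makes the mass small. For n - j <
  \<epsilon> N / 2 it may be much larger, so \<open>p_local\<close> is paired with the bound on the
  partial sums of b.\<close>

lemma qn_uniform:
  fixes \<epsilon> e :: real
  assumes eps: "\<epsilon> > 0" and e: "e > 0"
  shows "\<forall>\<^sub>F N in sequentially. \<forall>n. (\<mu> + \<epsilon>) * N \<le> n \<and> n \<le> N \<longrightarrow>
           \<bar>qn N n - C * (n / N - \<mu>) powr (\<theta>s - 1)\<bar> \<le> e"
proof -
  obtain B1 where B1: "B1 > 0" "\<forall>\<^sub>F N in sequentially. \<forall>k. \<epsilon>/2 * real N \<le> k \<and> k \<le> N \<longrightarrow> expseq t k / N powr (\<theta>s - 1) \<le> B1"
    using expseq_t_bounded[of "\<epsilon>/2"] eps by auto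
  obtain B2 where B2: "B2 > 0" "\<And>x. x \<in> {\<epsilon>..1} \<Longrightarrow> x powr (\<theta>s - 1) \<le> B2"
    using powr_bounded_on[of \<epsilon> 1 "\<theta>s - 1"] eps by auto
  define B where "B = B1 + C * B2"
  have B: "B > 0" using B1 B2 C_pos by (simp add: B_def add_pos_pos)
  obtain S where S: "S > 0" "\<And>n. n \<ge> 1 \<Longrightarrow> (\<Sum>k\<le>n. expseq t k) \<le> S * real n powr \<theta>s"
    using expseq_partial_sums[OF ths_pos t_lim t_summable] by blast
  obtain \<gamma> where \<gamma>: "\<gamma> > 0" "\<gamma> \<le> \<epsilon> / 2" "\<forall>\<^sub>F N in sequentially. \<forall>k y. \<epsilon> \<le> y \<and> y \<le> 1 \<and> \<bar>real k / N - y\<bar> \<le> \<gamma> \<longrightarrow>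
           \<bar>expseq t k / N powr (\<theta>s - 1) - C * y powr (\<theta>s - 1)\<bar> \<le> e / 4"
    using expseq_t_uniform[OF eps, of "e/4"] e by auto
  have "e / (4 * B) > 0" using e B by auto
  note lln = p_lln[OF \<gamma>(1) this]
  have e': "e / (4 * S) > 0" using e S by auto
  have eps2: "\<epsilon> / 2 > 0" using eps by simp
  have loc: "\<forall>\<^sub>F N in sequentially. \<forall>j. real j \<ge> (\<mu> + \<epsilon> / 2) * N \<longrightarrow> N * p N j \<le> e / (4 * S)"
    by (rule p_local[OF c_bound s_gt eps2 e'])
  show ?thesis using B1(2) \<gamma>(3) lln loc eventually_gt_at_top[of 0]
  proof eventually_elim
    case (elim N)
    show ?case
    proof (intro allI impI)
      fix n :: nat assume n: "(\<mu> + \<epsilon>) * N \<le> n \<and> n \<le> N"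
      have N: "real N > 0" using elim by simp
      define y where "y = n / N - \<mu>"
      have "real n / N \<le> 1" using n N by simp
      moreover have "\<mu> + \<epsilon> \<le> real n / N" using n N by (simp add: le_divide_eq)
      ultimately have y: "y \<in> {\<epsilon>..1}" using mu_nonneg by (auto simp: y_def)
      define Y where "Y = C * y powr (\<theta>s - 1)"
      have Y: "0 \<le> Y" "Y \<le> C * B2" using B2(2)[OF y] C_pos by (auto simp: Y_def)
      define v where "v k = expseq t k / N powr (\<theta>s - 1)" for k
      have v: "v k \<ge> 0" for k using expseq_t_nonneg by (simp add: v_def)
      let ?w = "\<lambda>j. if j \<le> n then p N j * v (n - j) else 0"
      let ?far = "\<lambda>j. if \<bar>j - \<mu> * N\<bar> > \<gamma> * N then p N j else 0"
      \<comment> \<open>Third range: p N j \<le> e / (4 S N) there, and the b_k sum to at most S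
        N^\<theta>s, so this part contributes at most e/4.\<close>
      let ?tail = "\<lambda>j. if j \<le> n then e / (4 * S) / N * v (n - j) else 0"
      have sw: "?w sums qn N n"
      proof -
        have "?w sums (\<Sum>j\<le>n. ?w j)" by (rule sums_finite) auto
        also have "(\<Sum>j\<le>n. ?w j) = qn N n"
          unfolding qn_def q_conv by (simp add: v_def sum_divide_distrib)
        finally show ?thesis .
      qed
      have st: "?tail sums (\<Sum>j\<le>n. ?tail j)" by (rule sums_finite) auto
      have "(\<Sum>j\<le>n. ?tail j) = e / (4 * S) / N * (\<Sum>j\<le>n. v (n - j))" by (simp add: sum_distrib_left)
      also have "(\<Sum>j\<le>n. v (n - j)) = (\<Sum>k\<le>n. v k)"
        by (rule sum.reindex_bij_witness[of _ "\<lambda>i. n - i" "\<lambda>i. n - i"]) auto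
      also have "\<dots> \<le> (\<Sum>k\<le>N. v k)" using n v by (intro sum_mono2) auto
      also have "\<dots> = (\<Sum>k\<le>N. expseq t k) / N powr (\<theta>s - 1)" by (simp add: v_def sum_divide_distrib)
      also have "\<dots> \<le> S * real N powr \<theta>s / N powr (\<theta>s - 1)"
        using S(2)[of N] elim by (intro divide_right_mono) auto
      also have "\<dots> = S * N" using N by (simp add: powr_diff)
      finally have tail: "(\<Sum>j\<le>n. ?tail j) \<le> e / 4"
        using e' N S by (simp add: mult_left_mono field_simps)
      have sf: "summable ?far"
        using p_nonneg by (intro summable_comparison_test'[OF p_summable[of N], of 0]) auto
      have tail_nonneg: "?tail j \<ge> 0" for j
        using e S(1) N v by (simp add: divide_nonneg_nonneg mult_nonneg_nonneg)
      have bound: "\<bar>?w j - Y * p N j\<bar> \<le> e / 4 * p N j + B * ?far j + ?tail j" for j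
      proof (cases "\<bar>j - \<mu> * N\<bar> > \<gamma> * N")
        case False
        then have "\<bar>real j - \<mu> * N\<bar> / N \<le> \<gamma>" using N by (simp add: divide_le_eq)
        moreover have "real j / N - \<mu> = (real j - \<mu> * N) / N" using N by (simp add: diff_divide_distrib)
        ultimately have "\<bar>real j / N - \<mu>\<bar> \<le> \<gamma>" using N by (simp add: abs_divide)
        moreover have jn: "j \<le> n"
        proof -
          have "real j \<le> \<mu> * N + \<gamma> * N" using False by linarith
          also have "\<dots> \<le> (\<mu> + \<epsilon>) * N" using \<gamma>(2) eps N by (simp add: algebra_simps)
          finally show ?thesis using n by linarith
        qed
        ultimately have "\<bar>real (n - j) / N - y\<bar> \<le> \<gamma>" by (simp add: y_def of_nat_diff diff_divide_distrib abs_le_iff)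
        then have "\<bar>v (n - j) - Y\<bar> \<le> e / 4" unfolding v_def Y_def using elim y by auto
        then have "\<bar>v (n - j) - Y\<bar> * p N j \<le> e / 4 * p N j" using p_nonneg by (rule mult_right_mono)
        moreover have "\<bar>?w j - Y * p N j\<bar> = \<bar>v (n - j) - Y\<bar> * p N j"
        proof -
          have "?w j - Y * p N j = (v (n - j) - Y) * p N j" using jn by (simp add: algebra_simps)
          then show ?thesis using p_nonneg[of N j] by (simp only: abs_mult abs_of_nonneg)
        qed
        moreover have "?tail j \<ge> 0" by (rule tail_nonneg)
        ultimately show ?thesis using False by simp
      next
        case True
        have w: "?w j \<le> B1 * p N j + ?tail j"
        proof (cases "j \<le> n \<and> n - j < \<epsilon> / 2 * N")
          case True
          then have "real (n - j) = real n - real j" "real (n - j) < \<epsilon> / 2 * N" by auto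
          then have "real j \<ge> n - \<epsilon> / 2 * N" by linarith
          moreover have "n - \<epsilon> / 2 * N \<ge> (\<mu> + \<epsilon> / 2) * N" using n by (simp add: algebra_simps)
          ultimately have "N * p N j \<le> e / (4 * S)" using elim by auto
          then have "p N j \<le> e / (4 * S) / N" using N by (simp only: pos_le_divide_eq mult.commute)
          from mult_right_mono[OF this v[of "n - j"]] have "?w j \<le> ?tail j" using True by simp
          then show ?thesis using B1 p_nonneg[of N j] by (simp add: add_increasing)
        next
          case False
          have "?w j \<le> B1 * p N j"
          proof (cases "j \<le> n")
            case True
            then have "v (n - j) \<le> B1" unfolding v_def using False elim n by auto
            then have "v (n - j) * p N j \<le> B1 * p N j" using p_nonneg by (rule mult_right_mono)
            then show ?thesis using True by (simp add: mult_ac)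
          qed (use B1 p_nonneg in auto)
          moreover have "?tail j \<ge> 0" by (rule tail_nonneg)
          ultimately show ?thesis by linarith
        qed
        have "Y * p N j \<le> C * B2 * p N j" "0 \<le> Y * p N j" "0 \<le> ?w j" "0 \<le> B1 * p N j" "0 \<le> e / 4 * p N j"
          using Y p_nonneg v B1 e by (auto intro!: mult_right_mono mult_nonneg_nonneg)
        moreover have "?tail j \<ge> 0" by (rule tail_nonneg)
        ultimately have "\<bar>?w j - Y * p N j\<bar> \<le> e / 4 * p N j + (B1 * p N j + C * B2 * p N j) + ?tail j"
          using w by linarith
        then show ?thesis using True by (simp add: B_def algebra_simps)
      qed
      have sr: "(\<lambda>j. e / 4 * p N j + B * ?far j + ?tail j) sums (e / 4 * 1 + B * (\<Sum>j. ?far j) + (\<Sum>j\<le>n. ?tail j))"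
        by (intro sums_add sums_mult p_sums summable_sums sf st)
      have sl: "(\<lambda>j. ?w j - Y * p N j) sums (qn N n - Y * 1)"
        by (intro sums_diff sw sums_mult p_sums)
      have sabs: "summable (\<lambda>j. \<bar>?w j - Y * p N j\<bar>)"
        by (rule summable_comparison_test'[OF sums_summable[OF sr], of 0]) (use bound in auto)
      have "\<bar>qn N n - Y\<bar> = \<bar>\<Sum>j. ?w j - Y * p N j\<bar>" using sl by (simp add: sums_iff)
      also have "\<dots> \<le> (\<Sum>j. \<bar>?w j - Y * p N j\<bar>)" by (rule summable_rabs[OF sabs])
      also have "\<dots> \<le> (\<Sum>j. e / 4 * p N j + B * ?far j + ?tail j)"
        by (rule suminf_le[OF bound sabs sums_summable[OF sr]])
      also have "\<dots> = e / 4 * 1 + B * (\<Sum>j. ?far j) + (\<Sum>j\<le>n. ?tail j)" using sr by (rule sums_unique[symmetric])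
      also have "B * (\<Sum>j. ?far j) \<le> B * (e / (4 * B))" using elim B by (intro mult_left_mono) auto
      also have "B * (e / (4 * B)) = e / 4" using B by simp
      finally show "\<bar>qn N n - C * (n / N - \<mu>) powr (\<theta>s - 1)\<bar> \<le> e"
        using tail e by (simp add: Y_def y_def)
    qed
  qed
qed

end

subsection \<open>One step of the chain of cycle lengths\<close>

lemma beta1_real_integral:
  assumes "\<theta>s > 0" "G \<in> borel_measurable lborel"
  shows "integral\<^sup>L (beta1 \<theta>s) G = (\<integral>x. indicator {0<..<1} x * \<theta>s * (1 - x) powr (\<theta>s - 1) * G x \<partial>lborel)"
  unfolding beta1_def using assms
  by (subst integral_density) (auto simp: indicator_def)

text \<open>Writing the sum as the integral of a step function of mesh 1/h makes Riemann sums
  accessible to dominated convergence.\<close>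

lemma integral_floor_step:
  fixes a :: "nat \<Rightarrow> real" and h :: real
  assumes h: "h > 0" and a: "\<And>l. l > n \<Longrightarrow> a l = 0"
  shows "(\<integral>y. indicator {0..} y * a (nat \<lfloor>y * h\<rfloor>) \<partial>lborel) = (\<Sum>l\<le>n. a l) / h"
proof -
  have fl: "y \<in> {real l / h..<real (Suc l) / h} \<longleftrightarrow> y \<ge> 0 \<and> nat \<lfloor>y * h\<rfloor> = l" for y l
  proof -
    have "y \<in> {real l / h..<real (Suc l) / h} \<longleftrightarrow> real l \<le> y * h \<and> y * h < real l + 1"
      using h by (auto simp: field_simps)
    also have "\<dots> \<longleftrightarrow> y * h \<ge> 0 \<and> nat \<lfloor>y * h\<rfloor> = l" by linarith
    also have "y * h \<ge> 0 \<longleftrightarrow> y \<ge> 0" using h by (simp add: zero_le_mult_iff)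
    finally show ?thesis .
  qed
  have "(\<Sum>l\<le>n. a l * indicator {real l / h..<real (Suc l) / h} y) = indicator {0..} y * a (nat \<lfloor>y * h\<rfloor>)" for y
  proof (cases "y \<ge> 0")
    case True
    have "(\<Sum>l\<le>n. a l * indicator {real l / h..<real (Suc l) / h} y) = (\<Sum>l\<le>n. if nat \<lfloor>y * h\<rfloor> = l then a l else 0)"
      using fl[of y] True by (intro sum.cong) (auto simp: indicator_def)
    also have "\<dots> = a (nat \<lfloor>y * h\<rfloor>)" using a[of "nat \<lfloor>y * h\<rfloor>"] by (auto simp: sum.delta)
    finally show ?thesis using True by simp
  next
    case False
    then show ?thesis using fl[of y] by (auto simp: indicator_def intro!: sum.neutral)
  qed
  then have "(\<integral>y. indicator {0..} y * a (nat \<lfloor>y * h\<rfloor>) \<partial>lborel) = (\<integral>y. (\<Sum>l\<le>n. a l * indicator {real l / h..<real (Suc l) / h} y) \<partial>lborel)"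
    by simp
  also have "\<dots> = (\<Sum>l\<le>n. a l * measure lborel {real l / h..<real (Suc l) / h})"
    using h by (subst Bochner_Integration.integral_sum) (auto simp: divide_right_mono)
  also have "\<dots> = (\<Sum>l\<le>n. a l * (1 / h))"
    using h by (intro sum.cong refl arg_cong2[where f = "(*)"]) (auto simp: divide_right_mono field_simps)
  finally show ?thesis by (simp add: sum_divide_distrib)
qed

lemma floor_seq_lim:
  fixes y h :: real
  assumes "y \<ge> 0" "h > 0"
  shows "(\<lambda>N. real (nat \<lfloor>y * (real N * h)\<rfloor>) / (real N * h)) \<longlonglongrightarrow> y"
proof (rule tendsto_sandwich)
  show "\<forall>\<^sub>F N in sequentially. y - 1 / (real N * h) \<le> real (nat \<lfloor>y * (real N * h)\<rfloor>) / (real N * h)"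
    using eventually_gt_at_top[of 0]
  proof eventually_elim
    case (elim N)
    have "y * (real N * h) - 1 \<le> real (nat \<lfloor>y * (real N * h)\<rfloor>)" by linarith
    then have "(y * (real N * h) - 1) / (real N * h) \<le> real (nat \<lfloor>y * (real N * h)\<rfloor>) / (real N * h)"
      using elim assms by (intro divide_right_mono) auto
    then show ?case using elim assms by (simp add: diff_divide_distrib)
  qed
  show "\<forall>\<^sub>F N in sequentially. real (nat \<lfloor>y * (real N * h)\<rfloor>) / (real N * h) \<le> y"
    using eventually_gt_at_top[of 0]
  proof eventually_elim
    case (elim N)
    have "real (nat \<lfloor>y * (real N * h)\<rfloor>) \<le> y * (real N * h)" using assms by (intro of_nat_floor) auto
    then show ?case using elim assms by (simp add: divide_le_eq)
  qed
  show "(\<lambda>N. y - 1 / (real N * h)) \<longlonglongrightarrow> y" using assms by real_asymp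
qed auto

context condensation
begin

definition \<nu> :: real where "\<nu> = 1 - \<mu>"

text \<open>At \<open>n = 0\<close> the chain stays put with length 0, as \<open>Lcyc\<close> does
  once all cycles are exhausted. Where \<open>q N n = 0\<close> division by zero makes the row
  vanish, so in general rows have mass at most 1.\<close>

definition K :: "nat \<Rightarrow> nat \<Rightarrow> nat \<Rightarrow> real" where
  "K N n l = (if n = 0 then (if l = 0 then 1 else 0)
     else if 1 \<le> l \<and> l \<le> n then (t l + N * c l) / n * (q N (n - l) / q N n) else 0)"

lemma nu_pos: "\<nu> > 0" and nu_le: "\<nu> \<le> 1"
  using mu_less mu_nonneg by (auto simp: \<nu>_def)

lemma q_nonneg: "q N n \<ge> 0"
  unfolding q_def by (intro expseq_nonneg add_nonneg_nonneg mult_nonneg_nonneg t_nonneg c_nonneg) auto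

lemma K_nonneg: "K N n l \<ge> 0"
  using q_nonneg t_nonneg c_nonneg by (auto simp: K_def)

lemma sum_K_pos:
  assumes "q N n > 0" shows "(\<Sum>l\<le>n. K N n l) = 1"
proof (cases "n = 0")
  case False
  have "(\<Sum>l\<le>n. K N n l) = (\<Sum>l\<in>{1..n}. (t l + N * c l) / n * (q N (n - l) / q N n))"
    using False by (intro sum.mono_neutral_cong_right) (auto simp: K_def)
  also have "\<dots> = (\<Sum>l\<in>{1..n}. (t l + N * c l) * q N (n - l)) / (n * q N n)"
    by (simp add: sum_divide_distrib)
  also have "(\<Sum>l\<in>{1..n}. (t l + N * c l) * q N (n - l)) = n * q N n"
    unfolding q_def expseq_rec ..
  finally show ?thesis using assms False by simp
qed (simp add: K_def)

lemma sum_K_le: "(\<Sum>l\<le>n. K N n l) \<le> 1"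
proof (cases "q N n > 0 \<or> n = 0")
  case True
  then have "q N n > 0" by (auto simp: q_def)
  then show ?thesis by (simp add: sum_K_pos)
next
  case False
  then have "q N n = 0" using q_nonneg[of N n] by simp
  then have "(\<Sum>l\<le>n. K N n l) = 0" using False by (intro sum.neutral) (auto simp: K_def)
  then show ?thesis by simp
qed

lemma qn_lim:
  assumes n: "\<And>N. n N \<le> N" and x: "(\<lambda>N. real (n N) / N) \<longlonglongrightarrow> x" "x > \<mu>"
  shows "(\<lambda>N. qn N (n N)) \<longlonglongrightarrow> C * (x - \<mu>) powr (\<theta>s - 1)"
proof -
  define \<epsilon> where "\<epsilon> = (x - \<mu>) / 2"
  have eps: "\<epsilon> > 0" using x by (simp add: \<epsilon>_def)
  have "\<forall>\<^sub>F N in sequentially. real (n N) / N > \<mu> + \<epsilon>"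
    using x eps by (intro order_tendstoD(1)[OF x(1)]) (auto simp: \<epsilon>_def field_simps)
  with eventually_gt_at_top[of 0]
  have ev: "\<forall>\<^sub>F N in sequentially. (\<mu> + \<epsilon>) * N \<le> n N"
    by eventually_elim (auto simp: pos_less_divide_eq)
  have "(\<lambda>N. qn N (n N) - C * (real (n N) / N - \<mu>) powr (\<theta>s - 1)) \<longlonglongrightarrow> 0"
  proof (rule tendstoI)
    fix e :: real assume "e > 0"
    with qn_uniform[OF eps, of "e/2"] have "\<forall>\<^sub>F N in sequentially. \<forall>n. (\<mu> + \<epsilon>) * N \<le> n \<and> n \<le> N \<longrightarrow>
           \<bar>qn N n - C * (n / N - \<mu>) powr (\<theta>s - 1)\<bar> \<le> e / 2" by simp
    with ev show "\<forall>\<^sub>F N in sequentially. dist (qn N (n N) - C * (real (n N) / N - \<mu>) powr (\<theta>s - 1)) 0 < e"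
    proof eventually_elim
      case (elim N)
      then have "\<bar>qn N (n N) - C * (real (n N) / N - \<mu>) powr (\<theta>s - 1)\<bar> \<le> e / 2" using n by auto
      then show ?case using \<open>e > 0\<close> by simp
    qed
  qed
  moreover have "(\<lambda>N. C * (real (n N) / N - \<mu>) powr (\<theta>s - 1)) \<longlonglongrightarrow> C * (x - \<mu>) powr (\<theta>s - 1)"
    using x by (intro tendsto_intros) auto
  ultimately show ?thesis using tendsto_add by fastforce
qed

lemma qn_bounded:
  assumes eps: "\<epsilon> > 0"
  shows "\<exists>B>0. \<forall>\<^sub>F N in sequentially. \<forall>n. (\<mu> + \<epsilon>) * real N \<le> n \<and> n \<le> N \<longrightarrow> qn N n \<le> B"
proof -
  obtain B where B: "B > 0" "\<And>x. x \<in> {\<epsilon>..1} \<Longrightarrow> x powr (\<theta>s - 1) \<le> B"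
    using powr_bounded_on[of \<epsilon> 1 "\<theta>s - 1"] eps by auto
  have "\<forall>\<^sub>F N in sequentially. \<forall>n. (\<mu> + \<epsilon>) * real N \<le> n \<and> n \<le> N \<longrightarrow> qn N n \<le> C * B + 1"
    using qn_uniform[OF eps, of 1, simplified] eventually_gt_at_top[of 0]
  proof eventually_elim
    case (elim N)
    show ?case
    proof (intro allI impI)
      fix n :: nat assume n: "(\<mu> + \<epsilon>) * real N \<le> n \<and> n \<le> N"
      have "real n / N \<le> 1" using n elim by simp
      moreover have "\<mu> + \<epsilon> \<le> real n / N" using n elim by (simp add: le_divide_eq)
      ultimately have y: "n / N - \<mu> \<in> {\<epsilon>..1}" using mu_nonneg by auto
      have "\<bar>qn N n - C * (n / N - \<mu>) powr (\<theta>s - 1)\<bar> \<le> 1" using elim n by auto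
      then have "qn N n \<le> C * (n / N - \<mu>) powr (\<theta>s - 1) + 1" by linarith
      also have "\<dots> \<le> C * B + 1" using B(2)[OF y] C_pos by (intro add_right_mono mult_left_mono) auto
      finally show "qn N n \<le> C * B + 1" .
    qed
  qed
  then show ?thesis using B C_pos by (intro exI[of _ "C * B + 1"]) (auto simp: add_pos_pos)
qed

lemma qn_ratio: "N > 0 \<Longrightarrow> qn N m / qn N n = q N m / q N n"
  by (simp add: qn_def)

end

text \<open>One transition from states \<open>n N\<close> of rescaled excess \<eta> over
  criticality, tested with \<open>F\<close>. The restriction y < \<eta> keeps the landing point n -
  l supercritical. Asking for the limit along all integer sequences \<open>l\<close> lets
  \<open>F\<close> depend on \<open>N\<close> and replaces a continuity assumption on
  \<open>G\<close>.\<close>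

locale one_step = condensation +
  fixes n :: "nat \<Rightarrow> nat" and \<eta> M :: real and F :: "nat \<Rightarrow> nat \<Rightarrow> real" and G :: "real \<Rightarrow> real"
  assumes n_le: "\<And>N. n N \<le> N" and n_lim: "(\<lambda>N. (real (n N) / N - \<mu>) / \<nu>) \<longlonglongrightarrow> \<eta>"
    and eta: "0 < \<eta>" "\<eta> \<le> 1"
    and F_bound: "\<And>N l. \<bar>F N l\<bar> \<le> M"
    and F_lim: "\<And>(l :: nat \<Rightarrow> nat) y. 0 \<le> y \<Longrightarrow> y < \<eta> \<Longrightarrow> (\<lambda>N. real (l N) / (real N * \<nu>)) \<longlonglongrightarrow> y \<Longrightarrow> (\<lambda>N. F N (l N)) \<longlonglongrightarrow> G y"
begin

abbreviation ratio :: "nat \<Rightarrow> nat \<Rightarrow> real" where "ratio N l \<equiv> q N (n N - l) / q N (n N)"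
abbreviation near :: "real \<Rightarrow> nat \<Rightarrow> nat set" where
  "near \<epsilon> N \<equiv> {l. 1 \<le> l \<and> l \<le> n N \<and> real l \<le> (\<eta> - \<epsilon>) * (real N * \<nu>)}"

definition x :: real where "x = \<mu> + \<nu> * \<eta>"
text \<open>Limit density on (0, \<eta>) of the rescaled length of a macroscopic next cycle. Its
  mass is \<open>ustar \<nu> \<eta>\<close>; the complement \<mu> / x is the mass of microscopic
  cycles.\<close>

definition w :: "real \<Rightarrow> real" where "w y = \<nu> / x * \<theta>s * (1 - y / \<eta>) powr (\<theta>s - 1)"

lemma x_pos: "x > 0" and x_gt: "x > \<mu>"
  using eta nu_pos mu_nonneg by (auto simp: x_def add_nonneg_pos)

lemma x_lim: "(\<lambda>N. real (n N) / N) \<longlonglongrightarrow> x"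
proof -
  have "(\<lambda>N. \<mu> + \<nu> * ((real (n N) / N - \<mu>) / \<nu>)) \<longlonglongrightarrow> x"
    unfolding x_def by (intro tendsto_intros n_lim)
  then show ?thesis using nu_pos by simp
qed

lemma M_nonneg: "M \<ge> 0"
  using F_bound[of 0 0] by linarith

lemma n_large: "\<forall>\<^sub>F N in sequentially. real (n N) \<ge> x / 2 * N"
proof -
  have "\<forall>\<^sub>F N in sequentially. real (n N) / N > x / 2"
    using x_pos by (intro order_tendstoD(1)[OF x_lim]) auto
  with eventually_gt_at_top[of 0] show ?thesis
    by eventually_elim (auto simp: pos_less_divide_eq)
qed

lemma qn_n_lim: "(\<lambda>N. qn N (n N)) \<longlonglongrightarrow> C * (\<nu> * \<eta>) powr (\<theta>s - 1)"
  using qn_lim[OF n_le x_lim x_gt] by (simp add: x_def)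

lemma qn_n_lim_pos: "C * (\<nu> * \<eta>) powr (\<theta>s - 1) > 0"
  using C_pos nu_pos eta by simp

lemma q_n_pos: "\<forall>\<^sub>F N in sequentially. q N (n N) > 0"
proof -
  have "\<forall>\<^sub>F N in sequentially. qn N (n N) > 0"
    using order_tendstoD(1)[OF qn_n_lim qn_n_lim_pos] .
  then show ?thesis
  proof eventually_elim
    case (elim N)
    then have "q N (n N) \<noteq> 0" by (auto simp: qn_def)
    then show ?case using q_nonneg[of N "n N"] by simp
  qed
qed

text \<open>Two instances of \<open>qn_lim\<close> are divided. The constant C cancels, and x -
  \<nu> y - \<mu> = \<nu> \<eta> (1 - y/\<eta>).\<close>

lemma ratio_lim:
  assumes y: "0 \<le> y" "y < \<eta>" and l: "(\<lambda>N. real (l N) / (real N * \<nu>)) \<longlonglongrightarrow> y"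
  shows "(\<lambda>N. ratio N (l N)) \<longlonglongrightarrow> (1 - y / \<eta>) powr (\<theta>s - 1)"
proof -
  have l': "(\<lambda>N. real (l N) / N) \<longlonglongrightarrow> \<nu> * y"
    using tendsto_mult_left[OF l, of \<nu>] nu_pos by (simp add: mult.commute)
  have lim: "(\<lambda>N. real (n N) / N - real (l N) / N) \<longlonglongrightarrow> x - \<nu> * y" by (intro tendsto_intros l' x_lim)
  have gt: "x - \<nu> * y > \<mu>" using y nu_pos by (simp add: x_def)
  have "\<forall>\<^sub>F N in sequentially. real (n N) / N - real (l N) / N > 0"
    using order_tendstoD(1)[OF lim, of 0] gt mu_nonneg by auto
  with eventually_gt_at_top[of 0]
  have "\<forall>\<^sub>F N in sequentially. real (n N) / N - real (l N) / N = real (n N - l N) / N"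
  proof eventually_elim
    case (elim N)
    then have "real (l N) < real (n N)" by (simp add: divide_less_cancel)
    then show ?case by (simp add: of_nat_diff diff_divide_distrib)
  qed
  from Lim_transform_eventually[OF lim this]
  have "(\<lambda>N. real (n N - l N) / N) \<longlonglongrightarrow> x - \<nu> * y" .
  moreover have "n N - l N \<le> N" for N using n_le[of N] by linarith
  ultimately have "(\<lambda>N. qn N (n N - l N)) \<longlonglongrightarrow> C * (x - \<nu> * y - \<mu>) powr (\<theta>s - 1)"
    using gt by (intro qn_lim) auto
  then have "(\<lambda>N. qn N (n N - l N) / qn N (n N)) \<longlonglongrightarrow> C * (x - \<nu> * y - \<mu>) powr (\<theta>s - 1) / (C * (\<nu> * \<eta>) powr (\<theta>s - 1))"
    using qn_n_lim_pos by (intro tendsto_divide qn_n_lim) auto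
  also have "C * (x - \<nu> * y - \<mu>) powr (\<theta>s - 1) / (C * (\<nu> * \<eta>) powr (\<theta>s - 1)) = (1 - y / \<eta>) powr (\<theta>s - 1)"
  proof -
    have "x - \<nu> * y - \<mu> = (\<nu> * \<eta>) * (1 - y / \<eta>)" using eta by (simp add: x_def field_simps)
    then have "(x - \<nu> * y - \<mu>) powr (\<theta>s - 1) = (\<nu> * \<eta>) powr (\<theta>s - 1) * (1 - y / \<eta>) powr (\<theta>s - 1)"
      using nu_pos eta y by (simp add: powr_mult)
    then show ?thesis using C_pos nu_pos eta by simp
  qed
  finally show ?thesis
    by (rule Lim_transform_eventually) (use eventually_gt_at_top[of 0] in eventually_elim, simp add: qn_ratio)
qed

text \<open>Staying \<epsilon> below \<eta> keeps n - l above \<mu> N by a fixed fraction of N,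
  where \<open>qn\<close> is bounded; the denominator has a positive limit.\<close>

lemma ratio_bounded:
  assumes eps: "\<epsilon> > 0"
  shows "\<exists>B>0. \<forall>\<^sub>F N in sequentially. \<forall>l. real l \<le> (\<eta> - \<epsilon>) * (real N * \<nu>) \<longrightarrow> l \<le> n N \<and> ratio N l \<le> B"
proof -
  define d where "d = C * (\<nu> * \<eta>) powr (\<theta>s - 1) / 2"
  have d: "d > 0" using qn_n_lim_pos by (simp add: d_def)
  have evd: "\<forall>\<^sub>F N in sequentially. qn N (n N) > d"
    using qn_n_lim_pos by (intro order_tendstoD(1)[OF qn_n_lim]) (simp add: d_def)
  have e2: "\<nu> * \<epsilon> / 2 > 0" using eps nu_pos by simp
  obtain B where B: "B > 0" "\<forall>\<^sub>F N in sequentially. \<forall>n. (\<mu> + \<nu> * \<epsilon> / 2) * real N \<le> n \<and> n \<le> N \<longrightarrow> qn N n \<le> B"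
    using qn_bounded[OF e2] by blast
  have "\<forall>\<^sub>F N in sequentially. real (n N) / N > x - \<nu> * \<epsilon> / 2"
    using e2 by (intro order_tendstoD(1)[OF x_lim]) auto
  then have "\<forall>\<^sub>F N in sequentially. \<forall>l. real l \<le> (\<eta> - \<epsilon>) * (real N * \<nu>) \<longrightarrow> l \<le> n N \<and> ratio N l \<le> B / d"
    using B(2) evd eventually_gt_at_top[of 0]
  proof eventually_elim
    case (elim N)
    show ?case
    proof (intro allI impI)
      fix l :: nat assume l: "real l \<le> (\<eta> - \<epsilon>) * (real N * \<nu>)"
      have "(x - \<nu> * \<epsilon> / 2) * N < n N" using elim by (simp add: pos_less_divide_eq)
      then have *: "real (n N) - real l \<ge> (\<mu> + \<nu> * \<epsilon> / 2) * N" using l by (simp add: x_def algebra_simps)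
      moreover have "(\<mu> + \<nu> * \<epsilon> / 2) * N \<ge> 0" using mu_nonneg e2 by simp
      ultimately have ln: "l \<le> n N" by linarith
      then have "qn N (n N - l) \<le> B" using elim * n_le[of N] by (auto simp: of_nat_diff)
      then have "qn N (n N - l) / qn N (n N) \<le> B / d" using elim d B by (intro frac_le) auto
      then show "l \<le> n N \<and> ratio N l \<le> B / d" using ln elim by (simp add: qn_ratio)
    qed
  qed
  then show ?thesis using B d by (intro exI[of _ "B / d"]) auto
qed

lemma G_bound:
  assumes "0 \<le> y" "y < \<eta>"
  shows "\<bar>G y\<bar> \<le> M"
proof -
  have "(\<lambda>N. \<bar>F N (nat \<lfloor>y * (real N * \<nu>)\<rfloor>)\<bar>) \<longlonglongrightarrow> \<bar>G y\<bar>"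
    using F_lim[OF assms floor_seq_lim] assms nu_pos by (intro tendsto_rabs) auto
  then show ?thesis by (rule LIMSEQ_le_const2) (use F_bound in auto)
qed

text \<open>By \<open>F_lim\<close>, taken along rounded multiples of y, \<open>G\<close> is a
  pointwise limit of step functions.\<close>

lemma G_measurable: "(\<lambda>y. indicator {0<..<\<eta>} y * G y) \<in> borel_measurable borel"
proof (rule borel_measurable_LIMSEQ_real)
  fix y :: real
  show "(\<lambda>N. indicator {0<..<\<eta>} y * F N (nat \<lfloor>y * (real N * \<nu>)\<rfloor>)) \<longlonglongrightarrow> indicator {0<..<\<eta>} y * G y"
  proof (cases "y \<in> {0<..<\<eta>}")
    case True
    then show ?thesis using F_lim[of y "\<lambda>N. nat \<lfloor>y * (real N * \<nu>)\<rfloor>"] floor_seq_lim[of y \<nu>] nu_pos by simp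
  qed simp
qed measurable

text \<open>The weights N c_l / n tend to c_l / x for fixed l and are dominated by a multiple of the
  summable \<open>c\<close>. Their mass therefore stays at microscopic lengths, where the ratio
  tends to 1 and \<open>F\<close> to \<open>G 0\<close>.\<close>

lemma kappa_part:
  assumes eps: "0 < \<epsilon>" "\<epsilon> < \<eta>"
  shows "(\<lambda>N. \<Sum>l\<in>near \<epsilon> N. N * c l / n N * ratio N l * F N l)
     \<longlonglongrightarrow> \<mu> / x * G 0"
proof -
  let ?P = "\<lambda>N l. 1 \<le> l \<and> l \<le> n N \<and> real l \<le> (\<eta> - \<epsilon>) * (real N * \<nu>)"
  let ?f = "\<lambda>l N. if ?P N l then N * c l / n N * ratio N l * F N l else 0"
  obtain B where B: "B > 0" "\<forall>\<^sub>F N in sequentially. \<forall>l. real l \<le> (\<eta> - \<epsilon>) * (real N * \<nu>) \<longrightarrow> l \<le> n N \<and> ratio N l \<le> B"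
    using ratio_bounded[OF eps(1)] by blast
  have xi: "(\<lambda>N. real N / n N) \<longlonglongrightarrow> 1 / x"
    using tendsto_inverse[OF x_lim] x_pos by (simp add: inverse_eq_divide)
  have "(\<lambda>N. \<Sum>l. ?f l N) \<longlonglongrightarrow> (\<Sum>l. c l * (1 / x * G 0))"
  proof (rule tannerys_theorem[where M = "\<lambda>l. c l * (2 / x * B * M)", THEN conjunct2, THEN conjunct2])
    fix l :: nat
    have "(\<lambda>N. real l / (real N * h)) \<longlonglongrightarrow> 0" if "h > 0" for h :: real using that by real_asymp
    from this[OF nu_pos] have l0: "(\<lambda>N. real l / (real N * \<nu>)) \<longlonglongrightarrow> 0" .
    have "(\<lambda>N. c l * (real N / n N) * ratio N l * F N l) \<longlonglongrightarrow> c l * (1 / x) * ((1 - 0 / \<eta>) powr (\<theta>s - 1)) * G 0"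
      using eta by (intro tendsto_intros xi ratio_lim F_lim l0) auto
    then have lim: "(\<lambda>N. N * c l / n N * ratio N l * F N l) \<longlonglongrightarrow> c l * (1 / x * G 0)"
      by (simp add: mult_ac)
    show "?f l \<longlonglongrightarrow> c l * (1 / x * G 0)"
    proof (cases "l = 0")
      case False
      have "\<forall>\<^sub>F N in sequentially. real l \<le> h * real N" if "h > 0" for h :: real using that by real_asymp
      from this[of "(\<eta> - \<epsilon>) * \<nu>"] have "\<forall>\<^sub>F N in sequentially. real l \<le> (\<eta> - \<epsilon>) * (real N * \<nu>)"
        using eps nu_pos by (simp add: mult_ac)
      with B(2) have "\<forall>\<^sub>F N in sequentially. ?P N l"
        by eventually_elim (use False in auto)
      then have "\<forall>\<^sub>F N in sequentially. N * c l / n N * ratio N l * F N l = ?f l N"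
        by eventually_elim auto
      with lim show ?thesis by (rule Lim_transform_eventually)
    qed (use c_0 in auto)
  next
    have "\<forall>\<^sub>F N in sequentially. \<forall>l. norm (?f l N) \<le> c l * (2 / x * B * M)"
      using B(2) n_large eventually_gt_at_top[of 0]
    proof eventually_elim
      case (elim N)
      show ?case
      proof
        fix l
        have N0: "real N > 0" using elim by simp
        have nn: "N / n N \<le> 2 / x"
        proof -
          have "0 < x / 2 * N" using x_pos N0 by simp
          then have "N / n N \<le> N / (x / 2 * N)" using elim by (intro divide_left_mono) (auto intro!: mult_pos_pos)
          then show ?thesis using N0 by simp
        qed
        show "norm (?f l N) \<le> c l * (2 / x * B * M)"
        proof (cases "?P N l")
          case True
          then have r: "ratio N l \<le> B" "0 \<le> ratio N l" using elim q_nonneg by auto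
          have "norm (?f l N) = c l * ((N / n N) * ratio N l * \<bar>F N l\<bar>)"
            using True c_nonneg[of l] r(2) by (simp add: abs_mult q_nonneg)
          also have "\<dots> \<le> c l * (2 / x * B * M)"
            using nn r F_bound[of N l] c_nonneg[of l] B x_pos M_nonneg by (intro mult_left_mono mult_mono) auto
          finally show ?thesis .
        qed (use c_nonneg[of l] B x_pos M_nonneg in auto)
      qed
    qed
    then show "\<forall>\<^sub>F (l, N) in at_top \<times>\<^sub>F sequentially. norm (?f l N) \<le> c l * (2 / x * B * M)"
      by (rule eventually_all_prod)
  qed (use c_summable in \<open>auto intro!: summable_mult2\<close>)
  also have "(\<Sum>l. c l * (1 / x * G 0)) = \<mu> / x * G 0"
    using suminf_mult2[OF c_summable, of "1 / x * G 0"] by (simp add: \<mu>_def)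
  finally have lim: "(\<lambda>N. \<Sum>l. ?f l N) \<longlonglongrightarrow> \<mu> / x * G 0" .
  have "(\<Sum>l. ?f l N) = (\<Sum>l\<in>{l. ?P N l}. N * c l / n N * ratio N l * F N l)" for N
  proof -
    have "finite {l. ?P N l}" by (rule finite_subset[of _ "{..n N}"]) auto
    then have "(\<Sum>l. ?f l N) = (\<Sum>l\<in>{l. ?P N l}. ?f l N)" by (intro suminf_finite) auto
    also have "\<dots> = (\<Sum>l\<in>{l. ?P N l}. N * c l / n N * ratio N l * F N l)"
      by (intro sum.cong) auto
    finally show ?thesis .
  qed
  then show ?thesis using lim by simp
qed

lemma w_nonneg: "w y \<ge> 0"
  unfolding w_def using nu_pos x_pos ths_pos by simp

text \<open>For \<theta>s < 1 the density is unbounded at \<eta>, hence the fundamental theorem for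
  nonnegative functions on an open interval, with limits of the antiderivative at both ends.\<close>

lemma w_integral:
  "integrable lborel (\<lambda>y. indicator {0<..<\<eta>} y * w y)"
  "(\<integral>y. indicator {0<..<\<eta>} y * w y \<partial>lborel) = \<nu> * \<eta> / x"
proof -
  define W where "W = (\<lambda>y. - (\<nu> * \<eta> / x) * (1 - y / \<eta>) powr \<theta>s)"
  have 1: "(W has_real_derivative w y) (at y)" if "0 < y" "y < \<eta>" for y
  proof -
    have ne: "\<eta> \<noteq> 0" "1 - y / \<eta> > 0" using that by auto
    have "((\<lambda>y. 1 - y / \<eta>) has_real_derivative - (1 / \<eta>)) (at y)"
      using ne(1) by (auto intro!: derivative_eq_intros)
    from DERIV_cmult[OF DERIV_fun_powr[OF this ne(2), of \<theta>s], of "- (\<nu> * \<eta> / x)"]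
    show ?thesis unfolding W_def w_def using ne(1) by (simp add: mult.assoc)
  qed
  have 2: "isCont w y" if "0 < y" "y < \<eta>" for y
    unfolding w_def using that eta by (intro continuous_intros) auto
  have 3: "((W \<circ> real_of_ereal) \<longlongrightarrow> - (\<nu> * \<eta> / x)) (at_right (ereal 0))"
  proof -
    have "(W \<longlongrightarrow> - (\<nu> * \<eta> / x) * (1 - 0 / \<eta>) powr \<theta>s) (at_right 0)"
      unfolding W_def using eta by (intro tendsto_intros) auto
    then show ?thesis unfolding ereal_tendsto_simps1 by simp
  qed
  have 4: "((W \<circ> real_of_ereal) \<longlongrightarrow> 0) (at_left (ereal \<eta>))"
  proof -
    have "((\<lambda>y. 1 - y / \<eta>) \<longlongrightarrow> 1 - \<eta> / \<eta>) (at_left \<eta>)" using eta by (intro tendsto_intros) auto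
    then have lim: "((\<lambda>y. 1 - y / \<eta>) \<longlongrightarrow> 0) (at_left \<eta>)" using eta by simp
    have ev: "\<forall>\<^sub>F y in at_left \<eta>. 0 \<le> 1 - y / \<eta>"
      using eventually_at_left_real[OF eta(1)] by eventually_elim (use eta in auto)
    have "((\<lambda>y. (1 - y / \<eta>) powr \<theta>s) \<longlongrightarrow> 0 powr \<theta>s) (at_left \<eta>)"
      by (rule tendsto_powr2[OF lim tendsto_const ev ths_pos])
    then have "(W \<longlongrightarrow> - (\<nu> * \<eta> / x) * 0 powr \<theta>s) (at_left \<eta>)"
      unfolding W_def by (rule tendsto_mult_left)
    then show ?thesis unfolding ereal_tendsto_simps1 by simp
  qed
  have "set_integrable lborel (einterval (ereal 0) (ereal \<eta>)) w"
    "(LBINT y=ereal 0..ereal \<eta>. w y) = 0 - (- (\<nu> * \<eta> / x))"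
  proof -
    have a: "ereal 0 < ereal \<eta>" using eta by simp
    have b: "AE y in lborel. ereal 0 < ereal y \<longrightarrow> ereal y < ereal \<eta> \<longrightarrow> 0 \<le> w y" using w_nonneg by simp
    note FTC = interval_integral_FTC_nonneg[OF a _ _ b 3 4]
    show "set_integrable lborel (einterval (ereal 0) (ereal \<eta>)) w" by (rule FTC(1)) (use 1 2 in auto)
    show "(LBINT y=ereal 0..ereal \<eta>. w y) = 0 - (- (\<nu> * \<eta> / x))" by (rule FTC(2)) (use 1 2 in auto)
  qed
  then show "integrable lborel (\<lambda>y. indicator {0<..<\<eta>} y * w y)"
    "(\<integral>y. indicator {0<..<\<eta>} y * w y \<partial>lborel) = \<nu> * \<eta> / x"
    using eta by (simp_all add: set_integrable_def set_lebesgue_integral_def interval_lebesgue_integral_def)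
qed

text \<open>A Riemann sum of mesh 1/(N \<nu>): since t_l is bounded, single terms are O(1/N) and
  only macroscopic lengths matter, where t_l is close to \<theta>s.\<close>

lemma theta_part:
  assumes eps: "0 < \<epsilon>" "\<epsilon> < \<eta>"
  shows "(\<lambda>N. \<Sum>l\<in>near \<epsilon> N. t l / n N * ratio N l * F N l)
     \<longlonglongrightarrow> (\<integral>y. indicator {0<..<\<eta> - \<epsilon>} y * (w y * G y) \<partial>lborel)"
proof -
  let ?P = "\<lambda>N l. 1 \<le> l \<and> l \<le> n N \<and> real l \<le> (\<eta> - \<epsilon>) * (real N * \<nu>)"
  define a where "a N l = (if ?P N l then (real N * \<nu>) * (t l / n N * ratio N l * F N l) else 0)" for N l
  define f where "f N y = indicator {0..} y * a N (nat \<lfloor>y * (real N * \<nu>)\<rfloor>)" for N and y :: real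
  let ?g = "\<lambda>y. indicator {0<..<\<eta> - \<epsilon>} y * (w y * G y)"
  obtain B where B: "B > 0" "\<forall>\<^sub>F N in sequentially. \<forall>l. real l \<le> (\<eta> - \<epsilon>) * (real N * \<nu>) \<longrightarrow> l \<le> n N \<and> ratio N l \<le> B"
    using ratio_bounded[OF eps(1)] by blast
  obtain T where T: "\<And>l. \<bar>t l - \<theta>s\<bar> \<le> T" using LIMSEQ_abs_bounded[OF t_lim] by blast
  define T' where "T' = T + \<theta>s"
  have T': "t l \<le> T'" for l using T[of l] by (simp add: T'_def abs_le_iff)
  have T'0: "T' \<ge> 0" using T'[of 0] t_nonneg[of 0] by linarith
  define D where "D = \<nu> * (T' * (2 / x) * B * M)"
  have D0: "D \<ge> 0" using nu_pos T'0 x_pos B M_nonneg by (simp add: D_def)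
  have xi: "(\<lambda>N. real N / n N) \<longlonglongrightarrow> 1 / x"
    using tendsto_inverse[OF x_lim] x_pos by (simp add: inverse_eq_divide)
  have big: "\<forall>\<^sub>F N in sequentially. K \<le> h * real N" if "h > 0" for h K :: real using that by real_asymp
  have "\<forall>\<^sub>F N in sequentially. \<forall>y. \<bar>f N y\<bar> \<le> D * indicator {0..\<eta>} y"
    using B(2) n_large eventually_gt_at_top[of 0] big[OF mult_pos_pos[OF eps(1) nu_pos], of 1]
  proof eventually_elim
    case (elim N)
    have N0: "real N > 0" using elim by simp
    have nn: "N / n N \<le> 2 / x"
    proof -
      have "0 < x / 2 * N" using x_pos N0 by simp
      then have "N / n N \<le> N / (x / 2 * N)" using elim by (intro divide_left_mono) (auto intro!: mult_pos_pos)
      then show ?thesis using N0 by simp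
    qed
    show ?case
    proof
      fix y
      define l where "l = nat \<lfloor>y * (real N * \<nu>)\<rfloor>"
      show "\<bar>f N y\<bar> \<le> D * indicator {0..\<eta>} y"
      proof (cases "y \<ge> 0 \<and> ?P N l")
        case True
        then have r: "ratio N l \<le> B" "0 \<le> ratio N l" using elim q_nonneg by auto
        \<comment> \<open>Rounding down costs at most 1, which is at most \<epsilon> \<nu> N for the
          present \<open>N\<close>; so \<open>f N\<close> vanishes outside [0, \<eta>].\<close>
        have "y * (real N * \<nu>) \<le> real l + 1" unfolding l_def by linarith
        also have "\<dots> \<le> (\<eta> - \<epsilon>) * (real N * \<nu>) + \<epsilon> * \<nu> * N" using True elim by (intro add_mono) auto
        also have "\<dots> = \<eta> * (real N * \<nu>)" by (simp add: algebra_simps)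
        finally have y: "y \<le> \<eta>" using N0 nu_pos by simp
        have "\<bar>f N y\<bar> = \<nu> * (t l * (N / n N) * ratio N l * \<bar>F N l\<bar>)"
          using True t_nonneg[of l] r(2) nu_pos by (simp add: f_def a_def l_def[symmetric] abs_mult q_nonneg)
        also have "\<dots> \<le> D" unfolding D_def
          using nn r F_bound[of N l] t_nonneg[of l] T'[of l] T'0 B x_pos M_nonneg nu_pos by (intro mult_left_mono mult_mono mult_nonneg_nonneg) auto
        finally show ?thesis using y True by simp
      next
        case False
        then have "f N y = 0" by (auto simp: f_def a_def l_def[symmetric])
        then show ?thesis using D0 by simp
      qed
    qed
  qed
  then obtain N0 where N0: "\<And>N y. N \<ge> N0 \<Longrightarrow> \<bar>f N y\<bar> \<le> D * indicator {0..\<eta>} y"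
    by (auto simp: eventually_sequentially)
  \<comment> \<open>The two exceptional points form a null set; \<open>?g\<close> may jump at the
    cut-off \<eta> - \<epsilon>.\<close>
  have lim: "(\<lambda>N. f N y) \<longlonglongrightarrow> ?g y" if y: "y \<noteq> 0" "y \<noteq> \<eta> - \<epsilon>" for y
  proof -
    define l where "l N = nat \<lfloor>y * (real N * \<nu>)\<rfloor>" for N
    consider "y < 0" | "0 < y" "y < \<eta> - \<epsilon>" | "y > \<eta> - \<epsilon>" "y > 0" using y eps by linarith
    then show ?thesis
    proof cases
      case 1
      then show ?thesis by (simp add: f_def)
    next
      case 2
      have ly: "(\<lambda>N. real (l N) / (real N * \<nu>)) \<longlonglongrightarrow> y"
        unfolding l_def using 2 nu_pos by (intro floor_seq_lim) auto
      have linf: "filterlim l at_top sequentially"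
        unfolding filterlim_at_top
      proof
        fix Z :: nat
        have "\<forall>\<^sub>F N in sequentially. real Z + 1 \<le> (y * \<nu>) * real N" using 2 nu_pos by (intro big) auto
        then show "\<forall>\<^sub>F N in sequentially. Z \<le> l N"
          by eventually_elim (simp add: l_def le_nat_iff le_floor_iff mult_ac)
      qed
      have tl: "(\<lambda>N. t (l N)) \<longlonglongrightarrow> \<theta>s"
        using filterlim_compose[OF LIM_zero_cancel[OF t_lim] linf] .
      have "(\<lambda>N. \<nu> * (t (l N) * (real N / n N) * ratio N (l N) * F N (l N))) \<longlonglongrightarrow>
         \<nu> * (\<theta>s * (1 / x) * ((1 - y / \<eta>) powr (\<theta>s - 1)) * G y)"
        using 2 eps by (intro tendsto_intros tl xi ratio_lim F_lim ly) auto
      also have "\<nu> * (\<theta>s * (1 / x) * ((1 - y / \<eta>) powr (\<theta>s - 1)) * G y) = ?g y"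
        using 2 by (simp add: w_def)
      finally have L: "(\<lambda>N. \<nu> * (t (l N) * (real N / n N) * ratio N (l N) * F N (l N))) \<longlonglongrightarrow> ?g y" .
      have "\<forall>\<^sub>F N in sequentially. 1 \<le> l N" using linf by (simp add: filterlim_at_top)
      with B(2) have "\<forall>\<^sub>F N in sequentially. \<nu> * (t (l N) * (real N / n N) * ratio N (l N) * F N (l N)) = f N y"
      proof eventually_elim
        case (elim N)
        have "real (l N) \<le> y * (real N * \<nu>)" unfolding l_def using 2 nu_pos by (intro of_nat_floor) auto
        also have "\<dots> \<le> (\<eta> - \<epsilon>) * (real N * \<nu>)" using 2 nu_pos by (intro mult_right_mono) auto
        finally have "?P N (l N)" using elim by auto
        then show ?case using 2 by (simp add: f_def a_def l_def[symmetric])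
      qed
      with L show ?thesis by (rule Lim_transform_eventually)
    next
      case 3
      have ly: "(\<lambda>N. real (l N) / (real N * \<nu>)) \<longlonglongrightarrow> y"
        unfolding l_def using 3 nu_pos by (intro floor_seq_lim) auto
      have "\<forall>\<^sub>F N in sequentially. real (l N) / (real N * \<nu>) > \<eta> - \<epsilon>"
        using 3 by (intro order_tendstoD(1)[OF ly]) auto
      with eventually_gt_at_top[of 0] have "\<forall>\<^sub>F N in sequentially. f N y = 0"
      proof eventually_elim
        case (elim N)
        then have "\<not> ?P N (l N)" using nu_pos by (simp add: pos_less_divide_eq)
        then show ?case by (auto simp: f_def a_def l_def[symmetric])
      qed
      then show ?thesis using 3 by (simp add: tendsto_eventually)
    qed
  qed
  have gm: "?g \<in> borel_measurable lborel"
  proof -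
    have "?g = (\<lambda>y. indicator {0<..<\<eta> - \<epsilon>} y * w y * (indicator {0<..<\<eta>} y * G y))"
      using eps by (auto simp: fun_eq_iff indicator_def)
    moreover have "(\<lambda>y. indicator {0<..<\<eta> - \<epsilon>} y * w y * (indicator {0<..<\<eta>} y * G y)) \<in> borel_measurable borel"
      using G_measurable unfolding w_def by measurable
    ultimately show ?thesis by simp
  qed
  have fm: "f N \<in> borel_measurable lborel" for N unfolding f_def by measurable
  have "(\<lambda>N. integral\<^sup>L lborel (f (N + N0))) \<longlonglongrightarrow> integral\<^sup>L lborel ?g"
  proof (rule integral_dominated_convergence[where w = "\<lambda>y. D * indicator {0..\<eta>} y"])
    show "AE y in lborel. (\<lambda>N. f (N + N0) y) \<longlonglongrightarrow> ?g y"
    proof -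
      have "AE y in lborel. y \<noteq> 0 \<and> y \<noteq> \<eta> - \<epsilon>"
        using AE_lborel_singleton[of 0] AE_lborel_singleton[of "\<eta> - \<epsilon>"] by eventually_elim auto
      then show ?thesis
        by eventually_elim (use lim in \<open>auto intro!: LIMSEQ_ignore_initial_segment\<close>)
    qed
    have "integrable lborel (indicator {0..\<eta>} :: real \<Rightarrow> real)"
      using eta by (intro integrable_real_indicator) auto
    then show "integrable lborel (\<lambda>y. D * indicator {0..\<eta>} y)" by (rule integrable_mult_right)
  qed (use gm fm N0 in auto)
  then have L: "(\<lambda>N. integral\<^sup>L lborel (f N)) \<longlonglongrightarrow> integral\<^sup>L lborel ?g" by (rule LIMSEQ_offset)
  have "\<forall>\<^sub>F N in sequentially. integral\<^sup>L lborel (f N) = (\<Sum>l\<in>{l. ?P N l}. t l / n N * ratio N l * F N l)"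
    using eventually_gt_at_top[of 0]
  proof eventually_elim
    case (elim N)
    have h: "real N * \<nu> > 0" using elim nu_pos by simp
    have "integral\<^sup>L lborel (f N) = (\<Sum>l\<le>n N. a N l) / (real N * \<nu>)"
      unfolding f_def using h by (intro integral_floor_step) (auto simp: a_def)
    also have "(\<Sum>l\<le>n N. a N l) = (\<Sum>l\<in>{l. ?P N l}. a N l)"
      by (intro sum.mono_neutral_right) (auto simp: a_def)
    also have "\<dots> = (\<Sum>l\<in>{l. ?P N l}. (real N * \<nu>) * (t l / n N * ratio N l * F N l))"
      by (intro sum.cong) (auto simp: a_def)
    also have "\<dots> = (real N * \<nu>) * (\<Sum>l\<in>{l. ?P N l}. t l / n N * ratio N l * F N l)"
      by (rule sum_distrib_left[symmetric])
    finally show ?case using nonzero_mult_div_cancel_left[of "real N * \<nu>"] h by (simp only: less_imp_neq[OF h, symmetric] not_False_eq_True)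
  qed
  with L show ?thesis by (rule Lim_transform_eventually)
qed

definition L :: real where
  "L = \<mu> / x * G 0 + (\<integral>y. indicator {0<..<\<eta>} y * (w y * G y) \<partial>lborel)"

lemma head_part:
  assumes eps: "0 < \<epsilon>" "\<epsilon> < \<eta>"
  shows "(\<lambda>N. \<Sum>l\<in>{l. l \<le> n N \<and> real l \<le> (\<eta> - \<epsilon>) * (real N * \<nu>)}. K N (n N) l * F N l)
     \<longlonglongrightarrow> \<mu> / x * G 0 + (\<integral>y. indicator {0<..<\<eta> - \<epsilon>} y * (w y * G y) \<partial>lborel)"
proof -
  have "\<forall>\<^sub>F N in sequentially. n N > 0"
    using n_large eventually_gt_at_top[of 0]
  proof eventually_elim
    case (elim N)
    then have "0 < x / 2 * N" using x_pos by simp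
    then show ?case using elim by linarith
  qed
  then have "\<forall>\<^sub>F N in sequentially.
     (\<Sum>l\<in>near \<epsilon> N. N * c l / n N * ratio N l * F N l)
   + (\<Sum>l\<in>near \<epsilon> N. t l / n N * ratio N l * F N l)
   = (\<Sum>l\<in>{l. l \<le> n N \<and> real l \<le> (\<eta> - \<epsilon>) * (real N * \<nu>)}. K N (n N) l * F N l)"
  proof eventually_elim
    case (elim N)
    have "(\<Sum>l\<in>{l. l \<le> n N \<and> real l \<le> (\<eta> - \<epsilon>) * (real N * \<nu>)}. K N (n N) l * F N l) =
      (\<Sum>l\<in>near \<epsilon> N. (t l + N * c l) / n N * ratio N l * F N l)"
      using elim by (intro sum.mono_neutral_cong_right) (auto simp: K_def)
    then show ?case by (simp add: sum.distrib[symmetric] add_divide_distrib algebra_simps)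
  qed
  with tendsto_add[OF kappa_part[OF eps] theta_part[OF eps]] show ?thesis by (rule Lim_transform_eventually)
qed

lemma w_tail:
  "((\<lambda>k. \<integral>y. indicator {0<..<\<eta> - \<eta> / real (Suc (Suc k))} y * w y \<partial>lborel)) \<longlonglongrightarrow> \<nu> * \<eta> / x"
proof -
  have "(\<lambda>k. \<integral>y. indicator {0<..<\<eta> - \<eta> / real (Suc (Suc k))} y * w y \<partial>lborel) \<longlonglongrightarrow> (\<integral>y. indicator {0<..<\<eta>} y * w y \<partial>lborel)"
  proof (rule integral_dominated_convergence[where w = "\<lambda>y. indicator {0<..<\<eta>} y * w y"])
    show "AE y in lborel. (\<lambda>k. indicator {0<..<\<eta> - \<eta> / real (Suc (Suc k))} y * w y) \<longlonglongrightarrow> indicator {0<..<\<eta>} y * w y"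
    proof (intro AE_I2)
      fix y
      show "(\<lambda>k. indicator {0<..<\<eta> - \<eta> / real (Suc (Suc k))} y * w y) \<longlonglongrightarrow> indicator {0<..<\<eta>} y * w y"
      proof (cases "y < \<eta>")
        case True
        have "(\<lambda>k. \<eta> - \<eta> / real (Suc (Suc k))) \<longlonglongrightarrow> \<eta>" by real_asymp
        from order_tendstoD(1)[OF this True]
        have "\<forall>\<^sub>F k in sequentially. indicator {0<..<\<eta> - \<eta> / real (Suc (Suc k))} y * w y = indicator {0<..<\<eta>} y * w y"
          by (rule eventually_mono) (use True in \<open>auto simp: indicator_def\<close>)
        then show ?thesis by (rule tendsto_eventually)
      next
        case False
        have "\<eta> / real (Suc (Suc k)) > 0" for k using eta by simp
        then have "y \<notin> {0<..<\<eta> - \<eta> / real (Suc (Suc k))}" for k using False by (smt (verit) greaterThanLessThan_iff)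
        then show ?thesis using False by simp
      qed
    qed
    show "AE y in lborel. norm (indicator {0<..<\<eta> - \<eta> / real (Suc (Suc k))} y * w y) \<le> indicator {0<..<\<eta>} y * w y" for k
    proof -
      have "\<eta> / real (Suc (Suc k)) > 0" using eta by simp
      then show ?thesis using w_nonneg by (intro AE_I2) (auto simp: indicator_def)
    qed
  qed (use w_integral(1) in \<open>auto simp: w_def\<close>)
  then show ?thesis by (simp add: w_integral)
qed

text \<open>The head l \<le> (\<eta> - \<epsilon>) N \<nu> converges by \<open>head_part\<close>.
  Its limiting mass is within e' of 1, so the complement of the row is small by subtraction, and the
  boundedness of \<open>F\<close> disposes of it.\<close>

theorem one_step: "(\<lambda>N. \<Sum>l\<le>n N. K N (n N) l * F N l) \<longlonglongrightarrow> L"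
proof (rule LIMSEQ_I)
  \<comment> \<open>With the constant test function 1, \<open>head_part\<close> computes the
    limiting mass of the head.\<close>
  interpret one: one_step c t \<theta>s A s n \<eta> 1 "\<lambda>_ _. 1" "\<lambda>_. 1"
    by unfold_locales (use n_le n_lim eta in auto)
  fix e :: real assume e: "e > 0"
  define e' where "e' = e / (4 * (M + 1))"
  have e': "e' > 0" using e M_nonneg by (simp add: e'_def)
  have total: "\<mu> / x + \<nu> * \<eta> / x = 1" using x_pos by (simp add: x_def add_divide_distrib[symmetric])
  obtain k where k: "(\<integral>y. indicator {0<..<\<eta> - \<eta> / real (Suc (Suc k))} y * w y \<partial>lborel) > \<nu> * \<eta> / x - e'"
    using order_tendstoD(1)[OF w_tail, of "\<nu> * \<eta> / x - e'"] e' by (auto simp: eventually_sequentially)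
  \<comment> \<open>The shift by 2 guarantees \<epsilon> < \<eta>.\<close>
  define \<epsilon> where "\<epsilon> = \<eta> / real (Suc (Suc k))"
  have eps: "0 < \<epsilon>" "\<epsilon> < \<eta>" using eta by (auto simp: \<epsilon>_def divide_less_eq)
  define H where "H N = {l. l \<le> n N \<and> real l \<le> (\<eta> - \<epsilon>) * (real N * \<nu>)}" for N
  define Le where "Le = \<mu> / x * G 0 + (\<integral>y. indicator {0<..<\<eta> - \<epsilon>} y * (w y * G y) \<partial>lborel)"
  define me where "me = \<mu> / x + (\<integral>y. indicator {0<..<\<eta> - \<epsilon>} y * w y \<partial>lborel)"
  have me: "me > 1 - e'" using k total by (simp add: me_def \<epsilon>_def)
  have 1: "(\<lambda>N. \<Sum>l\<in>H N. K N (n N) l * F N l) \<longlonglongrightarrow> Le"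
    unfolding H_def Le_def by (rule head_part[OF eps])
  have 2: "(\<lambda>N. \<Sum>l\<in>H N. K N (n N) l) \<longlonglongrightarrow> me"
    using one.head_part[OF eps] by (simp add: H_def me_def)
  have int: "integrable lborel (\<lambda>y. indicator {0<..<\<eta>} y * (w y * G y))"
  proof (rule Bochner_Integration.integrable_bound[of _ "\<lambda>y. M * (indicator {0<..<\<eta>} y * w y)"])
    show "integrable lborel (\<lambda>y. M * (indicator {0<..<\<eta>} y * w y))" using w_integral(1) by simp
    have "(\<lambda>y. indicator {0<..<\<eta>} y * (w y * G y)) = (\<lambda>y. w y * (indicator {0<..<\<eta>} y * G y))" by (simp add: mult_ac)
    moreover have "(\<lambda>y. w y * (indicator {0<..<\<eta>} y * G y)) \<in> borel_measurable borel"
      using G_measurable unfolding w_def by measurable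
    ultimately show "(\<lambda>y. indicator {0<..<\<eta>} y * (w y * G y)) \<in> borel_measurable lborel" by simp
    show "AE y in lborel. norm (indicator {0<..<\<eta>} y * (w y * G y)) \<le> norm (M * (indicator {0<..<\<eta>} y * w y))"
    proof (intro AE_I2)
      fix y
      show "norm (indicator {0<..<\<eta>} y * (w y * G y)) \<le> norm (M * (indicator {0<..<\<eta>} y * w y))"
        using mult_right_mono[OF G_bound[of y] w_nonneg[of y]] w_nonneg[of y] M_nonneg
        by (cases "y \<in> {0<..<\<eta>}") (auto simp: abs_mult mult_ac)
    qed
  qed
  have int2: "integrable lborel (\<lambda>y. indicator {0<..<\<eta> - \<epsilon>} y * (w y * G y))"
  proof -
    have "(\<lambda>y. indicator {0<..<\<eta> - \<epsilon>} y * (w y * G y)) = (\<lambda>y. indicator {0<..<\<eta> - \<epsilon>} y *\<^sub>R (indicator {0<..<\<eta>} y * (w y * G y)))"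
      using eps by (auto simp: indicator_def fun_eq_iff)
    then show ?thesis using integrable_mult_indicator[OF _ int, of "{0<..<\<eta> - \<epsilon>}"] by simp
  qed
  have int3: "integrable lborel (\<lambda>y. indicator {0<..<\<eta> - \<epsilon>} y * w y)"
  proof -
    have "(\<lambda>y. indicator {0<..<\<eta> - \<epsilon>} y * w y) = (\<lambda>y. indicator {0<..<\<eta> - \<epsilon>} y *\<^sub>R (indicator {0<..<\<eta>} y * w y))"
      using eps by (auto simp: indicator_def fun_eq_iff)
    then show ?thesis using integrable_mult_indicator[OF _ w_integral(1), of "{0<..<\<eta> - \<epsilon>}"] by simp
  qed
  have wG: "\<bar>w y * G y\<bar> \<le> M * w y" if "0 \<le> y" "y < \<eta>" for y
    using mult_right_mono[OF G_bound[OF that] w_nonneg[of y]] w_nonneg[of y] by (simp add: abs_mult mult.commute)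
  have 3: "\<bar>L - Le\<bar> \<le> M * e'"
  proof -
    have 1: "L - Le = (\<integral>y. indicator {0<..<\<eta>} y * (w y * G y) - indicator {0<..<\<eta> - \<epsilon>} y * (w y * G y) \<partial>lborel)"
      unfolding L_def Le_def by (simp only: Bochner_Integration.integral_diff[OF int int2] add_diff_cancel_left)
    have 2: "\<bar>\<integral>y. indicator {0<..<\<eta>} y * (w y * G y) - indicator {0<..<\<eta> - \<epsilon>} y * (w y * G y) \<partial>lborel\<bar> \<le> (\<integral>y. M * (indicator {0<..<\<eta>} y * w y - indicator {0<..<\<eta> - \<epsilon>} y * w y) \<partial>lborel)"
    proof (rule integral_abs_bound_integral)
      fix y
      show "\<bar>indicator {0<..<\<eta>} y * (w y * G y) - indicator {0<..<\<eta> - \<epsilon>} y * (w y * G y)\<bar> \<le> M * (indicator {0<..<\<eta>} y * w y - indicator {0<..<\<eta> - \<epsilon>} y * w y)"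
      proof (cases "y \<in> {0<..<\<eta>}")
        case True
        show ?thesis
        proof (cases "y \<in> {0<..<\<eta> - \<epsilon>}")
          case False
          then show ?thesis using wG[of y] True by simp
        qed (use True in simp)
      next
        case False
        moreover from this have "y \<notin> {0<..<\<eta> - \<epsilon>}" using eps(1) by (meson greaterThanLessThan_iff diff_less_eq less_trans less_add_same_cancel1)
        ultimately show ?thesis by simp
      qed
      show "integrable lborel (\<lambda>y. indicator {0<..<\<eta>} y * (w y * G y) - indicator {0<..<\<eta> - \<epsilon>} y * (w y * G y))"
        by (intro Bochner_Integration.integrable_diff int int2)
      show "integrable lborel (\<lambda>y. M * (indicator {0<..<\<eta>} y * w y - indicator {0<..<\<eta> - \<epsilon>} y * w y))"
        by (intro integrable_mult_right Bochner_Integration.integrable_diff int3 w_integral(1))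
    qed
    have 3: "(\<integral>y. M * (indicator {0<..<\<eta>} y * w y - indicator {0<..<\<eta> - \<epsilon>} y * w y) \<partial>lborel) = M * (\<nu> * \<eta> / x - (me - \<mu> / x))"
      by (simp only: me_def integral_mult_right_zero Bochner_Integration.integral_diff[OF w_integral(1) int3]
          w_integral(2) add_diff_cancel_left')
    have 4: "M * (\<nu> * \<eta> / x - (me - \<mu> / x)) \<le> M * e'" using me total M_nonneg by (intro mult_left_mono) auto
    show ?thesis using 2 4 unfolding 1 3 by (rule order_trans)
  qed
  have "\<forall>\<^sub>F N in sequentially. \<bar>(\<Sum>l\<in>H N. K N (n N) l * F N l) - Le\<bar> < e'" using tendstoD[OF 1 e'] by (simp add: dist_real_def)
  moreover have "\<forall>\<^sub>F N in sequentially. (\<Sum>l\<in>H N. K N (n N) l) > me - e'" using order_tendstoD(1)[OF 2, of "me - e'"] e' by simp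
  ultimately have "\<forall>\<^sub>F N in sequentially. norm ((\<Sum>l\<le>n N. K N (n N) l * F N l) - L) < e"
    using q_n_pos
  proof eventually_elim
    case (elim N)
    have fin: "finite {..n N}" and sub: "H N \<subseteq> {..n N}" by (auto simp: H_def)
    have "(\<Sum>l\<le>n N. K N (n N) l * F N l) - (\<Sum>l\<in>H N. K N (n N) l * F N l) = (\<Sum>l\<in>{..n N} - H N. K N (n N) l * F N l)"
      using sum_diff[OF fin sub, of "\<lambda>l. K N (n N) l * F N l"] by simp
    also have "\<bar>\<dots>\<bar> \<le> (\<Sum>l\<in>{..n N} - H N. \<bar>K N (n N) l * F N l\<bar>)" by (rule sum_abs)
    also have "\<dots> \<le> (\<Sum>l\<in>{..n N} - H N. K N (n N) l * M)"
      using F_bound K_nonneg by (intro sum_mono) (auto simp: abs_mult intro!: mult_left_mono)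
    also have "\<dots> = ((\<Sum>l\<le>n N. K N (n N) l) - (\<Sum>l\<in>H N. K N (n N) l)) * M"
      by (simp add: sum_diff[OF fin sub] sum_distrib_right[symmetric])
    \<comment> \<open>The row has mass 1 because q N (n N) > 0, and the head has more than me - e' >
      1 - 2 e'.\<close>
    also have "\<dots> \<le> (2 * e') * M"
      using elim me M_nonneg by (intro mult_right_mono) (auto simp: sum_K_pos)
    finally have "\<bar>(\<Sum>l\<le>n N. K N (n N) l * F N l) - L\<bar> < 2 * e' * M + e' + M * e'"
      using elim 3 by linarith
    also have "\<dots> \<le> 4 * (M + 1) * e'" using e' M_nonneg by (simp add: algebra_simps)
    also have "\<dots> = e" using M_nonneg by (simp add: e'_def)
    finally show ?case by simp
  qed
  then show "\<exists>no. \<forall>N\<ge>no. norm ((\<Sum>l\<le>n N. K N (n N) l * F N l) - L) < e"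
    by (simp add: eventually_sequentially)
qed

text \<open>The substitution y = \<eta> b turns \<open>w\<close> into
  \<open>ustar \<nu> \<eta>\<close> times the Beta density, which is the step made by
  \<open>etaX\<close>.\<close>

lemma L_beta:
  "L = (1 - ustar \<nu> \<eta>) * G 0 + ustar \<nu> \<eta> * (\<integral>b. indicator {0<..<1} b * \<theta>s * (1 - b) powr (\<theta>s - 1) * G (\<eta> * b) \<partial>lborel)"
proof -
  have x: "x = 1 - \<nu> + \<nu> * \<eta>" by (simp add: x_def \<nu>_def)
  have u: "ustar \<nu> \<eta> = \<nu> * \<eta> / x" by (simp add: ustar_def x)
  have 1: "1 - ustar \<nu> \<eta> = \<mu> / x" unfolding u using x_pos by (simp add: x_def field_simps)
  have "(\<integral>y. indicator {0<..<\<eta>} y * (w y * G y) \<partial>lborel) = \<bar>\<eta>\<bar> *\<^sub>R (\<integral>b. indicator {0<..<\<eta>} (0 + \<eta> * b) * (w (0 + \<eta> * b) * G (0 + \<eta> * b)) \<partial>lborel)"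
    using eta by (intro lborel_integral_real_affine) auto
  also have "\<dots> = \<eta> * (\<integral>b. \<nu> / x * (indicator {0<..<1} b * \<theta>s * (1 - b) powr (\<theta>s - 1) * G (\<eta> * b)) \<partial>lborel)"
  proof -
    have "indicator {0<..<\<eta>} (0 + \<eta> * b) * (w (0 + \<eta> * b) * G (0 + \<eta> * b)) =
      \<nu> / x * (indicator {0<..<1} b * \<theta>s * (1 - b) powr (\<theta>s - 1) * G (\<eta> * b))" for b
      using eta by (cases "b \<in> {0<..<1}") (auto simp: w_def indicator_def zero_less_mult_iff)
    then show ?thesis using eta by (simp only: real_scaleR_def abs_of_pos)
  qed
  also have "\<dots> = ustar \<nu> \<eta> * (\<integral>b. indicator {0<..<1} b * \<theta>s * (1 - b) powr (\<theta>s - 1) * G (\<eta> * b) \<partial>lborel)"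
    by (simp add: u)
  finally show ?thesis unfolding L_def 1 by simp
qed

end

subsection \<open>Coefficient bounds from singular behaviour\<close>

text \<open>For t \<le> 1/2 put x = pi t \<le> 1.6: the Maclaurin bound gives sin x \<ge> x - x^3/6
  \<ge> x/2 \<ge> t. The other half follows by reflection.\<close>

lemma sin_pi_lower:
  fixes t :: real
  assumes "0 \<le> t" "t \<le> 1"
  shows "min t (1 - t) \<le> sin (pi * t)"
proof -
  have half: "t \<le> sin (pi * t)" if "0 \<le> t" "t \<le> 1 / 2" for t :: real
  proof -
    define x where "x = pi * t"
    have x: "0 \<le> x" "x \<le> 1.6" using that pi_less_4 pi_approx mult_mono[of pi "3.2" t "1/2"] by (auto simp: x_def)
    have "\<bar>sin x - (\<Sum>m<3. sin_coeff m * x ^ m)\<bar> \<le> inverse (fact 3) * \<bar>x\<bar> ^ 3"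
      by (rule Maclaurin_sin_bound)
    moreover have "(\<Sum>m<3. sin_coeff m * x ^ m) = x" by (simp add: sin_coeff_def numeral_3_eq_3)
    ultimately have "\<bar>sin x - x\<bar> \<le> x ^ 3 / 6" using x by (simp add: fact_numeral)
    from abs_le_D2[OF this] have "sin x \<ge> x - x ^ 3 / 6" by linarith
    moreover have "x ^ 3 / 6 \<le> x * (1.6 ^ 2 / 6)"
      using x mult_left_mono[OF power_mono[of x "1.6" 2], of x] by (simp add: power3_eq_cube power2_eq_square)
    ultimately have "sin x \<ge> x / 2" by (simp add: power2_eq_square) (use x in linarith)
    moreover have "x / 2 \<ge> t" using that pi_gt3 mult_right_mono[of 2 pi t] by (simp add: x_def)
    ultimately show ?thesis by (simp add: x_def)
  qed
  show ?thesis
  proof (cases "t \<le> 1 / 2")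
    case True
    then show ?thesis using half[of t] assms by simp
  next
    case False
    have "sin (pi * (1 - t)) = sin (pi * t)" by (simp add: right_diff_distrib sin_diff)
    then show ?thesis using half[of "1 - t"] False assms by simp
  qed
qed

text \<open>The squared modulus is (1 - \<rho>)^2 + 4 \<rho> sin(pi t)^2. With \<rho> \<ge> 1/2 the
  modulus is at least each of the two summands on the left, hence at least their mean.\<close>

lemma cmod_one_minus_cis_ge:
  fixes \<rho> t :: real
  assumes t: "0 \<le> t" "t \<le> 1" and \<rho>: "1 / 2 \<le> \<rho>" "\<rho> \<le> 1"
  shows "((1 - \<rho>) + min t (1 - t)) / 2 \<le> cmod (1 - \<rho> * cis (2 * pi * t))"
proof -
  define m where "m = min t (1 - t)"
  have m: "0 \<le> m" "m \<le> sin (pi * t)" using t sin_pi_lower[OF t] by (auto simp: m_def)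
  have "(cmod (1 - \<rho> * cis (2 * pi * t)))\<^sup>2 = (1 - \<rho> * cos (2 * pi * t))\<^sup>2 + (\<rho> * sin (2 * pi * t))\<^sup>2"
    by (simp add: cmod_power2)
  also have "\<dots> = (1 - \<rho>)\<^sup>2 + 2 * \<rho> * (1 - cos (2 * (pi * t)))"
  proof -
    have "(1 - \<rho> * c)\<^sup>2 + (\<rho> * s)\<^sup>2 = (1 - \<rho>)\<^sup>2 + 2 * \<rho> * (1 - c) + \<rho>\<^sup>2 * (s\<^sup>2 + c\<^sup>2 - 1)" for c s
      by (simp add: power2_eq_square algebra_simps)
    from this[of "cos (2 * pi * t)" "sin (2 * pi * t)"] show ?thesis by (simp add: mult.assoc)
  qed
  also have "1 - cos (2 * (pi * t)) = 2 * (sin (pi * t))\<^sup>2"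
    by (simp add: cos_double_sin)
  finally have eq: "(cmod (1 - \<rho> * cis (2 * pi * t)))\<^sup>2 = (1 - \<rho>)\<^sup>2 + 2 * \<rho> * (2 * (sin (pi * t))\<^sup>2)" .
  have "(sin (pi * t))\<^sup>2 \<ge> m\<^sup>2" using m by (intro power_mono)
  then have "2 * \<rho> * (2 * (sin (pi * t))\<^sup>2) \<ge> 1 * (1 * m\<^sup>2)" using \<rho> by (intro mult_mono) auto
  then have "(cmod (1 - \<rho> * cis (2 * pi * t)))\<^sup>2 \<ge> m\<^sup>2" "(cmod (1 - \<rho> * cis (2 * pi * t)))\<^sup>2 \<ge> (1 - \<rho>)\<^sup>2"
    using eq \<rho> by (auto intro: add_increasing)
  then have "cmod (1 - \<rho> * cis (2 * pi * t)) \<ge> m" "cmod (1 - \<rho> * cis (2 * pi * t)) \<ge> 1 - \<rho>"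
    using power2_le_imp_le norm_ge_zero by blast+
  then show ?thesis by (simp add: m_def)
qed

lemma integral_shifted_powr:
  fixes a \<beta> :: real
  assumes a: "a > 0" and b: "\<beta> > 1"
  shows "((\<lambda>t. (a + t) powr (-\<beta>)) has_integral (a powr (1 - \<beta>) - (a + 1) powr (1 - \<beta>)) / (\<beta> - 1)) {0..1}"
    "((\<lambda>t. (a + (1 - t)) powr (-\<beta>)) has_integral (a powr (1 - \<beta>) - (a + 1) powr (1 - \<beta>)) / (\<beta> - 1)) {0..1}"
proof -
  have 1: "((\<lambda>t. (a + t) powr (-\<beta>)) has_integral (- ((a + 1) powr (1 - \<beta>)) / (\<beta> - 1)) - (- ((a + 0) powr (1 - \<beta>)) / (\<beta> - 1))) {0..1}"
  proof (rule fundamental_theorem_of_calculus)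
    fix t :: real assume t: "t \<in> {0..1}"
    have "((\<lambda>t. a + t) has_real_derivative 1) (at t)" by (auto intro!: derivative_eq_intros)
    from DERIV_fun_powr[OF this, of "1 - \<beta>"]
    have "((\<lambda>t. (a + t) powr (1 - \<beta>)) has_real_derivative (1 - \<beta>) * (a + t) powr (-\<beta>)) (at t)"
      using t a by simp
    from DERIV_cmult[OF this, of "- 1 / (\<beta> - 1)"]
    have "((\<lambda>t. - ((a + t) powr (1 - \<beta>)) / (\<beta> - 1)) has_real_derivative - 1 / (\<beta> - 1) * ((1 - \<beta>) * (a + t) powr (-\<beta>))) (at t)"
      by simp
    also have "- 1 / (\<beta> - 1) * ((1 - \<beta>) * (a + t) powr (-\<beta>)) = (a + t) powr (-\<beta>)"
      using b by (simp add: field_simps)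
    finally show "((\<lambda>t. - ((a + t) powr (1 - \<beta>)) / (\<beta> - 1)) has_vector_derivative (a + t) powr - \<beta>) (at t within {0..1})"
      by (simp add: has_real_derivative_iff_has_vector_derivative has_vector_derivative_at_within)
  qed simp
  then show h: "((\<lambda>t. (a + t) powr (-\<beta>)) has_integral (a powr (1 - \<beta>) - (a + 1) powr (1 - \<beta>)) / (\<beta> - 1)) {0..1}"
    by (simp add: diff_divide_distrib)
  have "((\<lambda>t. (a + (- 1 * t + 1)) powr (-\<beta>)) has_integral (1 / \<bar>- 1\<bar>) *\<^sub>R ((a powr (1 - \<beta>) - (a + 1) powr (1 - \<beta>)) / (\<beta> - 1))) ((\<lambda>x. (1 / - 1) *\<^sub>R x + - ((1 / - 1) *\<^sub>R 1)) ` {0..1})"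
    using has_integral_affinity[of "\<lambda>t. (a + t) powr (-\<beta>)" "(a powr (1 - \<beta>) - (a + 1) powr (1 - \<beta>)) / (\<beta> - 1)" 0 1 "-1" 1] h
    by simp
  moreover have "((\<lambda>x::real. (1 / - 1) *\<^sub>R x + - ((1 / - 1) *\<^sub>R 1)) ` {0..1}) = {0..1}"
    by (auto simp: image_iff intro!: bexI[of _ "1 - x" for x])
  ultimately show "((\<lambda>t. (a + (1 - t)) powr (-\<beta>)) has_integral (a powr (1 - \<beta>) - (a + 1) powr (1 - \<beta>)) / (\<beta> - 1)) {0..1}"
    by (simp add: algebra_simps)
qed

text \<open>Cauchy's formula on the circle of radius (1 - 1/k) R. There |1 - z/R| is at least half
  of 1/k + min t (1 - t), so the integral is O(k^(\<beta> - 1)) because \<beta> > 1, while (1 -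
  1/k)^(-k) stays bounded.\<close>

lemma taylor_coeff_bound:
  fixes h :: "complex \<Rightarrow> complex" and R \<beta> D :: real
  assumes holo: "h holomorphic_on ball 0 R" and R: "R > 0" and b: "\<beta> > 1" and D: "D \<ge> 0"
    and bd: "\<And>z. z \<in> ball 0 R \<Longrightarrow> cmod (h z) \<le> D * cmod (1 - z / R) powr (-\<beta>)"
  shows "\<exists>D'. \<forall>k\<ge>2. cmod ((deriv ^^ k) h 0) / fact k * R ^ k \<le> D' * real k powr (\<beta> - 1)"
proof (intro exI allI impI)
  fix k :: nat assume k: "k \<ge> 2"
  define \<rho> where "\<rho> = 1 - 1 / real k"
  define r where "r = \<rho> * R"
  have \<rho>: "1 / 2 \<le> \<rho>" "\<rho> < 1" "1 - \<rho> = 1 / k" using k by (auto simp: \<rho>_def field_simps)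
  have r: "0 < r" "r < R" using \<rho> R by (auto simp: r_def)
  define \<gamma> where "\<gamma> = circlepath 0 r"
  have sub: "cball 0 r \<subseteq> ball (0::complex) R" using r by auto
  have "((\<lambda>u. h u / (u - 0) ^ Suc k) has_contour_integral (2 * pi * \<i> / fact k * (deriv ^^ k) h 0)) \<gamma>"
    unfolding \<gamma>_def
  proof (rule Cauchy_has_contour_integral_higher_derivative_circlepath)
    show "continuous_on (cball 0 r) h"
      using holo sub by (meson holomorphic_on_imp_continuous_on continuous_on_subset)
    show "h holomorphic_on ball 0 r" using holo sub ball_subset_cball by (meson holomorphic_on_subset order_trans)
  qed (use r in auto)
  then have I: "((\<lambda>t. h (\<gamma> t) / \<gamma> t ^ Suc k * vector_derivative \<gamma> (at t)) has_integral (2 * pi * \<i> / fact k * (deriv ^^ k) h 0)) {0..1}"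
    by (simp add: has_contour_integral)
  have \<gamma>: "\<gamma> t = r * cis (2 * pi * t)" for t
    by (simp add: \<gamma>_def circlepath cis_conv_exp mult_ac)
  have vd: "cmod (vector_derivative \<gamma> (at t)) = 2 * pi * r" for t
    unfolding \<gamma>_def using r by (simp add: vector_derivative_circlepath norm_mult norm_exp_eq_Re)
  \<comment> \<open>The power of the minimum is bounded by the sum of two powers, both with explicit
    integrals.\<close>
  define g where "g t = 2 * pi / r ^ k * (D * 2 powr \<beta>) * ((1 / k + t) powr (-\<beta>) + (1 / k + (1 - t)) powr (-\<beta>))" for t
  define J where "J = ((1 / k) powr (1 - \<beta>) - (1 / real k + 1) powr (1 - \<beta>)) / (\<beta> - 1)"
  have gI: "(g has_integral (2 * pi / r ^ k * (D * 2 powr \<beta>) * (J + J))) {0..1}"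
    unfolding g_def J_def using k b
    by (intro has_integral_mult_right has_integral_add integral_shifted_powr) auto
  have le: "cmod (h (\<gamma> t) / \<gamma> t ^ Suc k * vector_derivative \<gamma> (at t)) \<le> g t" if t: "t \<in> {0..1}" for t
  proof -
    have t': "0 \<le> t" "t \<le> 1" using t by auto
    have ng: "cmod (\<gamma> t) = r" using r by (simp add: \<gamma> norm_mult)
    then have in_ball: "\<gamma> t \<in> ball 0 R" using r by simp
    define m where "m = min t (1 - t)"
    have m0: "0 < 1 / k + m" using t' k by (auto simp: m_def intro!: add_pos_nonneg)
    have "1 - \<gamma> t / R = 1 - \<rho> * cis (2 * pi * t)" using R by (simp add: \<gamma> r_def)
    then have "(1 / k + m) / 2 \<le> cmod (1 - \<gamma> t / R)"
      using cmod_one_minus_cis_ge[OF t', of \<rho>] \<rho> by (simp add: m_def)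
    then have "cmod (1 - \<gamma> t / R) powr (-\<beta>) \<le> ((1 / k + m) / 2) powr (-\<beta>)"
      using m0 b by (intro powr_mono2') auto
    also have "\<dots> = 2 powr \<beta> * (1 / k + m) powr (-\<beta>)"
      using m0 by (simp add: powr_divide powr_minus field_simps)
    also have "(1 / k + m) powr (-\<beta>) \<le> (1 / k + t) powr (-\<beta>) + (1 / k + (1 - t)) powr (-\<beta>)"
      by (auto simp: m_def min_def)
    finally have "cmod (1 - \<gamma> t / R) powr (-\<beta>) \<le> 2 powr \<beta> * ((1 / k + t) powr (-\<beta>) + (1 / k + (1 - t)) powr (-\<beta>))"
      by simp
    then have "cmod (h (\<gamma> t)) \<le> D * (2 powr \<beta> * ((1 / k + t) powr (-\<beta>) + (1 / k + (1 - t)) powr (-\<beta>)))"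
      using bd[OF in_ball] D by (meson mult_left_mono order_trans)
    then have "cmod (h (\<gamma> t)) * (2 * pi / r ^ k) \<le> D * (2 powr \<beta> * ((1 / k + t) powr (-\<beta>) + (1 / k + (1 - t)) powr (-\<beta>))) * (2 * pi / r ^ k)"
      using r by (intro mult_right_mono) auto
    moreover have "cmod (h (\<gamma> t) / \<gamma> t ^ Suc k * vector_derivative \<gamma> (at t)) = cmod (h (\<gamma> t)) * (2 * pi / r ^ k)"
      using r by (simp add: norm_mult norm_divide norm_power ng vd)
    ultimately show ?thesis unfolding g_def by (simp only: mult_ac)
  qed
  have "cmod (2 * pi * \<i> / fact k * (deriv ^^ k) h 0) \<le> 2 * pi / r ^ k * (D * 2 powr \<beta>) * (J + J)"
    using integral_norm_bound_integral[OF has_integral_integrable[OF I] has_integral_integrable[OF gI] le]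
    unfolding integral_unique[OF I] integral_unique[OF gI] .
  moreover have JJ: "J + J \<le> 2 * (real k powr (\<beta> - 1) / (\<beta> - 1))"
  proof -
    have "(1 / k) powr (1 - \<beta>) = real k powr (\<beta> - 1)" using powr_minus_divide[of "real k" "1 - \<beta>"] by (simp add: powr_divide)
    then have "J \<le> real k powr (\<beta> - 1) / (\<beta> - 1)" unfolding J_def using b by (intro divide_right_mono) auto
    then show ?thesis by simp
  qed
  moreover have "cmod (2 * pi * \<i> / fact k * (deriv ^^ k) h 0) = 2 * pi * (cmod ((deriv ^^ k) h 0) / fact k)"
    by (simp add: norm_mult norm_divide)
  moreover have "2 * pi / r ^ k * (D * 2 powr \<beta>) * (J + J) \<le> 2 * pi / r ^ k * (D * 2 powr \<beta>) * (2 * (real k powr (\<beta> - 1) / (\<beta> - 1)))"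
    using D r by (intro mult_left_mono JJ) auto
  ultimately have "2 * pi * (cmod ((deriv ^^ k) h 0) / fact k) \<le> 2 * pi / r ^ k * (D * 2 powr \<beta>) * (2 * (real k powr (\<beta> - 1) / (\<beta> - 1)))"
    by linarith
  then have "cmod ((deriv ^^ k) h 0) / fact k \<le> (D * 2 powr \<beta>) * (2 * (real k powr (\<beta> - 1) / (\<beta> - 1))) / r ^ k"
  proof -
    define Y where "Y = (D * 2 powr \<beta>) * (2 * (real k powr (\<beta> - 1) / (\<beta> - 1)))"
    assume "2 * pi * (cmod ((deriv ^^ k) h 0) / fact k) \<le> 2 * pi / r ^ k * (D * 2 powr \<beta>) * (2 * (real k powr (\<beta> - 1) / (\<beta> - 1)))"
    then have "(2 * pi) * (cmod ((deriv ^^ k) h 0) / fact k) \<le> (2 * pi) * (Y / r ^ k)"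
      by (simp add: Y_def mult_ac)
    then have "cmod ((deriv ^^ k) h 0) / fact k \<le> Y / r ^ k" by (subst (asm) mult_le_cancel_left_pos) simp_all
    then show ?thesis by (simp only: Y_def)
  qed
  then have "cmod ((deriv ^^ k) h 0) / fact k * r ^ k \<le> (D * 2 powr \<beta>) * (2 * (real k powr (\<beta> - 1) / (\<beta> - 1)))"
    by (simp only: pos_le_divide_eq[OF zero_less_power[OF r(1)]])
  then have "cmod ((deriv ^^ k) h 0) / fact k * r ^ k * exp 2 \<le> (D * 2 powr \<beta>) * (2 * (real k powr (\<beta> - 1) / (\<beta> - 1))) * exp 2"
    by (rule mult_right_mono) simp
  \<comment> \<open>1 / \<rho> = 1 + 1/(k - 1) \<le> exp (1/(k - 1)), and k/(k - 1) \<le> 2 for k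
    \<ge> 2.\<close>
  moreover have "R ^ k \<le> r ^ k * exp 2"
  proof -
    have "1 / \<rho> = 1 + 1 / (real k - 1)" using k by (simp add: \<rho>_def field_simps)
    also have "\<dots> \<le> exp (1 / (real k - 1))" by (rule exp_ge_add_one_self)
    finally have "(1 / \<rho>) ^ k \<le> exp (1 / (real k - 1)) ^ k" using \<rho> by (intro power_mono) auto
    also have "\<dots> = exp (k / (real k - 1))" by (simp add: exp_of_nat_mult[symmetric])
    also have "\<dots> \<le> exp 2" using k by (simp add: divide_le_eq)
    finally have "1 \<le> exp 2 * \<rho> ^ k" using \<rho> by (simp add: power_divide divide_le_eq)
    then have "R ^ k * 1 \<le> R ^ k * (exp 2 * \<rho> ^ k)" using R by (intro mult_left_mono) auto
    then show ?thesis by (simp add: r_def power_mult_distrib mult_ac)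
  qed
  then have "cmod ((deriv ^^ k) h 0) / fact k * R ^ k \<le> cmod ((deriv ^^ k) h 0) / fact k * (r ^ k * exp 2)"
    by (intro mult_left_mono) auto
  ultimately show "cmod ((deriv ^^ k) h 0) / fact k * R ^ k \<le> (D * 2 powr \<beta> * 2 / (\<beta> - 1) * exp 2) * real k powr (\<beta> - 1)"
    by (simp add: mult_ac)
qed

lemma fact_add_ge: "(fact (k + n) :: real) \<ge> fact k * real k ^ n"
proof (induction n)
  case (Suc n)
  have "fact k * real k ^ Suc n = real k * (fact k * real k ^ n)" by simp
  also have "\<dots> \<le> real (Suc (k + n)) * fact (k + n)" using Suc by (intro mult_mono) auto
  finally show ?case by simp
qed simp

text \<open>The n-th derivative has Taylor coefficients (k+n)!/k! times \<alpha>_(k+n), and the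
  quotient is at least k^n, so n derivatives gain n powers of l. This reaches l \<ge> n + 2; the
  finitely many smaller l go into the constant.\<close>

lemma power_series_coeff_bound:
  fixes f :: "complex \<Rightarrow> complex" and \<alpha> :: "nat \<Rightarrow> complex" and R \<beta> D :: real and n :: nat
  assumes R: "R > 0" and f: "f holomorphic_on ball 0 R" and \<alpha>: "\<And>l. (deriv ^^ l) f 0 = fact l * \<alpha> l"
    and b: "\<beta> > 1" "\<beta> \<le> n + 1" and D: "D \<ge> 0"
    and bd: "\<And>z. z \<in> ball 0 R \<Longrightarrow> cmod ((deriv ^^ n) f z) \<le> D * cmod (1 - z / R) powr (-\<beta>)"
  shows "\<exists>D'. \<forall>l\<ge>1. cmod (\<alpha> l) * R ^ l \<le> D' * real l powr (\<beta> - 1 - n)"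
proof -
  have holo: "(deriv ^^ n) f holomorphic_on ball 0 R" by (rule holomorphic_higher_deriv[OF f]) simp
  obtain D1 where D1: "\<And>k. k \<ge> 2 \<Longrightarrow> cmod ((deriv ^^ k) ((deriv ^^ n) f) 0) / fact k * R ^ k \<le> D1 * real k powr (\<beta> - 1)"
    using taylor_coeff_bound[OF holo R b(1) D bd] by blast
  define D2 where "D2 = \<bar>D1\<bar> * R ^ n * (1 / (n + 1)) powr (\<beta> - 1 - n)"
  have big: "cmod (\<alpha> l) * R ^ l \<le> D2 * real l powr (\<beta> - 1 - n)" if l: "l \<ge> n + 2" for l
  proof -
    define k where "k = l - n"
    have k: "l = k + n" "k \<ge> 2" using l by (auto simp: k_def)
    have "(deriv ^^ k) ((deriv ^^ n) f) 0 = fact l * \<alpha> l" using \<alpha>[of l] by (simp add: k(1) funpow_add)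
    then have "fact l / fact k * cmod (\<alpha> l) * R ^ k \<le> D1 * real k powr (\<beta> - 1)"
      using D1[OF k(2)] by (simp add: norm_mult)
    moreover have "real k ^ n * cmod (\<alpha> l) * R ^ k \<le> fact l / fact k * cmod (\<alpha> l) * R ^ k"
      using fact_add_ge[of k n] R unfolding k(1) by (intro mult_right_mono) (auto simp: pos_le_divide_eq mult.commute)
    ultimately have "real k ^ n * (cmod (\<alpha> l) * R ^ k) \<le> D1 * real k powr (\<beta> - 1)" by (simp add: mult.assoc)
    also have "\<dots> \<le> \<bar>D1\<bar> * real k powr (\<beta> - 1)" by (intro mult_right_mono) auto
    finally have "cmod (\<alpha> l) * R ^ k \<le> \<bar>D1\<bar> * real k powr (\<beta> - 1) / real k ^ n"
      using k by (simp add: pos_le_divide_eq mult.commute)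
    also have "\<dots> = \<bar>D1\<bar> * real k powr (\<beta> - 1 - n)"
      using k by (simp add: powr_diff powr_realpow)
    finally have "cmod (\<alpha> l) * R ^ k \<le> \<bar>D1\<bar> * real k powr (\<beta> - 1 - n)" .
    \<comment> \<open>The exponent is at most 0 since \<beta> \<le> n + 1, so a lower bound on k is
      wanted: l = k + n \<le> k (n + 1).\<close>
    moreover have "real k powr (\<beta> - 1 - n) \<le> (real l * (1 / (n + 1))) powr (\<beta> - 1 - n)"
    proof (rule powr_mono2')
      have "l \<le> k * (n + 1)" using k mult_le_mono1[of 1 k n] by (simp add: algebra_simps)
      then have "real l \<le> real k * (real n + 1)" by (metis of_nat_le_iff of_nat_mult of_nat_add of_nat_1)
      then show "real l * (1 / (n + 1)) \<le> real k" by (simp add: pos_divide_le_eq add.commute)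
    qed (use b k in auto)
    ultimately have "cmod (\<alpha> l) * R ^ k \<le> \<bar>D1\<bar> * (real l * (1 / (n + 1))) powr (\<beta> - 1 - n)"
      by (meson abs_ge_zero mult_left_mono order_trans)
    then have "cmod (\<alpha> l) * R ^ k * R ^ n \<le> \<bar>D1\<bar> * (real l * (1 / (n + 1))) powr (\<beta> - 1 - n) * R ^ n"
      using R by (intro mult_right_mono) auto
    also have "(real l * (1 / (n + 1))) powr (\<beta> - 1 - n) = real l powr (\<beta> - 1 - n) * (1 / (n + 1)) powr (\<beta> - 1 - n)"
      by (rule powr_mult)
    finally show ?thesis by (simp add: D2_def k(1) power_add mult_ac)
  qed
  define D3 where "D3 = (\<Sum>l\<in>{1..n+1}. cmod (\<alpha> l) * R ^ l / real l powr (\<beta> - 1 - n))"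
  have small: "cmod (\<alpha> l) * R ^ l \<le> D3 * real l powr (\<beta> - 1 - n)" if l: "l \<in> {1..n+1}" for l
  proof -
    have "cmod (\<alpha> l) * R ^ l / real l powr (\<beta> - 1 - n) \<le> D3"
      unfolding D3_def using R by (intro member_le_sum l) auto
    then show ?thesis using l by (simp add: pos_divide_le_eq)
  qed
  have "D2 \<ge> 0" using R by (simp add: D2_def)
  have "D3 \<ge> 0" unfolding D3_def using R by (intro sum_nonneg divide_nonneg_nonneg mult_nonneg_nonneg) auto
  have "cmod (\<alpha> l) * R ^ l \<le> (D2 + D3) * real l powr (\<beta> - 1 - n)" if "l \<ge> 1" for l
  proof (cases "l \<ge> n + 2")
    case True
    from big[OF this] show ?thesis using \<open>D3 \<ge> 0\<close> by (simp add: distrib_right add_increasing2)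
  next
    case False
    then have "l \<in> {1..n+1}" using that by auto
    from small[OF this] show ?thesis using \<open>D2 \<ge> 0\<close> by (simp add: distrib_right add_increasing)
  qed
  then show ?thesis by blast
qed

section \<open>The indented domain, and bounds carried from R to the whole disc\<close>

context
  fixes R \<eta> \<phi> :: real
  assumes R: "R > 0" and eta: "\<eta> > 0" and phi: "0 < \<phi>" "\<phi> < pi / 2"
begin

lemma one_plus_cis_gt: "cmod (1 + complex_of_real \<eta> * cis \<phi>) > 1"
proof -
  have "cos \<phi> > 0" using phi by (intro cos_gt_zero_pi) auto
  then have "1 < \<bar>Re (1 + complex_of_real \<eta> * cis \<phi>)\<bar>" using eta by simp
  also have "\<dots> \<le> cmod (1 + complex_of_real \<eta> * cis \<phi>)" by (rule abs_Re_le_cmod)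
  finally show ?thesis .
qed

text \<open>The cosine removes the discontinuous \<open>Arg\<close>, and the strict inequality fails
  by itself at z = R. Openness then follows from continuity of both sides.\<close>

lemma Delta0_alt: "Delta0 R \<eta> \<phi> = {z. cmod z < R * cmod (1 + complex_of_real \<eta> * cis \<phi>)
    \<and> Re (z - R) < cmod (z - R) * cos \<phi>}"
proof -
  have "(z \<noteq> complex_of_real R \<and> \<phi> < \<bar>Arg (z - complex_of_real R)\<bar>) \<longleftrightarrow> Re (z - R) < cmod (z - R) * cos \<phi>" for z
  proof (cases "z = R")
    case False
    define u where "u = z - complex_of_real R"
    have u: "u \<noteq> 0" using False by (simp add: u_def)
    have "Re u = cmod u * cos (Arg u)"
      using rcis_cmod_Arg[of u] by (metis Re_rcis)
    then have "Re u < cmod u * cos \<phi> \<longleftrightarrow> cos \<bar>Arg u\<bar> < cos \<phi>" using u by simp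
    also have "\<dots> \<longleftrightarrow> \<phi> < \<bar>Arg u\<bar>"
      using Arg_bounded[of u] phi by (intro cos_mono_less_eq) auto
    finally show ?thesis using False by (simp add: u_def)
  qed simp
  then show ?thesis unfolding Delta0_def by blast
qed

lemma open_Delta0: "open (Delta0 R \<eta> \<phi>)"
  unfolding Delta0_alt by (intro open_Collect_conj open_Collect_less continuous_intros)

lemma cball_subset_Delta0:
  assumes "cmod z \<le> R" "z \<noteq> complex_of_real R"
  shows "z \<in> Delta0 R \<eta> \<phi>"
proof -
  have "cmod z < R * cmod (1 + complex_of_real \<eta> * cis \<phi>)"
  proof -
    have "R * 1 < R * cmod (1 + complex_of_real \<eta> * cis \<phi>)" using R one_plus_cis_gt by (intro mult_strict_left_mono) auto
    then show ?thesis using assms by linarith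
  qed
  moreover have "Re (z - R) < cmod (z - R) * cos \<phi>"
  proof -
    have "Re z \<le> R" using complex_Re_le_cmod[of z] assms by linarith
    moreover have "cmod (z - R) * cos \<phi> > 0"
      using assms phi by (intro mult_pos_pos cos_gt_zero_pi) auto
    ultimately show ?thesis by simp
  qed
  ultimately show ?thesis unfolding Delta0_alt by simp
qed

lemma ball_subset_Delta0: "ball 0 R \<subseteq> Delta0 R \<eta> \<phi>"
proof
  fix z :: complex assume "z \<in> ball 0 R"
  then show "z \<in> Delta0 R \<eta> \<phi>" using R by (intro cball_subset_Delta0) auto
qed

text \<open>Away from R the closed disc is a compact part of the domain, on which \<open>h\<close>
  is bounded. As |1 - z/R| \<le> 2 on the disc, a constant is dominated by a multiple of |1 -
  z/R|^(-\<beta>).\<close>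

lemma disc_bound_of_local_bound:
  fixes h :: "complex \<Rightarrow> complex" and \<beta> D :: real
  assumes holo: "h holomorphic_on Delta0 R \<eta> \<phi>" and b: "\<beta> > 0"
    and loc: "\<forall>\<^sub>F z in nearR R \<eta> \<phi>. cmod (h z) \<le> D * cmod (1 - z / R) powr (-\<beta>)"
  shows "\<exists>D'\<ge>0. \<forall>z\<in>ball 0 R. cmod (h z) \<le> D' * cmod (1 - z / R) powr (-\<beta>)"
proof -
  obtain d where d: "d > 0" "\<And>z. z \<in> Delta0 R \<eta> \<phi> \<Longrightarrow> z \<noteq> R \<Longrightarrow> dist z R < d \<Longrightarrow> cmod (h z) \<le> D * cmod (1 - z / R) powr (-\<beta>)"
    using loc unfolding nearR_def eventually_at by blast
  define S where "S = cball 0 R - ball (complex_of_real R) d"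
  have "compact S" unfolding S_def by (intro compact_diff) auto
  moreover have "S \<subseteq> Delta0 R \<eta> \<phi>"
    unfolding S_def using d(1) by (auto intro!: cball_subset_Delta0)
  then have "continuous_on S h" using holo holomorphic_on_imp_continuous_on continuous_on_subset by blast
  ultimately have "bounded (h ` S)" by (intro compact_imp_bounded compact_continuous_image)
  then obtain B where B: "\<And>z. z \<in> S \<Longrightarrow> cmod (h z) \<le> B" unfolding bounded_iff by blast
  have "cmod (h z) \<le> (\<bar>D\<bar> + \<bar>B\<bar> * 2 powr \<beta>) * cmod (1 - z / R) powr (-\<beta>)" if z: "z \<in> ball 0 R" for z
  proof (cases "dist z R < d")
    case True
    have "cmod (h z) \<le> D * cmod (1 - z / R) powr (-\<beta>)"
      using z True ball_subset_Delta0 by (intro d(2)) auto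
    also have "\<dots> \<le> (\<bar>D\<bar> + \<bar>B\<bar> * 2 powr \<beta>) * cmod (1 - z / R) powr (-\<beta>)"
      by (intro mult_right_mono add_increasing2) auto
    finally show ?thesis .
  next
    case False
    have "cmod (1 - z / R) \<le> 1 + cmod (z / R)" using norm_triangle_ineq4[of 1 "z / R"] by simp
    also have "\<dots> \<le> 2" using z R by (simp add: norm_divide)
    finally have le2: "cmod (1 - z / R) \<le> 2" .
    have pos: "cmod (1 - z / R) > 0" using z R by auto
    have "2 powr (-\<beta>) \<le> cmod (1 - z / R) powr (-\<beta>)" using le2 pos b by (intro powr_mono2') auto
    then have "2 powr \<beta> * 2 powr (-\<beta>) \<le> 2 powr \<beta> * cmod (1 - z / R) powr (-\<beta>)" by (rule mult_left_mono) simp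
    then have one: "1 \<le> 2 powr \<beta> * cmod (1 - z / R) powr (-\<beta>)" by (simp add: powr_minus)
    have "z \<in> S" using z False by (auto simp: S_def dist_commute)
    then have "cmod (h z) \<le> \<bar>B\<bar> * 1" using B[of z] by simp
    also have "\<dots> \<le> \<bar>B\<bar> * (2 powr \<beta> * cmod (1 - z / R) powr (-\<beta>))" by (intro mult_left_mono one) simp
    also have "\<dots> \<le> (\<bar>D\<bar> + \<bar>B\<bar> * 2 powr \<beta>) * cmod (1 - z / R) powr (-\<beta>)"
      unfolding mult.assoc[symmetric] by (intro mult_right_mono add_increasing) auto
    finally show ?thesis .
  qed
  then show ?thesis by (intro exI[of _ "\<bar>D\<bar> + \<bar>B\<bar> * 2 powr \<beta>"]) auto
qed

lemma nearR_small:
  assumes "e > 0"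
  shows "\<forall>\<^sub>F z in nearR R \<eta> \<phi>. z \<in> Delta0 R \<eta> \<phi> \<and> z \<noteq> R \<and> cmod (1 - z / R) < e \<and> R / 2 \<le> cmod z \<and> cmod z \<le> 2 * R"
proof -
  define d where "d = min (e * R) (R / 2)"
  have "d > 0" using assms R by (simp add: d_def)
  moreover have "z \<in> Delta0 R \<eta> \<phi> \<and> z \<noteq> R \<and> cmod (1 - z / R) < e \<and> R / 2 \<le> cmod z \<and> cmod z \<le> 2 * R"
    if "z \<in> Delta0 R \<eta> \<phi>" "z \<noteq> R" "dist z R < d" for z
  proof -
    have dz: "cmod (z - R) < d" using that by (simp add: dist_norm)
    have "1 - z / R = (R - z) / R" using R by (simp add: field_simps)
    then have "cmod (1 - z / R) = cmod (z - R) / R" using R by (simp add: norm_divide norm_minus_commute)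
    also have "\<dots> < e" using dz R by (simp add: d_def pos_divide_less_eq)
    finally have 1: "cmod (1 - z / R) < e" .
    have "cmod z \<le> cmod (z - R) + R" using norm_triangle_ineq[of "z - R" R] R by simp
    moreover have "R \<le> cmod (z - R) + cmod z" using norm_triangle_ineq[of "R - z" z] R by (simp add: norm_minus_commute)
    ultimately show ?thesis using that 1 dz R by (auto simp: d_def)
  qed
  ultimately show ?thesis unfolding nearR_def eventually_at by blast
qed

end

lemma higher_deriv_of_power_series:
  fixes f :: "complex \<Rightarrow> complex" and a :: "nat \<Rightarrow> complex"
  assumes R: "R > 0" and sums: "\<And>z. z \<in> ball 0 R \<Longrightarrow> (\<lambda>j. a j * z ^ j) sums f z"
  shows "(deriv ^^ l) f 0 = fact l * a l" "f holomorphic_on ball 0 R"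
proof -
  show "f holomorphic_on ball 0 R"
    by (rule power_series_holomorphic[where a = a]) (use sums in simp)
  have "conv_radius a \<ge> ereal R"
  proof (rule conv_radius_geI_ex')
    fix r :: real assume "0 < r" "ereal r < ereal R"
    then show "summable (\<lambda>n. a n * of_real r ^ n)" using sums[of "of_real r"] by (auto simp: sums_iff)
  qed
  then have "fps_conv_radius (Abs_fps a) > 0"
    using R unfolding fps_conv_radius_def by (simp add: Abs_fps_inverse) (metis ereal_less(2) less_le_trans)
  moreover have "eventually (\<lambda>z. eval_fps (Abs_fps a) z = f z) (nhds 0)"
  proof -
    have "eventually (\<lambda>z. z \<in> ball 0 R) (nhds (0::complex))" using R by (intro eventually_nhds_in_open) auto
    then show ?thesis
      by eventually_elim (use sums in \<open>auto simp: eval_fps_def sums_iff\<close>)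
  qed
  ultimately have "f has_fps_expansion Abs_fps a" by (simp add: has_fps_expansion_def)
  from fps_nth_fps_expansion[OF this, of l] show "(deriv ^^ l) f 0 = fact l * a l" by (simp add: field_simps)
qed

section \<open>Coefficients of the two generating functions\<close>

lemma gcoef_sums:
  assumes "conv_radius (gcoef a) = ereal R" "\<And>z. z \<in> ball 0 R \<Longrightarrow> G z = (\<Sum>j. gcoef a j * z ^ j)" "z \<in> ball 0 R"
  shows "(\<lambda>j. gcoef a j * z ^ j) sums G z"
proof -
  have "ereal (norm z) < conv_radius (gcoef a)" using assms by simp
  then have "summable (\<lambda>j. gcoef a j * z ^ j)" by (rule summable_in_conv_radius)
  then show ?thesis using assms by (simp add: summable_sums)
qed

lemma cmod_gcoef: "cmod (gcoef a l) = \<bar>a l\<bar> / l"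
  unfolding gcoef_def norm_of_real by (simp add: abs_divide)

lemma bigo_powr_bound:
  fixes e :: "complex \<Rightarrow> complex"
  assumes "e \<in> O[F](\<lambda>z. (1 - z / complex_of_real R) powr complex_of_real d)"
  shows "\<exists>c>0. \<forall>\<^sub>F z in F. cmod (e z) \<le> c * cmod (1 - z / complex_of_real R) powr d"
proof -
  obtain c where "c > 0" "\<forall>\<^sub>F z in F. norm (e z) \<le> c * norm ((1 - z / complex_of_real R) powr complex_of_real d)"
    using assms by (auto elim: landau_o.bigE)
  then show ?thesis by (auto simp: norm_powr_real_powr')
qed

text \<open>After n > s derivatives the singular term blows up at R, so its expansion becomes a
  growth bound of exponent n - s. For \<kappa>_l / l this yields the power (n - s) - 1 - n = - s -
  1.\<close>

lemma kappa_coeff_bound: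
  fixes \<kappa> :: "nat \<Rightarrow> real" and G :: "complex \<Rightarrow> complex" and d :: "nat \<Rightarrow> real"
  assumes R: "R > 0" and par: "\<eta> > 0" "0 < \<phi>" "\<phi> < pi / 2"
    and nonneg: "\<And>j. \<kappa> j \<ge> 0" and radius: "conv_radius (gcoef \<kappa>) = ereal R"
    and holo: "G holomorphic_on Delta0 R \<eta> \<phi>"
    and ext: "\<And>z. z \<in> ball 0 R \<Longrightarrow> G z = (\<Sum>j. gcoef \<kappa> j * z ^ j)"
    and s: "s > 1" and d: "\<And>n. d n > 0"
    and asym: "\<And>n::nat. real n > s \<Longrightarrow>
        \<exists>e. e \<in> O[nearR R \<eta> \<phi>](\<lambda>z. (1 - z / complex_of_real R) powr complex_of_real (d n)) \<and>
            (\<forall>\<^sub>F z in nearR R \<eta> \<phi>.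
               gbrace n G z = complex_of_real (b n) * (1 - z / complex_of_real R) powr complex_of_real (s - real n) * (1 + e z))"
  shows "\<exists>A. \<forall>l\<ge>1. \<kappa> l * R ^ l \<le> A * real l powr (-s)"
proof -
  \<comment> \<open>The offset makes n - s \<ge> 2, so \<beta> = n - s exceeds 1.\<close>
  define n where "n = nat \<lceil>s\<rceil> + 2"
  have n: "real n \<ge> s + 2" unfolding n_def by linarith
  have "real n > s" using n by simp
  from asym[OF this] obtain e where e: "e \<in> O[nearR R \<eta> \<phi>](\<lambda>z. (1 - z / complex_of_real R) powr complex_of_real (d n))"
    "\<forall>\<^sub>F z in nearR R \<eta> \<phi>. gbrace n G z = complex_of_real (b n) * (1 - z / complex_of_real R) powr complex_of_real (s - real n) * (1 + e z)"
    by blast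
  obtain C where C: "C > 0" "\<forall>\<^sub>F z in nearR R \<eta> \<phi>. cmod (e z) \<le> C * cmod (1 - z / complex_of_real R) powr d n"
    using bigo_powr_bound[OF e(1)] by blast
  have "\<forall>\<^sub>F z in nearR R \<eta> \<phi>. cmod ((deriv ^^ n) G z) \<le> (\<bar>b n\<bar> * (1 + C) * (2 / R) ^ n) * cmod (1 - z / R) powr (-(n - s))"
    using e(2) C(2) nearR_small[OF R par zero_less_one]
  proof eventually_elim
    case (elim z)
    define x where "x = cmod (1 - z / R)"
    have x: "0 \<le> x" "x \<le> 1" using elim by (auto simp: x_def)
    have "x powr d n \<le> 1" using x d[of n] by (simp add: powr_le1 less_imp_le)
    then have "cmod (e z) \<le> C * 1" using elim(2) C(1) unfolding x_def[symmetric] by (meson mult_left_mono order_trans less_imp_le)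
    then have e1: "cmod (1 + e z) \<le> 1 + C" using norm_triangle_ineq[of 1 "e z"] by simp
    have "cmod (z ^ n * (deriv ^^ n) G z) = \<bar>b n\<bar> * x powr (s - n) * cmod (1 + e z)"
      using elim(1) by (simp add: gbrace_def norm_mult norm_powr_real_powr' x_def)
    also have "\<dots> \<le> \<bar>b n\<bar> * x powr (s - n) * (1 + C)" by (intro mult_left_mono e1) auto
    finally have 1: "cmod z ^ n * cmod ((deriv ^^ n) G z) \<le> \<bar>b n\<bar> * x powr (s - n) * (1 + C)"
      by (simp add: norm_mult norm_power)
    have "(R / 2) ^ n * cmod ((deriv ^^ n) G z) \<le> cmod z ^ n * cmod ((deriv ^^ n) G z)"
      using elim R by (intro mult_right_mono power_mono) auto
    with 1 have "(R / 2) ^ n * cmod ((deriv ^^ n) G z) \<le> \<bar>b n\<bar> * x powr (s - n) * (1 + C)" by linarith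
    then have "(2 / R) ^ n * ((R / 2) ^ n * cmod ((deriv ^^ n) G z)) \<le> (2 / R) ^ n * (\<bar>b n\<bar> * x powr (s - n) * (1 + C))"
      using R by (intro mult_left_mono) auto
    moreover have "(2 / R) ^ n * (R / 2) ^ n = 1" using R by (simp add: power_mult_distrib[symmetric])
    ultimately show ?case by (simp add: mult.assoc[symmetric]) (simp add: x_def mult_ac)
  qed
  from disc_bound_of_local_bound[OF R par holomorphic_higher_deriv[OF holo open_Delta0[OF R par]] _ this]
  obtain D where D: "D \<ge> 0" "\<And>z::complex. z \<in> ball 0 R \<Longrightarrow> cmod ((deriv ^^ n) G z) \<le> D * cmod (1 - z / R) powr (-(n - s))"
    using n by auto
  have sums: "(\<lambda>j. gcoef \<kappa> j * z ^ j) sums G z" if "z \<in> ball 0 R" for z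
    by (rule gcoef_sums[OF radius ext that])
  have "\<exists>D'. \<forall>l\<ge>1. cmod (gcoef \<kappa> l) * R ^ l \<le> D' * real l powr ((n - s) - 1 - n)"
    using power_series_coeff_bound[OF R higher_deriv_of_power_series(2)[OF R sums] higher_deriv_of_power_series(1)[OF R sums] _ _ D] n s
    by simp
  then obtain D' where D': "\<And>l. l \<ge> 1 \<Longrightarrow> cmod (gcoef \<kappa> l) * R ^ l \<le> D' * real l powr ((n - s) - 1 - n)" by blast
  have "\<kappa> l * R ^ l \<le> D' * real l powr (-s)" if l: "l \<ge> 1" for l
  proof -
    have "\<kappa> l / l * R ^ l \<le> D' * real l powr (-s - 1)" using D'[OF l] nonneg[of l] by (simp add: cmod_gcoef)
    then have "real l * (\<kappa> l / l * R ^ l) \<le> real l * (D' * real l powr (-s - 1))" by (rule mult_left_mono) simp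
    moreover have "real l * real l powr (-s - 1) = real l powr (-s)" using l by (simp add: powr_diff)
    ultimately show ?thesis using l by (simp add: mult.left_commute)
  qed
  then show ?thesis by blast
qed

text \<open>Adding \<theta>s log(1 - z/R) to \<open>G\<close> subtracts \<theta>s / R^l from
  \<theta>_l. In the second derivative the double poles cancel up to |1 - z/R|^(\<delta> - 2), and
  the gain \<delta> makes the coefficient error decay faster than 1/l.\<close>

lemma theta_coeff_bound:
  fixes \<theta> :: "nat \<Rightarrow> real" and G :: "complex \<Rightarrow> complex"
  assumes R: "R > 0" and par: "\<eta> > 0" "0 < \<phi>" "\<phi> < pi / 2"
    and radius: "conv_radius (gcoef \<theta>) = ereal R"
    and holo: "G holomorphic_on Delta0 R \<eta> \<phi>"
    and ext: "\<And>z. z \<in> ball 0 R \<Longrightarrow> G z = (\<Sum>j. gcoef \<theta> j * z ^ j)"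
    and ths: "\<theta>s > 0" and d: "d > 0"
    and e: "e \<in> O[nearR R \<eta> \<phi>](\<lambda>z. (1 - z / complex_of_real R) powr complex_of_real d)"
    and asym: "\<forall>\<^sub>F z in nearR R \<eta> \<phi>. gbrace 2 G z = complex_of_real \<theta>s / (1 - z / complex_of_real R) ^ 2 * (1 + e z)"
  shows "\<exists>D \<delta>. \<delta> > 0 \<and> (\<forall>l\<ge>1. \<bar>\<theta> l * R ^ l - \<theta>s\<bar> / l \<le> D * real l powr (-1 - \<delta>))"
proof -
  \<comment> \<open>Replacing 1/z^2 by 1/R^2 leaves a relative error of order |1 - z/R|, so \<delta>
    is capped at 1; strictly below 1 keeps \<beta> = 2 - \<delta> above 1.\<close>
  define \<delta> where "\<delta> = min d (1 / 2)"
  have \<delta>: "0 < \<delta>" "\<delta> < 1" "\<delta> \<le> d" "\<delta> \<le> 1" using d by (auto simp: \<delta>_def)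
  define h where "h = (\<lambda>z. (deriv ^^ 2) G z - of_real \<theta>s / (of_real R - z) ^ 2)"
  define a where "a = (\<lambda>j. \<theta> j - \<theta>s / R ^ j)"
  define f where "f = (\<lambda>z. G z + of_real \<theta>s * Ln (1 - z / of_real R))"
  obtain C where C: "C > 0" "\<forall>\<^sub>F z in nearR R \<eta> \<phi>. cmod (e z) \<le> C * cmod (1 - z / complex_of_real R) powr d"
    using bigo_powr_bound[OF e] by blast
  have hbd: "\<forall>\<^sub>F z in nearR R \<eta> \<phi>. cmod (h z) \<le> (\<theta>s * (4 / R\<^sup>2 * (C + 3))) * cmod (1 - z / R) powr (-(2 - \<delta>))"
    using asym C(2) nearR_small[OF R par zero_less_one]
  proof eventually_elim
    case (elim z)
    define x where "x = cmod (1 - z / R)"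
    define u where "u = 1 - z / R"
    have u0: "u \<noteq> 0" using elim R by (auto simp: u_def field_simps)
    have x: "0 < x" "x \<le> 1" "x = cmod u" using elim u0 by (auto simp: x_def u_def)
    have z0: "z \<noteq> 0" using elim R by auto
    have zR: "z = R * (1 - u)" using R by (simp add: u_def)
    have "z\<^sup>2 * (deriv ^^ 2) G z = of_real \<theta>s / u\<^sup>2 * (1 + e z)" using elim(1) by (simp add: gbrace_def u_def)
    then have dd: "(deriv ^^ 2) G z = of_real \<theta>s / u\<^sup>2 * (1 + e z) / z\<^sup>2" using z0 by (metis nonzero_mult_div_cancel_left power_not_zero)
    have rz: "of_real R - z = R * u" using R by (simp add: u_def algebra_simps)
    have "h z = of_real \<theta>s / u\<^sup>2 * ((1 + e z) / z\<^sup>2 - 1 / (of_real R)\<^sup>2)"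
      unfolding h_def dd rz by (simp add: power_mult_distrib right_diff_distrib mult.commute)
    also have "(1 + e z) / z\<^sup>2 - 1 / (of_real R)\<^sup>2 = (e z + (1 - (1 - u)\<^sup>2)) / z\<^sup>2"
    proof -
      have "1 / (of_real R)\<^sup>2 = (1 - u)\<^sup>2 / z\<^sup>2" using R z0 unfolding zR by (simp add: power_mult_distrib)
      then show ?thesis by (simp add: diff_divide_distrib add_divide_distrib)
    qed
    also have "1 - (1 - u)\<^sup>2 = u * (2 - u)" by (simp add: power2_eq_square algebra_simps)
    finally have hz: "h z = of_real \<theta>s / u\<^sup>2 * ((e z + u * (2 - u)) / z\<^sup>2)" .
    have "x powr d \<le> x powr \<delta>" "x powr 1 \<le> x powr \<delta>" using x(1,2) \<delta> powr_mono'[of \<delta> d x] powr_mono'[of \<delta> 1 x] by simp_all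
    then have pw: "x powr d \<le> x powr \<delta>" "x \<le> x powr \<delta>" using x by auto
    have "cmod (e z) \<le> C * x powr \<delta>"
      using elim(2) pw(1) C(1) unfolding x_def[symmetric] by (meson mult_left_mono order_trans less_imp_le)
    moreover have "cmod (u * (2 - u)) \<le> x powr \<delta> * 3"
    proof -
      have "cmod (2 - u) \<le> 3" using norm_triangle_ineq4[of 2 u] x by simp
      then show ?thesis unfolding norm_mult x(3)[symmetric] using pw(2) by (intro mult_mono) auto
    qed
    ultimately have num: "cmod (e z + u * (2 - u)) \<le> (C + 3) * x powr \<delta>"
      using norm_triangle_ineq[of "e z" "u * (2 - u)"] by (simp add: algebra_simps)
    have den: "cmod (z\<^sup>2) \<ge> (R / 2)\<^sup>2" using elim R unfolding norm_power by (intro power_mono) auto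
    have "cmod (h z) = \<theta>s / x\<^sup>2 * (cmod (e z + u * (2 - u)) / cmod (z\<^sup>2))"
      unfolding hz using ths x(3) by (simp add: norm_mult norm_divide norm_power)
    also have "\<dots> \<le> \<theta>s / x\<^sup>2 * ((C + 3) * x powr \<delta> / (R / 2)\<^sup>2)"
      using num den R ths C(1) by (intro mult_left_mono frac_le) auto
    also have "\<dots> = (\<theta>s * (4 / R\<^sup>2 * (C + 3))) * (x powr \<delta> / x powr 2)"
      using x(1) by (simp add: power_divide powr_numeral algebra_simps)
    also have "x powr \<delta> / x powr 2 = x powr (-(2 - \<delta>))" by (simp add: powr_diff[symmetric])
    finally show ?case by (simp add: x_def)
  qed
  have hholo: "h holomorphic_on Delta0 R \<eta> \<phi>"
  proof -
    have "R \<notin> Delta0 R \<eta> \<phi>" by (simp add: Delta0_def)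
    then show ?thesis unfolding h_def
      by (intro holomorphic_intros holomorphic_higher_deriv holo open_Delta0[OF R par]) auto
  qed
  have "2 - \<delta> > 0" using \<delta> by simp
  from disc_bound_of_local_bound[OF R par hholo this hbd]
  obtain D where D: "D \<ge> 0" "\<And>z::complex. z \<in> ball 0 R \<Longrightarrow> cmod (h z) \<le> D * cmod (1 - z / R) powr (-(2 - \<delta>))"
    by auto
  have sumsG: "(\<lambda>j. gcoef \<theta> j * z ^ j) sums G z" if "z \<in> ball 0 R" for z
    by (rule gcoef_sums[OF radius ext that])
  have sums: "(\<lambda>j. gcoef a j * z ^ j) sums f z" if z: "z \<in> ball 0 R" for z
  proof -
    have nz: "norm (- z / R) < 1" using z R by (simp add: norm_divide)
    have L: "(\<lambda>j. of_real \<theta>s * ((-1) ^ Suc j / of_nat j * (- z / R) ^ j)) sums (of_real \<theta>s * Ln (1 + - z / R))"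
      by (intro sums_mult Ln_series nz)
    have fz: "f z = G z + of_real \<theta>s * Ln (1 + - z / R)" by (simp add: f_def)
    have "(\<lambda>j. gcoef \<theta> j * z ^ j + of_real \<theta>s * ((-1) ^ Suc j / of_nat j * (- z / R) ^ j)) sums f z"
      unfolding fz by (rule sums_add[OF sumsG[OF z] L])
    moreover have "gcoef \<theta> j * z ^ j + of_real \<theta>s * ((-1) ^ Suc j / of_nat j * (- z / R) ^ j) = gcoef a j * z ^ j" for j
    proof -
      have "(-1) ^ Suc j * (- z / R) ^ j = - (z ^ j / R ^ j)"
      proof -
        have "(-1) ^ j * (- (z / of_real R)) ^ j = (z / of_real R) ^ j" by (simp flip: power_mult_distrib)
        then show ?thesis by (simp add: power_divide)
      qed
      then have "of_real \<theta>s * ((-1) ^ Suc j / of_nat j * (- z / R) ^ j) = - (of_real \<theta>s / R ^ j / of_nat j * z ^ j)"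
        by simp
      then show ?thesis by (simp add: gcoef_def a_def diff_divide_distrib left_diff_distrib)
    qed
    ultimately show ?thesis by simp
  qed
  have f2: "(deriv ^^ 2) f z = h z" if z: "z \<in> ball 0 R" for z
  proof -
    have G1: "(G has_field_derivative deriv G z) (at z)" if "z \<in> ball 0 R" for z
      using holomorphic_derivI[OF holo open_Delta0[OF R par]] that ball_subset_Delta0[OF R par] by auto
    have G2: "(deriv G has_field_derivative deriv (deriv G) z) (at z)" if "z \<in> ball 0 R" for z
      using holomorphic_derivI[OF holomorphic_deriv[OF holo open_Delta0[OF R par]] open_Delta0[OF R par]] that ball_subset_Delta0[OF R par] by auto
    have nz: "1 - z / R \<notin> \<real>\<^sub>\<le>\<^sub>0" "of_real R - z \<noteq> 0" if "z \<in> ball 0 R" for z :: complex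
    proof -
      have "cmod (z / R) < 1" using that R by (simp add: norm_divide)
      then have "Re (z / R) < 1" using complex_Re_le_cmod[of "z / R"] by linarith
      then show "1 - z / R \<notin> \<real>\<^sub>\<le>\<^sub>0" by (auto simp: complex_nonpos_Reals_iff simp del: Re_divide_of_real)
      show "of_real R - z \<noteq> 0" using that R by auto
    qed
    have f1: "deriv f z = deriv G z - of_real \<theta>s / (of_real R - z)" if "z \<in> ball 0 R" for z
    proof -
      have "((\<lambda>z. 1 - z / R) has_field_derivative (- 1 / R)) (at z)" using R by (auto intro!: derivative_eq_intros)
      from DERIV_chain2[OF has_field_derivative_Ln[OF nz(1)[OF that]] this]
      have "((\<lambda>z. Ln (1 - z / R)) has_field_derivative (inverse (1 - z / R) * (- 1 / R))) (at z)" .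
      from DERIV_add[OF G1[OF that] DERIV_cmult[OF this, of "of_real \<theta>s"]]
      have "(f has_field_derivative deriv G z + of_real \<theta>s * (inverse (1 - z / R) * (- 1 / R))) (at z)" unfolding f_def .
      moreover have "inverse (1 - z / R) * (- 1 / R) = - 1 / (of_real R - z)"
        using R nz(2)[OF that] by (simp add: field_simps)
      ultimately have "(f has_field_derivative deriv G z + of_real \<theta>s * (- 1 / (of_real R - z))) (at z)" by (simp only:)
      from DERIV_imp_deriv[OF this] show ?thesis by simp
    qed
    have "((\<lambda>z. deriv G z - of_real \<theta>s / (of_real R - z)) has_field_derivative deriv (deriv G) z - of_real \<theta>s / (of_real R - z) ^ 2) (at z)"
      using nz(2)[OF z] by (auto intro!: derivative_eq_intros G2[OF z] simp: power2_eq_square)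
    then have "(deriv f has_field_derivative deriv (deriv G) z - of_real \<theta>s / (of_real R - z) ^ 2) (at z)"
      by (rule has_field_derivative_transform_within_open[where S = "ball 0 R"]) (use z f1 in auto)
    then have "deriv (deriv f) z = deriv (deriv G) z - of_real \<theta>s / (of_real R - z) ^ 2" by (rule DERIV_imp_deriv)
    then show ?thesis by (simp add: h_def numeral_2_eq_2)
  qed
  have bd: "cmod ((deriv ^^ 2) f z) \<le> D * cmod (1 - z / R) powr (-(2 - \<delta>))" if "z \<in> ball 0 R" for z
    using D(2)[OF that] f2[OF that] by simp
  have "\<exists>D'. \<forall>l\<ge>1. cmod (gcoef a l) * R ^ l \<le> D' * real l powr ((2 - \<delta>) - 1 - real 2)"
    using \<delta> by (intro power_series_coeff_bound[OF R higher_deriv_of_power_series(2)[OF R sums] higher_deriv_of_power_series(1)[OF R sums] _ _ D(1) bd]) auto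
  then obtain D' where D': "\<And>l. l \<ge> 1 \<Longrightarrow> cmod (gcoef a l) * R ^ l \<le> D' * real l powr (-1 - \<delta>)" by auto
  have "\<bar>\<theta> l * R ^ l - \<theta>s\<bar> / l \<le> D' * real l powr (-1 - \<delta>)" if l: "l \<ge> 1" for l
  proof -
    have "\<theta> l * R ^ l - \<theta>s = a l * R ^ l" using R by (simp add: a_def left_diff_distrib)
    then have "\<bar>\<theta> l * R ^ l - \<theta>s\<bar> / l = cmod (gcoef a l) * R ^ l" using R by (simp add: cmod_gcoef abs_mult)
    then show ?thesis using D'[OF l] by simp
  qed
  then show ?thesis using \<delta>(1) by blast
qed

text \<open>On (0, R) the function r G'(r) is the series of nonnegative terms \<kappa>_j R^j
  (r/R)^j. If it diverged at R, partial sums would force an infinite left limit, against the bound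
  1. Once it converges, domination gives the value, as in Abel's theorem.\<close>

lemma gbraceR_1_eq_suminf:
  fixes \<kappa> :: "nat \<Rightarrow> real" and G :: "complex \<Rightarrow> complex"
  assumes R: "R > 0" and nonneg: "\<And>j. \<kappa> j \<ge> 0"
    and radius: "conv_radius (gcoef \<kappa>) = ereal R"
    and ext: "\<And>z. z \<in> ball 0 R \<Longrightarrow> G z = (\<Sum>j. gcoef \<kappa> j * z ^ j)"
    and lt: "gbraceR 1 G R < 1"
  shows "summable (\<lambda>j. \<kappa> (Suc j) * R ^ Suc j)" "gbraceR 1 G R = ereal (\<Sum>j. \<kappa> (Suc j) * R ^ Suc j)"
proof -
  have sums: "(\<lambda>j. gcoef \<kappa> j * z ^ j) sums G z" if "z \<in> ball 0 R" for z
    by (rule gcoef_sums[OF radius ext that])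
  define c where "c j = \<kappa> (Suc j) * R ^ Suc j" for j
  have c: "c j \<ge> 0" for j using nonneg R by (simp add: c_def)
  define \<psi> where "\<psi> r = Re (gbrace 1 G (complex_of_real r))" for r
  have psi: "(\<lambda>j. c j * (r / R) ^ Suc j) sums \<psi> r" if r: "0 < r" "r < R" for r
  proof -
    have rb: "complex_of_real r \<in> ball 0 R" using r by simp
    have hd: "(G has_field_derivative deriv G (of_real r)) (at (of_real r))"
      using holomorphic_derivI[OF higher_deriv_of_power_series(2)[OF R sums] open_ball rb] .
    have "(\<lambda>n. diffs (gcoef \<kappa>) n * of_real r ^ n) sums deriv G (of_real r)"
      by (rule termdiffs_sums_strong[OF _ hd, where K = R]) (use sums rb in auto)
    then have "(\<lambda>n. of_real r * (diffs (gcoef \<kappa>) n * of_real r ^ n)) sums (of_real r * deriv G (of_real r))"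
      by (rule sums_mult)
    moreover have "of_real r * (diffs (gcoef \<kappa>) n * of_real r ^ n) = of_real (c n * (r / R) ^ Suc n)" for n
      using R by (simp add: diffs_def gcoef_def c_def power_divide field_simps del: of_nat_Suc)
    ultimately have "(\<lambda>n. of_real (c n * (r / R) ^ Suc n)) sums gbrace 1 G (of_real r)"
      by (simp add: gbrace_def)
    from sums_Re[OF this] show ?thesis by (simp add: \<psi>_def)
  qed
  have ev: "\<forall>\<^sub>F r in at_left R. 0 < r \<and> r < R" using eventually_at_left_real[OF R] by eventually_elim auto
  have pw: "((\<lambda>r. c j * (r / R) ^ Suc j) \<longlongrightarrow> c j) (at_left R)" for j
  proof -
    have "((\<lambda>r. c j * (r / R) ^ Suc j) \<longlongrightarrow> c j * (R / R) ^ Suc j) (at_left R)" by (intro tendsto_intros) (use R in auto)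
    then show ?thesis using R by simp
  qed
  have "summable c"
  proof (rule ccontr)
    assume ns: "\<not> summable c"
    have "((\<lambda>r. ereal (\<psi> r)) \<longlongrightarrow> \<infinity>) (at_left R)"
      unfolding tendsto_PInfty
    proof
      fix M :: real
      have "\<exists>n. (\<Sum>j\<le>n. c j) > M"
      proof (rule ccontr)
        assume "\<not> (\<exists>n. (\<Sum>j\<le>n. c j) > M)"
        then have "summable c" using c by (intro bounded_imp_summable[of c M]) (auto simp: not_less)
        then show False using ns by simp
      qed
      then obtain n where n: "(\<Sum>j\<le>n. c j) > M" by blast
      have "((\<lambda>r. \<Sum>j\<le>n. c j * (r / R) ^ Suc j) \<longlongrightarrow> (\<Sum>j\<le>n. c j)) (at_left R)" by (intro tendsto_sum pw)
      from order_tendstoD(1)[OF this n] ev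
      show "\<forall>\<^sub>F r in at_left R. ereal M < ereal (\<psi> r)"
      proof eventually_elim
        case (elim r)
        have "(\<Sum>j\<le>n. c j * (r / R) ^ Suc j) \<le> \<psi> r"
        proof -
          have ps: "(\<lambda>j. c j * (r / R) ^ Suc j) sums \<psi> r" using psi elim by simp
          have "0 \<le> c j * (r / R) ^ Suc j" for j using c[of j] elim R by (intro mult_nonneg_nonneg zero_le_power) auto
          then show ?thesis unfolding sums_unique[OF ps] by (intro sum_le_suminf sums_summable[OF ps]) auto
        qed
        then show ?case using elim by simp
      qed
    qed
    then have "gbraceR 1 G R = \<infinity>" unfolding gbraceR_def \<psi>_def by (intro tendsto_Lim) auto
    then show False using lt by simp
  qed
  then show "summable (\<lambda>j. \<kappa> (Suc j) * R ^ Suc j)" by (simp add: c_def[abs_def])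
  have "((\<lambda>r. \<Sum>j. c j * (r / R) ^ Suc j) \<longlongrightarrow> (\<Sum>j. c j)) (at_left R)"
  proof (rule tannerys_theorem[where M = c, THEN conjunct2, THEN conjunct2])
    show "\<forall>\<^sub>F (j, r) in at_top \<times>\<^sub>F at_left R. norm (c j * (r / R) ^ Suc j) \<le> c j"
    proof -
      have "\<forall>\<^sub>F r in at_left R. \<forall>j. norm (c j * (r / R) ^ Suc j) \<le> c j"
        using ev
      proof eventually_elim
        case (elim r)
        show ?case
        proof
          fix j
          have "(r / R) ^ Suc j \<le> 1" using elim by (intro power_le_one) auto
          then have "c j * (r / R) ^ Suc j \<le> c j * 1" using c by (intro mult_left_mono)
          then show "norm (c j * (r / R) ^ Suc j) \<le> c j" using elim c[of j] by (simp add: abs_mult power_abs)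
        qed
      qed
      then show ?thesis by (rule eventually_all_prod)
    qed
  qed (use pw \<open>summable c\<close> in auto)
  moreover have "\<forall>\<^sub>F r in at_left R. (\<Sum>j. c j * (r / R) ^ Suc j) = \<psi> r"
    using ev by eventually_elim (use psi in \<open>auto simp: sums_iff\<close>)
  ultimately have "(\<psi> \<longlongrightarrow> (\<Sum>j. c j)) (at_left R)" by (rule Lim_transform_eventually)
  then have "((\<lambda>r. ereal (\<psi> r)) \<longlongrightarrow> ereal (\<Sum>j. c j)) (at_left R)" by simp
  then show "gbraceR 1 G R = ereal (\<Sum>j. \<kappa> (Suc j) * R ^ Suc j)"
    unfolding gbraceR_def \<psi>_def c_def[abs_def] by (intro tendsto_Lim) auto
qed

subsection \<open>Cycle lengths of permutations\<close>

text \<open>\<open>covered\<close> for a general ground set: once the first cycle is removed, the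
  remaining points need not form an interval.\<close>

fun cycle_cover :: "nat set \<Rightarrow> (nat \<Rightarrow> nat) \<Rightarrow> nat \<Rightarrow> nat set" where
  "cycle_cover A \<sigma> 0 = {}"
| "cycle_cover A \<sigma> (Suc k) = (if A - cycle_cover A \<sigma> k = {} then cycle_cover A \<sigma> k else cycle_cover A \<sigma> k \<union> cyc \<sigma> (Min (A - cycle_cover A \<sigma> k)))"

definition cyclen :: "nat set \<Rightarrow> (nat \<Rightarrow> nat) \<Rightarrow> nat \<Rightarrow> nat" where
  "cyclen A \<sigma> k = card (cycle_cover A \<sigma> k) - card (cycle_cover A \<sigma> (k - 1))"

definition cyclens :: "nat \<Rightarrow> nat set \<Rightarrow> (nat \<Rightarrow> nat) \<Rightarrow> nat \<Rightarrow> nat" where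
  "cyclens m A \<sigma> i = (if i \<in> {1..m} then cyclen A \<sigma> i else 0)"

definition cycweight :: "(nat \<Rightarrow> real) \<Rightarrow> nat set \<Rightarrow> (nat \<Rightarrow> nat) \<Rightarrow> real" where
  "cycweight w A \<sigma> = (\<Prod>c\<in>cyc \<sigma> ` A. w (card c))"

definition vcons :: "nat \<Rightarrow> (nat \<Rightarrow> nat) \<Rightarrow> nat \<Rightarrow> nat" where
  "vcons l y i = (if i = 0 then 0 else if i = 1 then l else y (i - 1))"

text \<open>By \<open>sum_cycweight\<close>, n! times this is the weighted sum of \<Phi>(first m
  cycle lengths) over the permutations of n points. The factor 1/n is what remains of (n-1)!/(n-l)!
  possible first cycles of length l, the (n-l)! of the other points, and the normalisation
  n!.\<close>

fun cycsum :: "(nat \<Rightarrow> real) \<Rightarrow> nat \<Rightarrow> nat \<Rightarrow> ((nat \<Rightarrow> nat) \<Rightarrow> real) \<Rightarrow> real" where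
  "cycsum w 0 n \<Phi> = expseq w n * \<Phi> (\<lambda>_. 0)"
| "cycsum w (Suc m) n \<Phi> = (if n = 0 then \<Phi> (\<lambda>_. 0)
     else (\<Sum>l\<in>{1..n}. w l / n * cycsum w m (n - l) (\<lambda>y. \<Phi> (vcons l y))))"

lemma covered_eq_cycle_cover: "covered N \<sigma> k = cycle_cover {1..N} \<sigma> k"
  by (induction k) auto

lemma Lcyc_eq_cyclen: "Lcyc N \<sigma> k = cyclen {1..N} \<sigma> k"
  by (simp add: Lcyc_def cyclen_def covered_eq_cycle_cover)

lemma cyc_self: "i \<in> cyc \<sigma> i"
  unfolding cyc_def by (rule range_eqI[of _ _ 0]) simp

lemma funpow_in: "\<sigma> permutes A \<Longrightarrow> i \<in> A \<Longrightarrow> (\<sigma> ^^ k) i \<in> A"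
  by (induction k) (auto simp: permutes_in_image)

lemma cyc_subset: "\<sigma> permutes A \<Longrightarrow> i \<in> A \<Longrightarrow> cyc \<sigma> i \<subseteq> A"
  by (auto simp: cyc_def funpow_in)

lemma cycle_cover_subset: "\<sigma> permutes A \<Longrightarrow> finite A \<Longrightarrow> cycle_cover A \<sigma> k \<subseteq> A"
proof (induction k)
  case (Suc k)
  have "Min (A - cycle_cover A \<sigma> k) \<in> A" if "A - cycle_cover A \<sigma> k \<noteq> {}"
    using Min_in[of "A - cycle_cover A \<sigma> k"] that Suc.prems by blast
  with Suc cyc_subset[of \<sigma> A] show ?case by auto
qed auto

lemma weight_eq_cycweight:
  assumes "\<sigma> \<in> perms N"
  shows "weight \<theta> \<kappa> N \<sigma> = cycweight (\<lambda>j. \<theta> j + real N * \<kappa> j) {1..N} \<sigma>"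
proof -
  have p: "\<sigma> permutes {1..N}" using assms by (simp add: perms_def)
  have sub: "(\<lambda>c. card c) ` cycles N \<sigma> \<subseteq> {1..N}"
  proof (clarsimp simp: cycles_def)
    fix i assume i: "Suc 0 \<le> i" "i \<le> N"
    then have "cyc \<sigma> i \<subseteq> {1..N}" using cyc_subset[OF p] by simp
    moreover from this have "finite (cyc \<sigma> i)" by (rule finite_subset) simp
    ultimately show "Suc 0 \<le> card (cyc \<sigma> i) \<and> card (cyc \<sigma> i) \<le> N"
      using cyc_self[of i \<sigma>] card_mono[of "{1..N}" "cyc \<sigma> i"] by (auto simp: Suc_le_eq card_gt_0_iff)
  qed
  have "cycweight (\<lambda>j. \<theta> j + real N * \<kappa> j) {1..N} \<sigma> = (\<Prod>c\<in>cycles N \<sigma>. \<theta> (card c) + real N * \<kappa> (card c))"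
    by (simp add: cycweight_def cycles_def)
  also have "\<dots> = (\<Prod>j\<in>{1..N}. \<Prod>c\<in>{c \<in> cycles N \<sigma>. card c = j}. \<theta> (card c) + real N * \<kappa> (card c))"
    by (rule prod.group[symmetric]) (use sub in \<open>auto simp: cycles_def\<close>)
  also have "\<dots> = weight \<theta> \<kappa> N \<sigma>"
    unfolding weight_def Ccount_def by (intro prod.cong) auto
  finally show ?thesis ..
qed

text \<open>A permutation of \<open>A\<close> is cut into the cycle of \<open>a\<close>, listed as \<open>a, \<sigma> a, \<sigma>\<^sup>2 a, \<dots>\<close>, and the
  permutation \<open>\<tau>\<close> that it induces on the remaining points.\<close>
context
  fixes A :: "nat set" and a :: nat and xs :: "nat list" and \<tau> :: "nat \<Rightarrow> nat"
  assumes fin: "finite A" and a: "a \<in> A" and dist: "distinct (a # xs)" and sub: "set xs \<subseteq> A"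
    and tau: "\<tau> permutes A - set (a # xs)"
begin

abbreviation (input) "cs \<equiv> a # xs"
abbreviation (input) "\<sigma> \<equiv> cycle_of_list cs \<circ> \<tau>"

lemma join_permutes: "\<sigma> permutes A"
proof (rule permutes_compose)
  show "\<tau> permutes A" by (rule permutes_subset[OF tau]) auto
  show "cycle_of_list cs permutes A" by (rule permutes_subset[OF cycle_permutes]) (use a sub in auto)
qed

text \<open>\<open>\<tau>\<close> fixes every point of the list, so the orbit of \<open>a\<close>
  sees only the cyclic rotation.\<close>

lemma join_funpow_cs: "(\<sigma> ^^ k) a = cs ! (k mod length cs)"
proof -
  have c: "(cycle_of_list cs ^^ k) a = cs ! (k mod length cs)" for k
  proof -
    have "hd (map (cycle_of_list cs ^^ k) cs) = hd (rotate k cs)" using cyclic_rotation[OF dist] by simp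
    then show ?thesis by (simp add: hd_rotate_conv_nth)
  qed
  have "(\<sigma> ^^ k) a = (cycle_of_list cs ^^ k) a"
  proof (induction k)
    case (Suc k)
    have "(cycle_of_list cs ^^ k) a \<in> set cs" unfolding c by (rule nth_mem) simp
    then have "\<tau> ((cycle_of_list cs ^^ k) a) = (cycle_of_list cs ^^ k) a"
      using tau by (auto simp: permutes_def)
    then show ?case using Suc by simp
  qed simp
  then show ?thesis by (simp only: c)
qed

lemma join_cyc_a: "cyc \<sigma> a = set cs"
proof
  show "cyc \<sigma> a \<subseteq> set cs" unfolding cyc_def join_funpow_cs
    by (auto simp del: set_simps intro!: nth_mem)
  show "set cs \<subseteq> cyc \<sigma> a"
  proof
    fix y assume "y \<in> set cs"
    then obtain k where "k < length cs" "y = cs ! k" by (metis in_set_conv_nth)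
    then have "y = (\<sigma> ^^ k) a" by (simp only: join_funpow_cs mod_less)
    then show "y \<in> cyc \<sigma> a" unfolding cyc_def by blast
  qed
qed

lemma join_least_power: "least_power \<sigma> a = length cs"
  unfolding least_power_def
proof (rule Least_equality)
  show "(\<sigma> ^^ length cs) a = a \<and> 0 < length cs" by (simp only: join_funpow_cs) simp
  fix n assume n: "(\<sigma> ^^ n) a = a \<and> 0 < n"
  then have "cs ! (n mod length cs) = cs ! 0" by (simp only: join_funpow_cs nth_Cons_0)
  then have "n mod length cs = 0" using dist by (subst (asm) nth_eq_iff_index_eq) auto
  then show "length cs \<le> n" using n by (auto simp del: list.size dest!: dvd_imp_le)
qed

text \<open>The list can be read off from the joined permutation, so the decomposition is
  injective.\<close>

lemma join_support: "support \<sigma> a = cs"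
  unfolding join_least_power
  by (rule nth_equalityI) (simp_all only: length_map length_upt nth_map nth_upt join_funpow_cs mod_less, auto)

lemma join_funpow_rest: "i \<in> A - set cs \<Longrightarrow> (\<sigma> ^^ k) i = (\<tau> ^^ k) i"
proof (induction k)
  case (Suc k)
  have "(\<tau> ^^ Suc k) i \<in> A - set cs" by (rule funpow_in[OF tau Suc.prems])
  then have "cycle_of_list cs ((\<tau> ^^ Suc k) i) = (\<tau> ^^ Suc k) i" by (intro id_outside_supp) auto
  then show ?case using Suc by simp
qed simp

lemma join_cyc_rest: "i \<in> A - set cs \<Longrightarrow> cyc \<sigma> i = cyc \<tau> i"
  unfolding cyc_def using join_funpow_rest by auto

lemma join_cyc_cs:
  assumes "i \<in> set cs" shows "cyc \<sigma> i = set cs"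
proof -
  obtain j where j: "j < length cs" "i = cs ! j" using assms by (metis in_set_conv_nth)
  then have i: "i = (\<sigma> ^^ j) a" by (simp only: join_funpow_cs mod_less)
  have eq: "(\<sigma> ^^ k) i = (\<sigma> ^^ (k + j)) a" for k unfolding i by (simp add: funpow_add)
  have "cyc \<sigma> i \<subseteq> cyc \<sigma> a" unfolding cyc_def eq by auto
  moreover have "cyc \<sigma> a \<subseteq> cyc \<sigma> i"
  proof
    fix y assume "y \<in> cyc \<sigma> a"
    then obtain k where "y = (\<sigma> ^^ k) a" by (auto simp: cyc_def)
    also have "\<dots> = cs ! (k mod length cs)" by (rule join_funpow_cs)
    \<comment> \<open>Going back by \<open>j\<close> is replaced by going forward by
      \<open>length cs * j - j\<close>, a natural number congruent to -j modulo the length.\<close>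
    also have "k mod length cs = (k + (length cs * j - j) + j) mod length cs"
    proof -
      have "j \<le> length cs * j" by simp
      then have "k + (length cs * j - j) + j = k + length cs * j" by linarith
      then show ?thesis by (simp only: mod_mult_self2)
    qed
    also have "cs ! \<dots> = (\<sigma> ^^ (k + (length cs * j - j) + j)) a" by (rule join_funpow_cs[symmetric])
    also have "\<dots> = (\<sigma> ^^ (k + (length cs * j - j))) i" by (rule eq[symmetric])
    finally show "y \<in> cyc \<sigma> i" unfolding cyc_def by blast
  qed
  ultimately have "cyc \<sigma> i = cyc \<sigma> a" by (rule equalityI)
  then show ?thesis by (simp only: join_cyc_a)
qed

lemma join_cycweight: "cycweight w A \<sigma> = w (length cs) * cycweight w (A - set cs) \<tau>"
proof -
  have "A = set cs \<union> (A - set cs)" using a sub by auto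
  then have "cyc \<sigma> ` A = cyc \<sigma> ` set cs \<union> cyc \<sigma> ` (A - set cs)" by (metis image_Un)
  also have "cyc \<sigma> ` set cs = {set cs}" using join_cyc_cs by auto
  also have "cyc \<sigma> ` (A - set cs) = cyc \<tau> ` (A - set cs)" using join_cyc_rest by (intro image_cong) auto
  finally have "cyc \<sigma> ` A = insert (set cs) (cyc \<tau> ` (A - set cs))" by (simp only: insert_is_Un[symmetric])
  moreover have "set cs \<notin> cyc \<tau> ` (A - set cs)"
  proof
    assume "set cs \<in> cyc \<tau> ` (A - set cs)"
    then obtain i where "i \<in> A - set cs" "cyc \<tau> i = set cs" by auto
    then show False using cyc_self[of i \<tau>] by auto
  qed
  ultimately have "cycweight w A \<sigma> = w (card (set cs)) * cycweight w (A - set cs) \<tau>"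
    unfolding cycweight_def using fin by (simp only: prod.insert finite_imageI finite_Diff not_False_eq_True)
  then show ?thesis by (simp only: distinct_card[OF dist])
qed

text \<open>As the minimum, \<open>a\<close> starts the first cycle. From then on both sides have
  the same uncovered points, hence the same minima and cycles.\<close>

lemma join_cycle_cover:
  assumes "a = Min A"
  shows "cycle_cover A \<sigma> (Suc k) = set cs \<union> cycle_cover (A - set cs) \<tau> k"
proof (induction k)
  case 0
  have "A \<noteq> {}" using a by auto
  then show ?case using assms join_cyc_a by (simp add: comp_def)
next
  case (Suc k)
  define B where "B = A - set cs - cycle_cover (A - set cs) \<tau> k"
  have B: "A - cycle_cover A \<sigma> (Suc k) = B" unfolding Suc.IH B_def by auto
  show ?case
  proof (cases "B = {}")
    case True
    then have "cycle_cover A \<sigma> (Suc (Suc k)) = cycle_cover A \<sigma> (Suc k)" "cycle_cover (A - set cs) \<tau> (Suc k) = cycle_cover (A - set cs) \<tau> k"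
      using B by (simp_all add: B_def)
    then show ?thesis using Suc.IH by (simp only:)
  next
    case False
    then have "Min B \<in> B" using fin by (intro Min_in) (auto simp: B_def)
    then have "cyc \<sigma> (Min B) = cyc \<tau> (Min B)" by (intro join_cyc_rest) (auto simp: B_def)
    moreover have "cycle_cover A \<sigma> (Suc (Suc k)) = cycle_cover A \<sigma> (Suc k) \<union> cyc \<sigma> (Min B)"
      using B False by (subst cycle_cover.simps) simp
    moreover have "cycle_cover (A - set cs) \<tau> (Suc k) = cycle_cover (A - set cs) \<tau> k \<union> cyc \<tau> (Min B)"
      using False by (simp add: B_def)
    ultimately show ?thesis using Suc.IH by (simp only: Un_assoc)
  qed
qed

lemma join_cyclens:
  assumes "a = Min A"
  shows "cyclens (Suc m) A \<sigma> = vcons (length cs) (cyclens m (A - set cs) \<tau>)"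
proof
  fix i
  have fc: "finite (cycle_cover (A - set cs) \<tau> k)" "set cs \<inter> cycle_cover (A - set cs) \<tau> k = {}" for k
    using cycle_cover_subset[OF tau, of k] fin by (auto intro: finite_subset)
  have card: "card (cycle_cover A \<sigma> (Suc k)) = length cs + card (cycle_cover (A - set cs) \<tau> k)" for k
    unfolding join_cycle_cover[OF assms] using fc[of k] by (subst card_Un_disjoint) (simp_all only: finite_set distinct_card[OF dist])
  consider "i = 0" | "i = 1" | k where "i = Suc (Suc k)" by (metis One_nat_def not0_implies_Suc)
  then show "cyclens (Suc m) A \<sigma> i = vcons (length cs) (cyclens m (A - set cs) \<tau>) i"
  proof cases
    case 2
    then show ?thesis using card[of 0] by (simp add: cyclens_def vcons_def cyclen_def del: cycle_cover.simps(2))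
  next
    case (3 k)
    have "cyclen A \<sigma> (Suc (Suc k)) = cyclen (A - set cs) \<tau> (Suc k)"
      unfolding cyclen_def diff_Suc_1 card by simp
    then show ?thesis using 3 by (simp add: cyclens_def vcons_def)
  qed (simp add: cyclens_def vcons_def)
qed

end

text \<open>The inverse map lists the cycle of \<open>a\<close> as \<open>support \<sigma> a\<close>
  and removes it by composing with the inverse of that cycle.\<close>

lemma sum_permutes_split:
  fixes g :: "(nat \<Rightarrow> nat) \<Rightarrow> real"
  assumes fin: "finite A" and a: "a \<in> A"
  shows "(\<Sum>\<sigma> | \<sigma> permutes A. g \<sigma>) =
    (\<Sum>xs | distinct (a # xs) \<and> set xs \<subseteq> A. \<Sum>\<tau> | \<tau> permutes A - set (a # xs). g (cycle_of_list (a # xs) \<circ> \<tau>))"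
proof -
  let ?X = "{xs. distinct (a # xs) \<and> set xs \<subseteq> A}"
  let ?T = "\<lambda>xs. {\<tau>. \<tau> permutes A - set (a # xs)}"
  have "?X \<subseteq> {xs. set xs \<subseteq> A \<and> distinct xs}" by auto
  then have finX: "finite ?X" by (rule finite_subset) (rule finite_subset_distinct[OF fin])
  have "(\<Sum>\<sigma> | \<sigma> permutes A. g \<sigma>) = (\<Sum>(xs, \<tau>)\<in>Sigma ?X ?T. g (cycle_of_list (a # xs) \<circ> \<tau>))"
  proof (rule sum.reindex_bij_witness[where
      i = "\<lambda>(xs, \<tau>). cycle_of_list (a # xs) \<circ> \<tau>" and
      j = "\<lambda>\<sigma>. (tl (support \<sigma> a), inv (cycle_of_list (support \<sigma> a)) \<circ> \<sigma>)"])
    fix \<sigma> assume "\<sigma> \<in> {\<sigma>. \<sigma> permutes A}"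
    then have p: "\<sigma> permutes A" by simp
    then have perm: "permutation \<sigma>" using fin permutation_permutes by blast
    define s where "s = support \<sigma> a"
    have lp: "least_power \<sigma> a > 0" by (rule least_power_of_permutation(2)[OF perm])
    then have s_ne: "s \<noteq> []" by (simp add: s_def)
    have "hd s = a" using lp by (simp add: s_def hd_map upt_conv_Cons)
    then have s: "s = a # tl s" using s_ne by (metis list.collapse)
    have d: "distinct s" unfolding s_def by (rule cycle_of_permutation[OF perm])
    have set_s: "set s = cyc \<sigma> a" unfolding s_def support_set[OF perm] cyc_def ..
    have sA: "set s \<subseteq> A" unfolding set_s by (rule cyc_subset[OF p a])
    have bc: "bij (cycle_of_list s)" using cycle_permutes permutes_bij by blast
    have comp: "cycle_of_list s \<circ> (inv (cycle_of_list s) \<circ> \<sigma>) = \<sigma>"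
      using bc by (simp add: o_assoc surj_iff[THEN iffD1] bij_is_surj)
    then show "(case (tl (support \<sigma> a), inv (cycle_of_list (support \<sigma> a)) \<circ> \<sigma>) of (xs, \<tau>) \<Rightarrow> cycle_of_list (a # xs) \<circ> \<tau>) = \<sigma>"
      unfolding s_def[symmetric] prod.case s[symmetric] .
    then show "(case (tl (support \<sigma> a), inv (cycle_of_list (support \<sigma> a)) \<circ> \<sigma>) of (xs, \<tau>) \<Rightarrow> g (cycle_of_list (a # xs) \<circ> \<tau>)) = g \<sigma>"
      by simp
    have "inv (cycle_of_list s) \<circ> \<sigma> permutes A - set s"
    proof (rule permutes_superset)
      show "inv (cycle_of_list s) \<circ> \<sigma> permutes A"
        by (intro permutes_compose p permutes_inv permutes_subset[OF cycle_permutes sA])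
      fix y assume "y \<in> A - (A - set s)"
      then have y: "y \<in> set (support \<sigma> a)" by (simp only: s_def) blast
      have "\<sigma> y = cycle_of_list s y" unfolding s_def by (rule cycle_restrict[OF perm y])
      then show "(inv (cycle_of_list s) \<circ> \<sigma>) y = y" using bc by (simp add: bij_is_inj)
    qed
    moreover have "distinct (a # tl s)" "set (tl s) \<subseteq> A" using d sA s set_subset_Cons by (metis, metis order_trans)
    ultimately show "(tl (support \<sigma> a), inv (cycle_of_list (support \<sigma> a)) \<circ> \<sigma>) \<in> Sigma ?X ?T"
      unfolding s_def[symmetric] mem_Sigma_iff mem_Collect_eq s[symmetric] by simp
  next
    fix z assume z: "z \<in> Sigma ?X ?T"
    obtain xs \<tau> where xt: "z = (xs, \<tau>)" by (cases z)
    then have h: "distinct (a # xs)" "set xs \<subseteq> A" "\<tau> permutes A - set (a # xs)" using z by auto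
    have bc: "bij (cycle_of_list (a # xs))" using cycle_permutes permutes_bij by blast
    have "inv (cycle_of_list (a # xs)) \<circ> (cycle_of_list (a # xs) \<circ> \<tau>) = \<tau>"
      using bc by (simp add: o_assoc bij_is_inj)
    then show "(tl (support (case z of (xs, \<tau>) \<Rightarrow> cycle_of_list (a # xs) \<circ> \<tau>) a),
        inv (cycle_of_list (support (case z of (xs, \<tau>) \<Rightarrow> cycle_of_list (a # xs) \<circ> \<tau>) a)) \<circ> (case z of (xs, \<tau>) \<Rightarrow> cycle_of_list (a # xs) \<circ> \<tau>)) = z"
      unfolding xt prod.case join_support[OF fin a h] list.sel by simp
    show "(case z of (xs, \<tau>) \<Rightarrow> cycle_of_list (a # xs) \<circ> \<tau>) \<in> {\<sigma>. \<sigma> permutes A}"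
      unfolding xt prod.case mem_Collect_eq by (rule join_permutes[OF fin a h])
  qed
  also have "\<dots> = (\<Sum>xs\<in>?X. \<Sum>\<tau>\<in>?T xs. g (cycle_of_list (a # xs) \<circ> \<tau>))"
    using fin by (subst sum.Sigma[OF finX]) (auto intro!: finite_permutations)
  finally show ?thesis .
qed

lemma card_distinct_lists_from:
  assumes fin: "finite A" and a: "a \<in> A" and l: "l < card A"
  shows "real (card {xs. distinct (a # xs) \<and> set xs \<subseteq> A \<and> length xs = l}) = fact (card A - 1) / fact (card A - Suc l)"
proof -
  have eq: "{xs. distinct (a # xs) \<and> set xs \<subseteq> A \<and> length xs = l} = {xs. length xs = l \<and> distinct xs \<and> set xs \<subseteq> A - {a}}"
    by auto
  have c: "card (A - {a}) = card A - 1" using a fin by simp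
  have "card {xs. length xs = l \<and> distinct xs \<and> set xs \<subseteq> A - {a}} = \<Prod>{card A - 1 - l + 1..card A - 1}"
    using card_lists_distinct_length_eq[of "A - {a}" l] fin l unfolding c by simp
  moreover have "real (\<Prod>{card A - 1 - l + 1..card A - 1}) = fact (card A - 1) / fact (card A - Suc l)"
  proof -
    have "(fact (card A - 1) :: nat) = fact (card A - Suc l) * \<Prod>{card A - 1 - l + 1..card A - 1}"
    proof -
      have "{1..card A - 1} = {1..card A - Suc l} \<union> {card A - 1 - l + 1..card A - 1}" using l by auto
      then show ?thesis unfolding fact_prod by (simp, subst prod.union_disjoint) auto
    qed
    then have "(fact (card A - 1) :: real) = fact (card A - Suc l) * real (\<Prod>{card A - 1 - l + 1..card A - 1})"
      by (metis of_nat_fact of_nat_mult)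
    then show ?thesis by simp
  qed
  ultimately show ?thesis unfolding eq by simp
qed

text \<open>Strong induction on the size, splitting off the cycle of the minimum. For m = 0, where
  no length is recorded, the same split yields the recursion of \<open>expseq\<close>.\<close>

theorem sum_cycweight:
  assumes "finite A"
  shows "(\<Sum>\<sigma> | \<sigma> permutes A. cycweight w A \<sigma> * \<Phi> (cyclens m A \<sigma>)) = fact (card A) * cycsum w m (card A) \<Phi>"
  using assms
proof (induction "card A" arbitrary: A m \<Phi> rule: less_induct)
  case less
  show ?case
  proof (cases "A = {}")
    case True
    have "cycle_cover {} id k = {}" for k by (induction k) auto
    then have "cyclens m {} id = (\<lambda>_. 0)" by (simp add: cyclens_def cyclen_def fun_eq_iff)
    then show ?thesis using True by (cases m) (simp_all add: cycweight_def id_def)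
  next
    case False
    define a where "a = Min A"
    define n where "n = card A"
    have n: "n > 0" using False less.prems by (simp add: n_def card_gt_0_iff)
    have a: "a \<in> A" using False less.prems by (simp add: a_def)
    \<comment> \<open>The contribution of one given first cycle with \<open>l\<close> points; it
      depends on that cycle through \<open>l\<close> only.\<close>
    define Q where "Q l = w l * (fact (n - l) * (case m of 0 \<Rightarrow> cycsum w 0 (n - l) \<Phi> | Suc m' \<Rightarrow> cycsum w m' (n - l) (\<lambda>y. \<Phi> (vcons l y))))" for l
    have inner: "(\<Sum>\<tau> | \<tau> permutes A - set (a # xs). cycweight w A (cycle_of_list (a # xs) \<circ> \<tau>) * \<Phi> (cyclens m A (cycle_of_list (a # xs) \<circ> \<tau>))) = Q (Suc (length xs))"
      if xs: "distinct (a # xs)" "set xs \<subseteq> A" for xs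
    proof -
      have cA: "card (A - set (a # xs)) = n - Suc (length xs)"
        using xs a less.prems by (subst card_Diff_subset) (auto simp: distinct_card n_def)
      then have lt: "card (A - set (a # xs)) < card A" using n by (simp add: n_def)
      have finB: "finite (A - set (a # xs))" using less.prems by simp
      show ?thesis
      proof (cases m)
        case 0
        have z: "cyclens 0 B \<tau> = (\<lambda>_. 0)" for B \<tau> by (simp add: cyclens_def fun_eq_iff)
        have "(\<Sum>\<tau> | \<tau> permutes A - set (a # xs). cycweight w A (cycle_of_list (a # xs) \<circ> \<tau>) * \<Phi> (cyclens m A (cycle_of_list (a # xs) \<circ> \<tau>)))
          = (\<Sum>\<tau> | \<tau> permutes A - set (a # xs). w (Suc (length xs)) * (cycweight w (A - set (a # xs)) \<tau> * \<Phi> (cyclens 0 (A - set (a # xs)) \<tau>)))"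
          using join_cycweight[OF less.prems a xs] unfolding 0 z by (intro sum.cong) auto
        also have "\<dots> = w (Suc (length xs)) * (fact (n - Suc (length xs)) * cycsum w 0 (n - Suc (length xs)) \<Phi>)"
          unfolding sum_distrib_left[symmetric] less.hyps[OF lt finB] cA ..
        finally show ?thesis by (simp add: Q_def 0)
      next
        case (Suc m')
        have "(\<Sum>\<tau> | \<tau> permutes A - set (a # xs). cycweight w A (cycle_of_list (a # xs) \<circ> \<tau>) * \<Phi> (cyclens m A (cycle_of_list (a # xs) \<circ> \<tau>)))
          = (\<Sum>\<tau> | \<tau> permutes A - set (a # xs). w (Suc (length xs)) * (cycweight w (A - set (a # xs)) \<tau> * \<Phi> (vcons (Suc (length xs)) (cyclens m' (A - set (a # xs)) \<tau>))))"
          using join_cycweight[OF less.prems a xs] join_cyclens[OF less.prems a xs _ a_def] unfolding Suc by (intro sum.cong) auto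
        also have "\<dots> = w (Suc (length xs)) * (fact (n - Suc (length xs)) * cycsum w m' (n - Suc (length xs)) (\<lambda>y. \<Phi> (vcons (Suc (length xs)) y)))"
          unfolding sum_distrib_left[symmetric]
            less.hyps[OF lt finB, where m = m' and \<Phi> = "\<lambda>y. \<Phi> (vcons (Suc (length xs)) y)"] cA ..
        finally show ?thesis by (simp add: Q_def Suc)
      qed
    qed
    let ?X = "{xs. distinct (a # xs) \<and> set xs \<subseteq> A}"
    have "?X \<subseteq> {xs. set xs \<subseteq> A \<and> distinct xs}" by auto
    then have finX: "finite ?X" by (rule finite_subset) (rule finite_subset_distinct[OF less.prems])
    have len: "length ` ?X \<subseteq> {..<n}"
    proof (clarsimp simp: n_def)
      fix xs assume "a \<notin> set xs" "distinct xs" "set xs \<subseteq> A"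
      then have "card (set (a # xs)) \<le> card A" using a less.prems by (intro card_mono) auto
      then show "length xs < card A" using \<open>a \<notin> set xs\<close> \<open>distinct xs\<close> by (simp add: distinct_card)
    qed
    have "(\<Sum>\<sigma> | \<sigma> permutes A. cycweight w A \<sigma> * \<Phi> (cyclens m A \<sigma>)) = (\<Sum>xs\<in>?X. Q (Suc (length xs)))"
      unfolding sum_permutes_split[OF less.prems a] using inner by (intro sum.cong) auto
    also have "\<dots> = (\<Sum>l<n. \<Sum>xs\<in>{xs \<in> ?X. length xs = l}. Q (Suc (length xs)))"
      by (rule sum.group[symmetric]) (use finX len in auto)
    also have "\<dots> = (\<Sum>l<n. fact (n - 1) / fact (n - Suc l) * Q (Suc l))"
    proof (intro sum.cong refl)
      fix l assume "l \<in> {..<n}"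
      then have "real (card {xs \<in> ?X. length xs = l}) = fact (n - 1) / fact (n - Suc l)"
        using card_distinct_lists_from[OF less.prems a, of l] by (simp add: n_def conj_assoc)
      moreover have "(\<Sum>xs\<in>{xs \<in> ?X. length xs = l}. Q (Suc (length xs))) = (\<Sum>xs\<in>{xs \<in> ?X. length xs = l}. Q (Suc l))"
        by (intro sum.cong) auto
      ultimately show "(\<Sum>xs\<in>{xs \<in> ?X. length xs = l}. Q (Suc (length xs))) = fact (n - 1) / fact (n - Suc l) * Q (Suc l)"
        by (simp only: sum_constant)
    qed
    also have "\<dots> = (\<Sum>l\<in>{1..n}. fact (n - 1) / fact (n - l) * Q l)"
      by (rule sum.reindex_bij_witness[of _ "\<lambda>l. l - 1" Suc]) auto
    also have "\<dots> = fact n * (\<Sum>l\<in>{1..n}. w l / n * (case m of 0 \<Rightarrow> cycsum w 0 (n - l) \<Phi> | Suc m' \<Rightarrow> cycsum w m' (n - l) (\<lambda>y. \<Phi> (vcons l y))))"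
      unfolding sum_distrib_left
    proof (intro sum.cong refl)
      fix l
      have "(fact n :: real) = n * fact (n - 1)" using n by (simp add: fact_reduce)
      then show "fact (n - 1) / fact (n - l) * Q l = fact n * (w l / n * (case m of 0 \<Rightarrow> cycsum w 0 (n - l) \<Phi> | Suc m' \<Rightarrow> cycsum w m' (n - l) (\<lambda>y. \<Phi> (vcons l y))))"
        using n by (simp add: Q_def)
    qed
    also have "\<dots> = fact n * cycsum w m n \<Phi>"
    proof (cases m)
      case 0
      have e: "expseq w n = (\<Sum>l\<in>{1..n}. w l * expseq w (n - l)) / n"
        using n by (subst expseq.simps) simp
      have "(\<Sum>l\<in>{1..n}. w l / n * (expseq w (n - l) * \<Phi> (\<lambda>_. 0))) = (\<Sum>l\<in>{1..n}. w l * expseq w (n - l)) / n * \<Phi> (\<lambda>_. 0)"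
        by (simp add: sum_distrib_left sum_distrib_right sum_divide_distrib mult_ac)
      then show ?thesis unfolding 0 nat.case cycsum.simps(1) by (simp only: e[symmetric])
    qed (use n in simp)
    finally show ?thesis by (simp add: n_def)
  qed
qed

subsection \<open>The chain of cycle lengths\<close>

text \<open>All cycle lengths add up to n, so the scaling pulls out as x^n. With x = R it passes
  from \<theta>, \<kappa> to \<open>t\<close>, \<open>c\<close> without changing the
  measure.\<close>

lemma cycsum_scale: "cycsum (\<lambda>l. w l * x ^ l) m n \<Phi> = x ^ n * cycsum w m n \<Phi>"
proof (induction m arbitrary: n \<Phi>)
  case (Suc m)
  show ?case
  proof (cases "n = 0")
    case False
    have "w l * x ^ l / n * (x ^ (n - l) * cycsum w m (n - l) \<Psi>) = x ^ n * (w l / n * cycsum w m (n - l) \<Psi>)"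
      if "l \<in> {1..n}" for l \<Psi>
    proof -
      have "x ^ n = x ^ l * x ^ (n - l)" using that by (simp add: power_add[symmetric])
      then show ?thesis by simp
    qed
    then show ?thesis using False unfolding cycsum.simps if_not_P[OF False] sum_distrib_left Suc.IH by (intro sum.cong) auto
  qed simp
qed (simp add: expseq_scale)

lemma vcons_zero: "vcons 0 (\<lambda>_. 0) = (\<lambda>_. 0)" and vcons_upd_zero: "vcons l (\<lambda>_. 0) = (\<lambda>_. 0)(Suc 0 := l)"
  and vcons_upd: "(vcons l y)(Suc (Suc m) := k) = vcons l (y(Suc m := k))"
  by (auto simp: vcons_def fun_eq_iff)

lemma sum_vcons: "(\<Sum>i\<in>{1..Suc m}. vcons l y i) = l + (\<Sum>i\<in>{1..m}. y i)"
proof -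
  have "(\<Sum>i\<in>{1..Suc m}. vcons l y i) = vcons l y 1 + (\<Sum>i\<in>{1..m}. vcons l y (Suc i))"
    using sum.atLeast_Suc_atMost[of 1 "Suc m" "vcons l y"] sum.shift_bounds_cl_Suc_ivl[of "vcons l y" 1 m]
    by (simp del: sum.cl_ivl_Suc)
  also have "(\<Sum>i\<in>{1..m}. vcons l y (Suc i)) = (\<Sum>i\<in>{1..m}. y i)"
    by (intro sum.cong) (auto simp: vcons_def)
  finally show ?thesis by (simp add: vcons_def)
qed

context condensation
begin

text \<open>When the rows of \<open>K\<close> are stochastic, this is the expectation of \<Phi> over
  the first \<open>m\<close> lengths of the Markov chain started at \<open>n\<close>.\<close>

fun E :: "nat \<Rightarrow> nat \<Rightarrow> nat \<Rightarrow> ((nat \<Rightarrow> nat) \<Rightarrow> real) \<Rightarrow> real" where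
  "E N 0 n \<Phi> = \<Phi> (\<lambda>_. 0)"
| "E N (Suc m) n \<Phi> = (\<Sum>l\<le>n. K N n l * E N m (n - l) (\<lambda>y. \<Phi> (vcons l y)))"

lemma E_0: "E N m 0 \<Phi> = \<Phi> (\<lambda>_. 0)"
  by (induction m arbitrary: \<Phi>) (auto simp: K_def vcons_zero)

text \<open>\<open>K\<close> is the Doob transform by \<open>q\<close> of the weights w_l / n, so
  the quotients q (n - l) / q n telescope along the chain.\<close>

lemma cycsum_eq_E: "cycsum (\<lambda>l. t l + N * c l) m n \<Phi> = q N n * E N m n \<Phi>"
proof (induction m arbitrary: n \<Phi>)
  case (Suc m)
  show ?case
  proof (cases "n = 0")
    case False
    have "(t l + N * c l) / n * q N (n - l) = q N n * K N n l" if l: "l \<in> {1..n}" for l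
    \<comment> \<open>If q N n = 0 the kernel vanishes by division by zero; so does the left side,
      since a zero sum of nonnegative terms in the recursion for \<open>q N n\<close> has only zero
      terms.\<close>
    proof (cases "q N n = 0")
      case True
      have nn: "(t l + N * c l) * q N (n - l) \<ge> 0" for l
        using t_nonneg c_nonneg q_nonneg by (intro mult_nonneg_nonneg add_nonneg_nonneg) auto
      have "(\<Sum>l\<in>{1..n}. (t l + N * c l) * q N (n - l)) = n * q N n" unfolding q_def expseq_rec ..
      then have "(t l + N * c l) * q N (n - l) = 0"
        using True sum_nonneg_eq_0_iff[of "{1..n}" "\<lambda>l. (t l + N * c l) * q N (n - l)"] nn l by simp
      then show ?thesis using True by auto
    qed (use l False in \<open>simp add: K_def\<close>)
    then have "cycsum (\<lambda>l. t l + N * c l) (Suc m) n \<Phi> = (\<Sum>l\<in>{1..n}. q N n * (K N n l * E N m (n - l) (\<lambda>y. \<Phi> (vcons l y))))"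
      using False by (simp add: Suc.IH mult.assoc[symmetric])
    also have "\<dots> = (\<Sum>l\<le>n. q N n * (K N n l * E N m (n - l) (\<lambda>y. \<Phi> (vcons l y))))"
      using False by (intro sum.mono_neutral_left) (auto simp: K_def)
    finally show ?thesis by (simp add: sum_distrib_left)
  qed (simp add: E_0 q_def del: E.simps)
qed (simp add: q_def)

text \<open>The recursion for \<open>E\<close> splits off the first cycle, whereas integrals over \<open>UBspace\<close> are
  computed by splitting off the last coordinate.\<close>
lemma E_peel_last:
  "E N (Suc m) n \<Phi> = E N m n (\<lambda>y. \<Sum>l\<le>n - (\<Sum>i\<in>{1..m}. y i). K N (n - (\<Sum>i\<in>{1..m}. y i)) l * \<Phi> (y(Suc m := l)))"
proof (induction m arbitrary: n \<Phi>)
  case 0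
  then show ?case by (simp add: vcons_upd_zero fun_upd_def)
next
  case (Suc m)
  have "E N (Suc (Suc m)) n \<Phi> = (\<Sum>l\<le>n. K N n l * E N (Suc m) (n - l) (\<lambda>y. \<Phi> (vcons l y)))"
    by (rule E.simps)
  also have "\<dots> = (\<Sum>l\<le>n. K N n l * E N m (n - l) (\<lambda>y. \<Sum>k\<le>n - (\<Sum>i\<in>{1..Suc m}. vcons l y i).
       K N (n - (\<Sum>i\<in>{1..Suc m}. vcons l y i)) k * \<Phi> ((vcons l y)(Suc (Suc m) := k))))"
    unfolding Suc.IH sum_vcons vcons_upd by (simp only: diff_diff_left)
  also have "\<dots> = E N (Suc m) n (\<lambda>y. \<Sum>k\<le>n - (\<Sum>i\<in>{1..Suc m}. y i). K N (n - (\<Sum>i\<in>{1..Suc m}. y i)) k * \<Phi> (y(Suc (Suc m) := k)))"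
    by (rule E.simps(2)[symmetric])
  finally show ?case .
qed

end

section \<open>The limiting random sequence\<close>

lemma prob_space_unif01: "prob_space unif01"
  unfolding unif01_def by (rule prob_space_uniform_measure) auto

lemma unif01_integral_step:
  fixes a b u :: real
  assumes "0 \<le> u" "u \<le> 1"
  shows "(\<integral>x. (if x \<le> u then a else b) \<partial>unif01) = u * a + (1 - u) * b"
proof -
  interpret prob_space unif01 by (rule prob_space_unif01)
  have m: "measure unif01 {..u} = u"
  proof -
    have "{0..1} \<inter> {..u} = {0..u}" using assms by auto
    then show ?thesis unfolding unif01_def using assms by (subst measure_uniform_measure) auto
  qed
  have s: "sets unif01 = sets borel" "space unif01 = UNIV" by (simp_all add: unif01_def)
  have i: "integrable unif01 (indicator {..u} :: real \<Rightarrow> real)"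
    by (rule integrable_real_indicator) (auto simp: s emeasure_eq_measure)
  have "(\<integral>x. (if x \<le> u then a else b) \<partial>unif01) = (\<integral>x. b + (a - b) * indicator {..u} x \<partial>unif01)"
    by (intro Bochner_Integration.integral_cong) (auto simp: indicator_def)
  also have "\<dots> = b + (a - b) * u"
    using i m by (simp add: s prob_space[unfolded s])
  finally show ?thesis by (simp add: algebra_simps)
qed

text \<open>Telescoping, as X_i is the decrease of \<open>etaX\<close> in step i. It matches \<eta>
  with the points left after m cycles.\<close>

lemma etaX_eq: "etaX \<nu> \<zeta> m = 1 - (\<Sum>i\<in>{1..m}. XX \<nu> \<zeta> i)"
  by (induction m) (auto simp: XX_def DX_def xiX_def algebra_simps)

lemma etaX_upd: "k \<le> m \<Longrightarrow> etaX \<nu> (\<zeta>(Suc m := v)) k = etaX \<nu> \<zeta> k"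
  by (induction k) auto

lemma XX_upd: "1 \<le> i \<Longrightarrow> i \<le> m \<Longrightarrow> XX \<nu> (\<zeta>(Suc m := v)) i = XX \<nu> \<zeta> i"
  by (auto simp: XX_def DX_def xiX_def etaX_upd)

lemma XX_upd_last: "XX \<nu> (\<zeta>(Suc m := v)) (Suc m) = etaX \<nu> \<zeta> m * ((if fst v \<le> ustar \<nu> (etaX \<nu> \<zeta> m) then 1 else 0) * snd v)"
  by (auto simp: XX_def DX_def xiX_def etaX_upd)

lemma etaX_bounds:
  assumes "\<And>i. i \<in> {1..m} \<Longrightarrow> 0 < snd (\<zeta> i) \<and> snd (\<zeta> i) < 1"
  shows "0 < etaX \<nu> \<zeta> m \<and> etaX \<nu> \<zeta> m \<le> 1"
  using assms
proof (induction m)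
  case (Suc m)
  then have IH: "0 < etaX \<nu> \<zeta> m" "etaX \<nu> \<zeta> m \<le> 1" and b: "0 < snd (\<zeta> (Suc m))" "snd (\<zeta> (Suc m)) < 1" by auto
  then show ?case by (auto intro!: mult_le_one)
qed auto

lemma XX_nonneg:
  assumes "\<And>i. i \<in> {1..m} \<Longrightarrow> 0 < snd (\<zeta> i) \<and> snd (\<zeta> i) < 1" "1 \<le> i" "i \<le> m"
  shows "0 \<le> XX \<nu> \<zeta> i"
proof -
  have "0 < etaX \<nu> \<zeta> (i - 1)"
    by (rule conjunct1[OF etaX_bounds]) (rule assms(1), use assms in auto)
  moreover have "0 < snd (\<zeta> i)" using assms by auto
  ultimately show ?thesis by (auto simp: XX_def DX_def xiX_def)
qed

context condensation
begin

definition UB :: "(real \<times> real) measure" where "UB = unif01 \<Otimes>\<^sub>M beta1 \<theta>s"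

lemma n_lim_self: "(\<lambda>N. (real N / N - \<mu>) / \<nu>) \<longlonglongrightarrow> 1"
proof -
  have "\<forall>\<^sub>F N in sequentially. 1 = (real N / N - \<mu>) / \<nu>"
    using eventually_gt_at_top[of 0] by eventually_elim (use nu_pos in \<open>simp add: \<nu>_def\<close>)
  then show ?thesis by (rule Lim_transform_eventually[OF tendsto_const])
qed

text \<open>The normalisation is \<open>w_integral\<close> at \<eta> = 1, where x = 1 and w is \<nu>
  times the Beta density.\<close>

lemma prob_space_beta1: "prob_space (beta1 \<theta>s)"
proof
  interpret o: one_step c t \<theta>s A s "\<lambda>N. N" 1 1 "\<lambda>_ _. 1" "\<lambda>_. 1"
    by unfold_locales (use n_lim_self in auto)
  have x: "o.x = 1" by (simp add: o.x_def \<nu>_def)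
  have w: "o.w y = \<nu> * (\<theta>s * (1 - y) powr (\<theta>s - 1))" for y by (simp add: o.w_def x)
  let ?f = "\<lambda>y. indicator {0<..<1} y * \<theta>s * (1 - y) powr (\<theta>s - 1)"
  have eq: "(\<lambda>y. indicator {0<..<1} y * o.w y) = (\<lambda>y. \<nu> * ?f y)" by (simp add: w fun_eq_iff)
  have "integrable lborel (\<lambda>y. \<nu> * ?f y)" "(\<integral>y. \<nu> * ?f y \<partial>lborel) = \<nu>"
    using o.w_integral unfolding eq x by simp_all
  then have int: "integrable lborel ?f" "(\<integral>y. ?f y \<partial>lborel) = 1"
    using nu_pos by simp_all
  have "emeasure (beta1 \<theta>s) (space (beta1 \<theta>s)) = (\<integral>\<^sup>+ y. ennreal (?f y) \<partial>lborel)"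
    by (simp add: beta1_def emeasure_density)
  also have "\<dots> = ennreal (\<integral>y. ?f y \<partial>lborel)"
    using ths_pos by (intro nn_integral_eq_integral int) auto
  finally show "emeasure (beta1 \<theta>s) (space (beta1 \<theta>s)) = 1" using int by simp
qed

lemma prob_space_UB: "prob_space UB"
  unfolding UB_def using prob_space_unif01 prob_space_beta1 by (rule prob_space_pair)

lemma UBspace_eq: "UBspace \<theta>s m = PiM {1..m} (\<lambda>_. UB)"
  by (simp add: UBspace_def UB_def)

lemma sets_unif01: "sets unif01 = sets borel" and sets_beta1: "sets (beta1 \<theta>s) = sets borel"
  by (simp_all add: unif01_def beta1_def)

lemma space_UB: "space UB = UNIV"
  by (simp add: UB_def space_pair_measure unif01_def beta1_def)

lemma AE_beta1: "AE b in beta1 \<theta>s. 0 < b \<and> b < 1"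
  unfolding beta1_def by (subst AE_density) (auto simp: indicator_def)

lemma AE_UB: "AE v in UB. 0 < snd v \<and> snd v < 1"
proof -
  interpret U: prob_space unif01 by (rule prob_space_unif01)
  interpret B: prob_space "beta1 \<theta>s" by (rule prob_space_beta1)
  interpret P: pair_prob_space unif01 "beta1 \<theta>s" ..
  have [measurable_cong]: "sets unif01 = sets borel" "sets (beta1 \<theta>s) = sets borel" by (rule sets_unif01 sets_beta1)+
  have "AE v in unif01 \<Otimes>\<^sub>M beta1 \<theta>s. 0 < snd v \<and> snd v < 1"
  proof (rule P.AE_pair_measure)
    show "{x \<in> space (unif01 \<Otimes>\<^sub>M beta1 \<theta>s). 0 < snd x \<and> snd x < 1} \<in> sets (unif01 \<Otimes>\<^sub>M beta1 \<theta>s)" by measurable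
    show "AE x in unif01. AE y in beta1 \<theta>s. 0 < snd (x, y) \<and> snd (x, y) < 1" using AE_beta1 by simp
  qed
  then show ?thesis unfolding UB_def .
qed

text \<open>An almost sure event on which \<open>etaX\<close> stays positive, so that every state
  reached is supercritical.\<close>

definition good :: "nat \<Rightarrow> (nat \<Rightarrow> real \<times> real) \<Rightarrow> bool" where
  "good m \<zeta> \<longleftrightarrow> (\<forall>i\<in>{1..m}. 0 < snd (\<zeta> i) \<and> snd (\<zeta> i) < 1)"

lemma AE_good: "AE \<zeta> in PiM {1..m} (\<lambda>_. UB). good m \<zeta>"
proof -
  have "AE \<zeta> in PiM {1..m} (\<lambda>_. UB). 0 < snd (\<zeta> i) \<and> snd (\<zeta> i) < 1" if "i \<in> {1..m}" for i
    by (rule AE_PiM_component[where P = "\<lambda>v. 0 < snd v \<and> snd v < 1"]) (use prob_space_UB AE_UB that in \<open>simp_all\<close>)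
  then show ?thesis unfolding good_def by (intro AE_finite_allI) simp_all
qed

text \<open>Test sequences of length vectors. They see the point \<zeta> only through its
  coordinates \<open>XX\<close>, so the jumps of the indicators in (U_i, B_i) do no harm.\<close>

definition conv_to :: "nat \<Rightarrow> (nat \<Rightarrow> nat \<Rightarrow> nat) \<Rightarrow> (nat \<Rightarrow> real \<times> real) \<Rightarrow> bool" where
  "conv_to m y \<zeta> \<longleftrightarrow> (\<forall>N i. i \<notin> {1..m} \<longrightarrow> y N i = 0) \<and> (\<forall>i\<in>{1..m}. (\<lambda>N. real (y N i) / (real N * \<nu>)) \<longlonglongrightarrow> XX \<nu> \<zeta> i)"

lemma conv_to_exists:
  assumes "good m \<zeta>"
  shows "conv_to m (\<lambda>N i. if i \<in> {1..m} then nat \<lfloor>XX \<nu> \<zeta> i * (real N * \<nu>)\<rfloor> else 0) \<zeta>"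
  unfolding conv_to_def
proof (intro conjI ballI allI impI)
  fix i assume i: "i \<in> {1..m}"
  then have "XX \<nu> \<zeta> i \<ge> 0" using assms by (intro XX_nonneg[of m]) (auto simp: good_def)
  then show "(\<lambda>N. real (if i \<in> {1..m} then nat \<lfloor>XX \<nu> \<zeta> i * (real N * \<nu>)\<rfloor> else 0) / (real N * \<nu>)) \<longlonglongrightarrow> XX \<nu> \<zeta> i"
    using floor_seq_lim[of "XX \<nu> \<zeta> i" \<nu>] nu_pos i by simp
qed auto

lemma conv_to_bounded:
  fixes G :: "nat \<Rightarrow> (nat \<Rightarrow> nat) \<Rightarrow> real" and h M :: real
  assumes "good m \<zeta>" "\<And>N y. \<bar>G N y\<bar> \<le> M"
    and "\<And>y. conv_to m y \<zeta> \<Longrightarrow> (\<lambda>N. G N (y N)) \<longlonglongrightarrow> h"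
  shows "\<bar>h\<bar> \<le> M"
proof -
  have "(\<lambda>N. \<bar>G N (\<lambda>i. if i \<in> {1..m} then nat \<lfloor>XX \<nu> \<zeta> i * (real N * \<nu>)\<rfloor> else 0)\<bar>) \<longlonglongrightarrow> \<bar>h\<bar>"
    using assms(3)[OF conv_to_exists[OF assms(1)]] by (rule tendsto_rabs)
  then show ?thesis by (rule LIMSEQ_le_const2) (use assms(2) in auto)
qed

text \<open>Averages over the last length. Given the earlier ones, the limit law of
  \<open>one_step\<close>, an atom at 0 plus a scaled Beta part, is the image of \<open>UB\<close>
  under the next coordinate.\<close>

lemma conv_to_step:
  fixes G :: "nat \<Rightarrow> (nat \<Rightarrow> nat) \<Rightarrow> real" and h :: "(nat \<Rightarrow> real \<times> real) \<Rightarrow> real"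
  assumes M: "\<And>N y. \<bar>G N y\<bar> \<le> M"
    and h: "h \<in> borel_measurable (PiM {1..Suc m} (\<lambda>_. UB))"
    and lim: "\<And>\<zeta> y. \<zeta> \<in> space (PiM {1..Suc m} (\<lambda>_. UB)) \<Longrightarrow> good (Suc m) \<zeta> \<Longrightarrow> conv_to (Suc m) y \<zeta> \<Longrightarrow> (\<lambda>N. G N (y N)) \<longlonglongrightarrow> h \<zeta>"
    and \<zeta>: "\<zeta> \<in> space (PiM {1..m} (\<lambda>_. UB))" "good m \<zeta>" and y: "conv_to m y \<zeta>"
  shows "(\<lambda>N. \<Sum>l\<le>N - (\<Sum>i\<in>{1..m}. y N i). K N (N - (\<Sum>i\<in>{1..m}. y N i)) l * G N ((y N)(Suc m := l)))
     \<longlonglongrightarrow> (\<integral>v. h (\<zeta>(Suc m := v)) \<partial>UB)"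
proof -
  define \<eta> where "\<eta> = etaX \<nu> \<zeta> m"
  have eta: "0 < \<eta>" "\<eta> \<le> 1" using etaX_bounds[of m \<zeta> \<nu>] \<zeta>(2) by (auto simp: \<eta>_def good_def)
  define u where "u = ustar \<nu> \<eta>"
  have den: "1 - \<nu> + \<nu> * \<eta> > 0" using nu_pos nu_le eta by (simp add: add_nonneg_pos)
  have u: "0 \<le> u" "u \<le> 1" using den nu_pos nu_le eta unfolding u_def ustar_def by (auto simp: divide_le_eq)
  define H where "H v = h (\<zeta>(Suc m := v))" for v
  have upd: "\<zeta>(Suc m := v) \<in> space (PiM {1..Suc m} (\<lambda>_. UB))" for v
    using \<zeta>(1) by (auto simp: space_PiM space_UB PiE_def extensional_def)
  have good_upd: "good (Suc m) (\<zeta>(Suc m := v))" if "0 < snd v" "snd v < 1" for v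
    using \<zeta>(2) that by (auto simp: good_def)
  have X_upd: "XX \<nu> (\<zeta>(Suc m := v)) (Suc m) = \<eta> * ((if fst v \<le> u then 1 else 0) * snd v)" for v
    by (simp add: XX_upd_last \<eta>_def u_def)
  have Hlim: "(\<lambda>N. G N ((y N)(Suc m := l N))) \<longlonglongrightarrow> H v"
    if v: "0 < snd v" "snd v < 1" and l: "(\<lambda>N. real (l N) / (real N * \<nu>)) \<longlonglongrightarrow> \<eta> * ((if fst v \<le> u then 1 else 0) * snd v)" for v l
  proof -
    have "conv_to (Suc m) (\<lambda>N. (y N)(Suc m := l N)) (\<zeta>(Suc m := v))"
      unfolding conv_to_def
    proof (intro conjI allI impI ballI)
      fix i assume i: "i \<in> {1..Suc m}"
      show "(\<lambda>N. real (((y N)(Suc m := l N)) i) / (real N * \<nu>)) \<longlonglongrightarrow> XX \<nu> (\<zeta>(Suc m := v)) i"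
      proof (cases "i = Suc m")
        case True
        then show ?thesis using l X_upd by simp
      next
        case False
        then have "i \<in> {1..m}" using i by auto
        then show ?thesis using y False by (auto simp: conv_to_def XX_upd)
      qed
    qed (use y in \<open>auto simp: conv_to_def\<close>)
    from lim[OF upd good_upd[OF v] this] show ?thesis by (simp add: H_def)
  qed
  \<comment> \<open>\<open>(u + 1, 1/2)\<close> and \<open>(u, z / \<eta>)\<close> are values of \<open>(U, B)\<close> for which the next coordinate is \<open>0\<close> and \<open>z\<close>.\<close>
  define Gz where "Gz z = (if z = 0 then H (u + 1, 1 / 2) else H (u, z / \<eta>))" for z
  define n where "n N = N - (\<Sum>i\<in>{1..m}. y N i)" for N
  interpret o: one_step c t \<theta>s A s n \<eta> M "\<lambda>N l. G N ((y N)(Suc m := l))" Gz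
  proof unfold_locales
    show "n N \<le> N" for N by (simp add: n_def)
    have S: "(\<lambda>N. real (\<Sum>i\<in>{1..m}. y N i) / (real N * \<nu>)) \<longlonglongrightarrow> (\<Sum>i\<in>{1..m}. XX \<nu> \<zeta> i)"
      using y unfolding of_nat_sum sum_divide_distrib by (intro tendsto_sum) (auto simp: conv_to_def)
    have sum_eta: "(\<Sum>i\<in>{1..m}. XX \<nu> \<zeta> i) = 1 - \<eta>" by (simp add: \<eta>_def etaX_eq)
    have S1: "\<forall>\<^sub>F N in sequentially. real (\<Sum>i\<in>{1..m}. y N i) / (real N * \<nu>) < 1"
      using eta sum_eta by (intro order_tendstoD(2)[OF S]) auto
    have "(\<lambda>N. 1 - real (\<Sum>i\<in>{1..m}. y N i) / (real N * \<nu>)) \<longlonglongrightarrow> 1 - (1 - \<eta>)"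
      using S unfolding sum_eta by (intro tendsto_diff tendsto_const)
    moreover have "\<forall>\<^sub>F N in sequentially. 1 - real (\<Sum>i\<in>{1..m}. y N i) / (real N * \<nu>) = (real (n N) / N - \<mu>) / \<nu>"
      using S1 eventually_gt_at_top[of 0]
    proof eventually_elim
      case (elim N)
      have N: "real N > 0" using elim by simp
      \<comment> \<open>With \<nu> \<le> 1 the lengths sum to less than \<open>N\<close>, so the
        truncated subtraction in \<open>n N\<close> is exact.\<close>
      have "real (\<Sum>i\<in>{1..m}. y N i) < real N * \<nu>" using elim N nu_pos by (simp add: pos_divide_less_eq)
      also have "\<dots> \<le> real N * 1" using nu_le by (intro mult_left_mono) auto
      finally have "(\<Sum>i\<in>{1..m}. y N i) < N" by (simp only: of_nat_less_iff mult_1_right)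
      then have "real (n N) = N - real (\<Sum>i\<in>{1..m}. y N i)" by (simp add: n_def of_nat_diff)
      then have "real (n N) / N - \<mu> = \<nu> - real (\<Sum>i\<in>{1..m}. y N i) / N"
        using N by (simp add: diff_divide_distrib \<nu>_def)
      then show ?case using nu_pos by (simp add: diff_divide_distrib)
    qed
    ultimately show "(\<lambda>N. (real (n N) / N - \<mu>) / \<nu>) \<longlonglongrightarrow> \<eta>" by (simp add: tendsto_cong)
    show "0 < \<eta>" "\<eta> \<le> 1" by (rule eta)+
    show "\<bar>G N ((y N)(Suc m := l))\<bar> \<le> M" for N l by (rule M)
    fix l :: "nat \<Rightarrow> nat" and z :: real
    assume z: "0 \<le> z" "z < \<eta>" "(\<lambda>N. real (l N) / (real N * \<nu>)) \<longlonglongrightarrow> z"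
    show "(\<lambda>N. G N ((y N)(Suc m := l N))) \<longlonglongrightarrow> Gz z"
    proof (cases "z = 0")
      case True
      then show ?thesis unfolding Gz_def using z by (auto intro!: Hlim)
    next
      case False
      then show ?thesis unfolding Gz_def using z eta by (auto intro!: Hlim)
    qed
  qed
  \<comment> \<open>\<open>H v\<close> and \<open>Gz z\<close> are limits of one and the same
    sequence, taken along rounded multiples of z; so \<open>H\<close> depends on v only through the
    next coordinate.\<close>
  have Heq: "H v = (if fst v \<le> u then H (u, snd v) else Gz 0)" if v: "0 < snd v" "snd v < 1" for v
  proof -
    define z where "z = \<eta> * ((if fst v \<le> u then 1 else 0) * snd v)"
    have z: "0 \<le> z" "z < \<eta>" using v eta by (auto simp: z_def)
    have l: "(\<lambda>N. real (nat \<lfloor>z * (real N * \<nu>)\<rfloor>) / (real N * \<nu>)) \<longlonglongrightarrow> z"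
      using z nu_pos by (intro floor_seq_lim)
    have "H v = Gz z"
      using Hlim[OF v l[unfolded z_def]] o.F_lim[OF z l] unfolding z_def by (rule LIMSEQ_unique)
    then show ?thesis using v eta by (auto simp: Gz_def z_def)
  qed
  have HM: "\<bar>H v\<bar> \<le> M" if "0 < snd v" "snd v < 1" for v
    unfolding H_def by (rule conv_to_bounded[OF good_upd[OF that] M]) (rule lim[OF upd good_upd[OF that]])
  interpret U: prob_space unif01 by (rule prob_space_unif01)
  interpret B: prob_space "beta1 \<theta>s" by (rule prob_space_beta1)
  interpret P: pair_prob_space unif01 "beta1 \<theta>s" ..
  interpret UBp: prob_space UB by (rule prob_space_UB)
  have Hm: "H \<in> borel_measurable UB"
  proof -
    have "(\<lambda>v. \<zeta>(Suc m := v)) \<in> measurable UB (PiM (insert (Suc m) {1..m}) (\<lambda>_. UB))"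
      using \<zeta>(1) by (intro measurable_component_update) auto
    moreover have "insert (Suc m) {1..m} = {1..Suc m}" by auto
    ultimately have m: "(\<lambda>v. \<zeta>(Suc m := v)) \<in> measurable UB (PiM {1..Suc m} (\<lambda>_. UB))" by simp
    show ?thesis unfolding H_def by (rule measurable_compose[OF m h])
  qed
  then have Hm': "H \<in> borel_measurable (unif01 \<Otimes>\<^sub>M beta1 \<theta>s)" by (simp add: UB_def)
  have Hfm: "(\<lambda>b. H (x, b)) \<in> borel_measurable (beta1 \<theta>s)" for x
    by (rule measurable_Pair2[OF Hm']) (simp add: unif01_def)
  have Hint: "integrable (unif01 \<Otimes>\<^sub>M beta1 \<theta>s) H"
  proof (rule P.P.integrable_const_bound[OF _ Hm'])
    show "AE v in unif01 \<Otimes>\<^sub>M beta1 \<theta>s. norm (H v) \<le> M"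
      using AE_UB unfolding UB_def by eventually_elim (use HM in auto)
  qed
  define I where "I = (\<integral>b. H (u, b) \<partial>beta1 \<theta>s)"
  have inner: "(\<integral>b. H (x, b) \<partial>beta1 \<theta>s) = (if x \<le> u then I else Gz 0)" for x
  proof (cases "x \<le> u")
    case True
    have "(\<integral>b. H (x, b) \<partial>beta1 \<theta>s) = I" unfolding I_def
    proof (rule integral_cong_AE[OF Hfm Hfm])
      show "AE b in beta1 \<theta>s. H (x, b) = H (u, b)"
        using AE_beta1 by eventually_elim (use Heq[of "(x, _)"] True in auto)
    qed
    then show ?thesis using True by simp
  next
    case False
    have "(\<integral>b. H (x, b) \<partial>beta1 \<theta>s) = (\<integral>b. Gz 0 \<partial>beta1 \<theta>s)"
    proof (rule integral_cong_AE[OF Hfm])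
      show "AE b in beta1 \<theta>s. H (x, b) = Gz 0"
        using AE_beta1 by eventually_elim (use Heq[of "(x, _)"] False in auto)
    qed simp
    then show ?thesis using False B.prob_space by simp
  qed
  have "(\<integral>v. H v \<partial>UB) = (\<integral>x. (\<integral>b. H (x, b) \<partial>beta1 \<theta>s) \<partial>unif01)"
    unfolding UB_def by (rule P.integral_fst'[OF Hint, symmetric])
  also have "\<dots> = u * I + (1 - u) * Gz 0" unfolding inner by (rule unif01_integral_step[OF u])
  also have "I = (\<integral>b. indicator {0<..<1} b * \<theta>s * (1 - b) powr (\<theta>s - 1) * H (u, b) \<partial>lborel)"
    unfolding I_def using Hfm[of u] ths_pos sets_beta1 by (intro beta1_real_integral) (auto cong: measurable_cong_sets)
  also have "\<dots> = (\<integral>b. indicator {0<..<1} b * \<theta>s * (1 - b) powr (\<theta>s - 1) * Gz (\<eta> * b) \<partial>lborel)"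
    using eta by (intro Bochner_Integration.integral_cong) (auto simp: Gz_def indicator_def)
  also have "u * \<dots> + (1 - u) * Gz 0 = o.L" by (simp add: o.L_beta u_def)
  finally show ?thesis using o.one_step by (simp add: H_def n_def)
qed

text \<open>Induction removes the last coordinate on both sides, by \<open>E_peel_last\<close> for
  the chain and by Fubini for the product measure. \<open>conv_to_step\<close> shows that the
  averaged functionals satisfy the hypotheses again.\<close>

theorem chain_limit:
  fixes G :: "nat \<Rightarrow> (nat \<Rightarrow> nat) \<Rightarrow> real" and h :: "(nat \<Rightarrow> real \<times> real) \<Rightarrow> real"
  assumes "\<And>N y. \<bar>G N y\<bar> \<le> M"
    and "h \<in> borel_measurable (PiM {1..m} (\<lambda>_. UB))"
    and "\<And>\<zeta> y. \<zeta> \<in> space (PiM {1..m} (\<lambda>_. UB)) \<Longrightarrow> good m \<zeta> \<Longrightarrow> conv_to m y \<zeta> \<Longrightarrow> (\<lambda>N. G N (y N)) \<longlonglongrightarrow> h \<zeta>"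
  shows "(\<lambda>N. E N m N (G N)) \<longlonglongrightarrow> (\<integral>\<zeta>. h \<zeta> \<partial>PiM {1..m} (\<lambda>_. UB))"
  using assms
proof (induction m arbitrary: G h)
  case 0
  have "good 0 (\<lambda>_. undefined)" "conv_to 0 (\<lambda>_ _. 0) (\<lambda>_. undefined)" by (auto simp: good_def conv_to_def)
  then have "(\<lambda>N. G N (\<lambda>_. 0)) \<longlonglongrightarrow> h (\<lambda>_. undefined)" using 0(3)[of "\<lambda>_. undefined" "\<lambda>_ _. 0"] by (simp add: space_PiM)
  moreover have "(\<integral>\<zeta>. h \<zeta> \<partial>PiM {1..0} (\<lambda>_. UB)) = h (\<lambda>_. undefined)"
    by (simp add: PiM_empty lebesgue_integral_count_space_finite)
  ultimately show ?case by simp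
next
  case (Suc m)
  let ?P = "PiM {1..m} (\<lambda>_. UB)"
  define G' where "G' N y = (\<Sum>l\<le>N - (\<Sum>i\<in>{1..m}. y i). K N (N - (\<Sum>i\<in>{1..m}. y i)) l * G N (y(Suc m := l)))" for N y
  define h' where "h' \<zeta> = (\<integral>v. h (\<zeta>(Suc m := v)) \<partial>UB)" for \<zeta>
  interpret UBp: prob_space UB by (rule prob_space_UB)
  interpret PP: product_prob_space "\<lambda>_. UB" "{1..Suc m}" ..
  have M0: "M \<ge> 0" using Suc.prems(1)[of 0 "\<lambda>_. 0"] by linarith
  have ins: "{1..Suc m} = insert (Suc m) {1..m}" by auto
  have "(\<lambda>N. E N m N (G' N)) \<longlonglongrightarrow> (\<integral>\<zeta>. h' \<zeta> \<partial>?P)"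
  proof (rule Suc.IH)
    fix N :: nat and y :: "nat \<Rightarrow> nat"
    let ?n = "N - (\<Sum>i\<in>{1..m}. y i)"
    have "\<bar>G' N y\<bar> \<le> (\<Sum>l\<le>?n. K N ?n l * M)"
      unfolding G'_def using Suc.prems(1) K_nonneg
      by (intro order_trans[OF sum_abs] sum_mono) (auto simp: abs_mult intro!: mult_left_mono)
    also have "\<dots> \<le> 1 * M" unfolding sum_distrib_right[symmetric] using M0 sum_K_le by (intro mult_right_mono)
    finally show "\<bar>G' N y\<bar> \<le> M" by simp
  next
    have m: "(\<lambda>(\<zeta>, v). \<zeta>(Suc m := v)) \<in> measurable (?P \<Otimes>\<^sub>M UB) (PiM {1..Suc m} (\<lambda>_. UB))"
      unfolding ins by (rule measurable_add_dim)
    have "(\<lambda>(\<zeta>, v). h (\<zeta>(Suc m := v))) \<in> borel_measurable (?P \<Otimes>\<^sub>M UB)"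
      using measurable_compose[OF m Suc.prems(2)] by (simp add: case_prod_beta' fun_upd_def)
    then show "h' \<in> borel_measurable ?P" unfolding h'_def by (rule UBp.borel_measurable_lebesgue_integral)
  next
    fix \<zeta> y assume "\<zeta> \<in> space ?P" "good m \<zeta>" "conv_to m y \<zeta>"
    from conv_to_step[OF Suc.prems this]
    show "(\<lambda>N. G' N (y N)) \<longlonglongrightarrow> h' \<zeta>" unfolding G'_def h'_def .
  qed
  moreover have "integrable (PiM {1..Suc m} (\<lambda>_. UB)) h"
  proof (rule PP.integrable_const_bound[where B = M])
    show "AE \<zeta> in PiM {1..Suc m} (\<lambda>_. UB). norm (h \<zeta>) \<le> M"
      using AE_good[of "Suc m"] AE_space
    proof eventually_elim
      case (elim \<zeta>)
      show ?case unfolding real_norm_def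
        by (rule conv_to_bounded[OF elim(1) Suc.prems(1)]) (rule Suc.prems(3)[OF elim(2,1)])
    qed
  qed (rule Suc.prems(2))
  then have "(\<integral>\<zeta>. h' \<zeta> \<partial>?P) = (\<integral>\<zeta>. h \<zeta> \<partial>PiM {1..Suc m} (\<lambda>_. UB))"
    unfolding h'_def ins by (intro PP.product_integral_insert[symmetric]) auto
  ultimately show ?case unfolding E_peel_last G'_def by simp
qed

end

subsection \<open>Convergence in distribution\<close>

lemma cycsum_cong:
  assumes "\<And>l. l \<ge> 1 \<Longrightarrow> w l = w' l"
  shows "cycsum w m n \<Phi> = cycsum w' m n \<Phi>"
proof (induction m arbitrary: n \<Phi>)
  case 0
  have "expseq w n = expseq w' n" using assms by (intro expseq_cong) auto
  then show ?case by simp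
next
  case (Suc m)
  then show ?case using assms by (auto intro!: sum.cong)
qed

lemma tendsto_fun_iff:
  fixes F :: "'b filter" and g :: "'b \<Rightarrow> 'i \<Rightarrow> 'a::topological_space"
  shows "(g \<longlongrightarrow> l) F \<longleftrightarrow> (\<forall>i. ((\<lambda>x. g x i) \<longlongrightarrow> l i) F)"
  using limitin_componentwise[of "\<lambda>_. euclidean" UNIV g l F]
  by (simp add: euclidean_product_topology)

context condensation
begin

lemma q_self_pos: "\<forall>\<^sub>F N in sequentially. q N N > 0"
proof -
  interpret o: one_step c t \<theta>s A s "\<lambda>N. N" 1 1 "\<lambda>_ _. 1" "\<lambda>_. 1"
    by unfold_locales (use n_lim_self in auto)
  show ?thesis by (rule o.q_n_pos)
qed

lemma XX_measurable:
  "(\<lambda>\<zeta> i. if i \<in> {1..m} then XX \<nu> \<zeta> i else 0) \<in> borel_measurable (PiM {1..m} (\<lambda>_. UB))"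
proof (rule measurable_coordinatewise_then_product)
  have s: "sets UB = sets (borel \<Otimes>\<^sub>M borel)"
    unfolding UB_def by (intro sets_pair_measure_cong sets_unif01 sets_beta1)
  let ?P = "PiM {1..m} (\<lambda>_. UB)"
  have comp: "(\<lambda>\<zeta>. \<zeta> i) \<in> measurable ?P (borel \<Otimes>\<^sub>M borel)" if "i \<in> {1..m}" for i
    using measurable_component_singleton[OF that, of "\<lambda>_. UB"] unfolding measurable_cong_sets[OF refl s] .
  have fs: "(\<lambda>\<zeta>. fst (\<zeta> i)) \<in> borel_measurable ?P" "(\<lambda>\<zeta>. snd (\<zeta> i)) \<in> borel_measurable ?P" if "i \<in> {1..m}" for i
    using measurable_compose[OF comp[OF that] measurable_fst] measurable_compose[OF comp[OF that] measurable_snd] by auto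
  have eta: "(\<lambda>\<zeta>. etaX \<nu> \<zeta> k) \<in> borel_measurable ?P" if "k \<le> m" for k
    using that
  proof (induction k)
    case (Suc k)
    then have IH[measurable]: "(\<lambda>\<zeta>. etaX \<nu> \<zeta> k) \<in> borel_measurable ?P" by simp
    have [measurable]: "(\<lambda>\<zeta>. fst (\<zeta> (Suc k))) \<in> borel_measurable ?P" "(\<lambda>\<zeta>. snd (\<zeta> (Suc k))) \<in> borel_measurable ?P"
      using fs[of "Suc k"] Suc.prems by auto
    show ?case unfolding etaX.simps ustar_def by measurable
  qed simp
  fix i
  show "(\<lambda>\<zeta>. if i \<in> {1..m} then XX \<nu> \<zeta> i else 0) \<in> borel_measurable ?P"
  proof (cases "i \<in> {1..m}")
    case True
    then have [measurable]: "(\<lambda>\<zeta>. etaX \<nu> \<zeta> (i - 1)) \<in> borel_measurable ?P" "(\<lambda>\<zeta>. fst (\<zeta> i)) \<in> borel_measurable ?P" "(\<lambda>\<zeta>. snd (\<zeta> i)) \<in> borel_measurable ?P"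
      using eta[of "i - 1"] fs[of i] by auto
    show ?thesis unfolding if_P[OF True] XX_def DX_def xiX_def ustar_def by measurable
  next
    case False
    show ?thesis unfolding if_not_P[OF False] by simp
  qed
qed

lemma joint_limit:
  fixes f :: "(nat \<Rightarrow> real) \<Rightarrow> real"
  assumes f: "continuous_on (Rm m) f" "bounded (f ` Rm m)"
  shows "(\<lambda>N. E N m N (\<lambda>y. f (\<lambda>i. if i \<in> {1..m} then real (y i) / (real N * \<nu>) else 0)))
    \<longlonglongrightarrow> (\<integral>\<zeta>. f (\<lambda>i. if i \<in> {1..m} then XX \<nu> \<zeta> i else 0) \<partial>UBspace \<theta>s m)"
proof -
  obtain M where M: "\<And>x. x \<in> Rm m \<Longrightarrow> \<bar>f x\<bar> \<le> M" using f(2) unfolding bounded_iff by auto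
  show ?thesis unfolding UBspace_eq
  proof (rule chain_limit)
  show "\<bar>f (\<lambda>i. if i \<in> {1..m} then real (y i) / (real N * \<nu>) else 0)\<bar> \<le> M" for N y
    by (rule M) (auto simp: Rm_def)
  \<comment> \<open>Continuity of \<open>f\<close> is given on \<open>Rm m\<close> only, so its
    measurability goes through the restricted Borel space.\<close>
  have "(\<lambda>\<zeta> i. if i \<in> {1..m} then XX \<nu> \<zeta> i else 0) \<in> measurable (PiM {1..m} (\<lambda>_. UB)) (restrict_space borel (Rm m))"
    by (rule measurable_restrict_space2[OF _ XX_measurable]) (auto simp: Rm_def)
  from measurable_compose[OF this borel_measurable_continuous_on_restrict[OF f(1)]]
  show "(\<lambda>\<zeta>. f (\<lambda>i. if i \<in> {1..m} then XX \<nu> \<zeta> i else 0)) \<in> borel_measurable (PiM {1..m} (\<lambda>_. UB))" .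
  fix \<zeta> y assume "conv_to m y \<zeta>"
  then have "(\<lambda>N. (\<lambda>i. if i \<in> {1..m} then real (y N i) / (real N * \<nu>) else 0)) \<longlonglongrightarrow> (\<lambda>i. if i \<in> {1..m} then XX \<nu> \<zeta> i else 0)"
    unfolding tendsto_fun_iff conv_to_def by auto
  from continuous_on_tendsto_compose[OF f(1) this]
  show "(\<lambda>N. f (\<lambda>i. if i \<in> {1..m} then real (y N i) / (real N * \<nu>) else 0)) \<longlonglongrightarrow> f (\<lambda>i. if i \<in> {1..m} then XX \<nu> \<zeta> i else 0)"
    by (auto simp: Rm_def)
  qed
qed

text \<open>The chain starts at n = N, that is at \<eta> = 1, where
  \<open>ustar \<nu> 1 = \<nu>\<close>; atom and density are the two terms of
  \<open>L_beta\<close>.\<close>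

lemma first_limit:
  fixes g :: "real \<Rightarrow> real"
  assumes g: "continuous_on UNIV g" "bounded (range g)"
  shows "(\<lambda>N. E N 1 N (\<lambda>y. g (real (y 1) / (real N * \<nu>))))
    \<longlonglongrightarrow> (1 - \<nu>) * g 0 + (\<integral>x. indicator {0<..<1} x * (g x * (\<nu> * \<theta>s * (1 - x) powr (\<theta>s - 1))) \<partial>lborel)"
proof -
  obtain M where M: "\<And>x. \<bar>g x\<bar> \<le> M" using g(2) unfolding bounded_iff by auto
  interpret o: one_step c t \<theta>s A s "\<lambda>N. N" 1 M "\<lambda>N l. g (real l / (real N * \<nu>))" g
  proof unfold_locales
    fix l :: "nat \<Rightarrow> nat" and z :: real
    assume "(\<lambda>N. real (l N) / (real N * \<nu>)) \<longlonglongrightarrow> z"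
    then show "(\<lambda>N. g (real (l N) / (real N * \<nu>))) \<longlonglongrightarrow> g z"
      by (intro continuous_on_tendsto_compose[OF g(1)]) auto
  qed (use n_lim_self M in auto)
  have u: "ustar \<nu> 1 = \<nu>" by (simp add: ustar_def)
  have "E N 1 N (\<lambda>y. g (real (y 1) / (real N * \<nu>))) = (\<Sum>l\<le>N. K N N l * g (real l / (real N * \<nu>)))" for N
    by (simp add: vcons_def)
  moreover have "o.L = (1 - \<nu>) * g 0 + (\<integral>x. indicator {0<..<1} x * (g x * (\<nu> * \<theta>s * (1 - x) powr (\<theta>s - 1))) \<partial>lborel)"
    unfolding o.L_beta u by (simp add: mult_ac flip: integral_mult_right_zero)
  ultimately show ?thesis using o.one_step by simp
qed

end

text \<open>Numerator and \<open>HN\<close> are both of the form \<open>q N N\<close> times a value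
  of \<open>E\<close> after scaling by R^N, the latter with m = 0 and \<Phi> = 1. Positivity of
  \<open>q N N\<close> allows the cancellation.\<close>

lemma PN_expectation:
  fixes \<theta> \<kappa> :: "nat \<Rightarrow> real"
  assumes L: "condensation c t \<theta>s A s" and R: "R > 0"
    and t: "\<And>l. l \<ge> 1 \<Longrightarrow> t l = \<theta> l * R ^ l" and c: "\<And>l. l \<ge> 1 \<Longrightarrow> c l = \<kappa> l * R ^ l"
    and pos: "condensation.q c t N N > 0"
  shows "(\<Sum>\<sigma>\<in>perms N. PN \<theta> \<kappa> N \<sigma> * \<Phi> (cyclens m {1..N} \<sigma>)) = condensation.E c t N m N \<Phi>"
proof -
  interpret condensation c t \<theta>s A s by (rule L)
  define w where "w = (\<lambda>j. \<theta> j + real N * \<kappa> j)"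
  have VE: "R ^ N * cycsum w m N \<Psi> = q N N * E N m N \<Psi>" for m \<Psi>
  proof -
    have "R ^ N * cycsum w m N \<Psi> = cycsum (\<lambda>l. w l * R ^ l) m N \<Psi>" by (rule cycsum_scale[symmetric])
    also have "\<dots> = cycsum (\<lambda>l. t l + real N * c l) m N \<Psi>"
      by (rule cycsum_cong) (simp add: w_def t c algebra_simps)
    finally show ?thesis by (simp add: cycsum_eq_E)
  qed
  have wt: "(\<Sum>\<sigma>\<in>perms N. weight \<theta> \<kappa> N \<sigma> * \<Psi> (cyclens m {1..N} \<sigma>)) = fact N * cycsum w m N \<Psi>" for m \<Psi>
  proof -
    have "(\<Sum>\<sigma>\<in>perms N. weight \<theta> \<kappa> N \<sigma> * \<Psi> (cyclens m {1..N} \<sigma>)) = (\<Sum>\<sigma> | \<sigma> permutes {1..N}. cycweight w {1..N} \<sigma> * \<Psi> (cyclens m {1..N} \<sigma>))"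
      by (rule sum.cong) (auto simp: weight_eq_cycweight w_def perms_def)
    also have "\<dots> = fact N * cycsum w m N \<Psi>" using sum_cycweight[of "{1..N}" w \<Psi> m] by simp
    finally show ?thesis .
  qed
  have H: "HN \<theta> \<kappa> N = cycsum w 0 N (\<lambda>_. 1)"
    using wt[of "\<lambda>_. 1" 0] by (simp add: HN_def)
  then have RH: "R ^ N * HN \<theta> \<kappa> N = q N N" using VE[of 0 "\<lambda>_. 1"] by simp
  have "(\<Sum>\<sigma>\<in>perms N. PN \<theta> \<kappa> N \<sigma> * \<Phi> (cyclens m {1..N} \<sigma>)) = (\<Sum>\<sigma>\<in>perms N. weight \<theta> \<kappa> N \<sigma> * \<Phi> (cyclens m {1..N} \<sigma>)) / (fact N * HN \<theta> \<kappa> N)"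
    by (simp add: PN_def sum_divide_distrib)
  also have "\<dots> = cycsum w m N \<Phi> / HN \<theta> \<kappa> N" unfolding wt by simp
  also have "\<dots> = (R ^ N * cycsum w m N \<Phi>) / (R ^ N * HN \<theta> \<kappa> N)" using R by simp
  also have "\<dots> = E N m N \<Phi>" unfolding VE RH using pos by simp
  finally show ?thesis .
qed

theorem theorem5p6:
  fixes \<theta> \<kappa> :: "nat \<Rightarrow> real"
    and G\<theta> G\<kappa> :: "complex \<Rightarrow> complex"
    and R \<eta> \<phi> \<theta>s \<delta> s a\<^sub>s :: real
    and \<delta>n :: "nat \<Rightarrow> real"
    and \<nu> :: real
    and m :: nat
  assumes nonneg: "\<And>j. \<theta> j \<ge> 0" "\<And>j. \<kappa> j \<ge> 0"
    and nonarith: "\<not> (\<exists>j0::nat. j0 > 1 \<and> (\<forall>j\<ge>1. \<kappa> j \<noteq> 0 \<longrightarrow> j0 dvd j))"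
    and kappa_pos: "\<exists>j\<ge>2. \<kappa> j > 0"
    and R_pos: "R > 0"
    and radius: "conv_radius (gcoef \<theta>) = ereal R" "conv_radius (gcoef \<kappa>) = ereal R"
    and Delta_par: "\<eta> > 0" "0 < \<phi>" "\<phi> < pi / 2"
    and holo: "G\<theta> holomorphic_on Delta0 R \<eta> \<phi>" "G\<kappa> holomorphic_on Delta0 R \<eta> \<phi>"
    and ext: "\<And>z. z \<in> ball 0 R \<Longrightarrow> G\<theta> z = (\<Sum>j. gcoef \<theta> j * z ^ j)"
             "\<And>z. z \<in> ball 0 R \<Longrightarrow> G\<kappa> z = (\<Sum>j. gcoef \<kappa> j * z ^ j)"
    and g1_lt: "gbraceR 1 G\<kappa> R < 1"
    and pars: "\<theta>s > 0" "\<delta> > 0"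
    and asym_theta: "(\<lambda>z. G\<theta> z + complex_of_real \<theta>s * Ln (1 - z / complex_of_real R))
        \<in> O[nearR R \<eta> \<phi>](\<lambda>z. (1 - z / complex_of_real R) powr complex_of_real \<delta>)"
    and asym_kappa: "(\<lambda>z. G\<kappa> z - (complex_of_real (real_of_ereal (gbraceR 0 G\<kappa> R))
            - complex_of_real (real_of_ereal (gbraceR 1 G\<kappa> R)) * (1 - z / complex_of_real R)))
        \<in> O[nearR R \<eta> \<phi>](\<lambda>z. (1 - z / complex_of_real R) powr complex_of_real (1 + \<delta>))"
    and s_prop: "s > 1" "s \<notin> \<int>" "a\<^sub>s > 0"
    and fin_below: "\<And>n::nat. n \<ge> 1 \<Longrightarrow> real n < s \<Longrightarrow> gbraceR n G\<kappa> R < \<infinity>"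
    and inf_above: "\<And>n::nat. real n > s \<Longrightarrow> gbraceR n G\<kappa> R = \<infinity>"
    and dn_pos: "\<And>n. \<delta>n n > 0"
    and asym_below: "\<And>n::nat. n \<ge> 1 \<Longrightarrow> real n < s \<Longrightarrow>
        \<exists>e. e \<in> O[nearR R \<eta> \<phi>](\<lambda>z. (1 - z / complex_of_real R) powr complex_of_real (\<delta>n n)) \<and>
            (\<forall>\<^sub>F z in nearR R \<eta> \<phi>.
               gbrace n G\<kappa> z = complex_of_real (real_of_ereal (gbraceR n G\<kappa> R)) * (1 + e z))"
    and asym_above: "\<And>n::nat. real n > s \<Longrightarrow>
        \<exists>e. e \<in> O[nearR R \<eta> \<phi>](\<lambda>z. (1 - z / complex_of_real R) powr complex_of_real (\<delta>n n)) \<and>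
            (\<forall>\<^sub>F z in nearR R \<eta> \<phi>.
               gbrace n G\<kappa> z = complex_of_real (Gamma (real n - s) * a\<^sub>s / Gamma (- s))
                  * (1 - z / complex_of_real R) powr complex_of_real (s - real n) * (1 + e z))"
    and asym_theta_n: "\<And>n::nat. n \<ge> 1 \<Longrightarrow>
        \<exists>e. e \<in> O[nearR R \<eta> \<phi>](\<lambda>z. (1 - z / complex_of_real R) powr complex_of_real (\<delta>n n)) \<and>
            (\<forall>\<^sub>F z in nearR R \<eta> \<phi>.
               gbrace n G\<theta> z = complex_of_real (\<theta>s * fact (n - 1))
                  / (1 - z / complex_of_real R) ^ n * (1 + e z))"
    and nu_def: "\<nu> = 1 - real_of_ereal (gbraceR 1 G\<kappa> R)"
  shows "(\<forall>f :: (nat \<Rightarrow> real) \<Rightarrow> real.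
            continuous_on (Rm m) f \<and> bounded (f ` Rm m) \<longrightarrow>
            (\<lambda>N. \<Sum>\<sigma>\<in>perms N. PN \<theta> \<kappa> N \<sigma> *
                  f (\<lambda>i. if i \<in> {1..m} then real (Lcyc N \<sigma> i) / (real N * \<nu>) else 0))
            \<longlonglongrightarrow> (\<integral>\<omega>. f (\<lambda>i. if i \<in> {1..m} then XX \<nu> \<omega> i else 0) \<partial>UBspace \<theta>s m))
       \<and> (\<forall>g :: real \<Rightarrow> real.
            continuous_on UNIV g \<and> bounded (range g) \<longrightarrow>
            (\<lambda>N. \<Sum>\<sigma>\<in>perms N. PN \<theta> \<kappa> N \<sigma> * g (real (Lcyc N \<sigma> 1) / (real N * \<nu>)))
            \<longlonglongrightarrow> (1 - \<nu>) * g 0 +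
                 (\<integral>x. indicator {0<..<1} x * (g x * (\<nu> * \<theta>s * (1 - x) powr (\<theta>s - 1))) \<partial>lborel))"
proof -
  \<comment> \<open>Index 0 is overwritten because \<open>compound_poisson\<close> requires c 0 =
    0.\<close>
  define c where "c l = (if l = 0 then 0 else \<kappa> l * R ^ l)" for l
  define t where "t l = \<theta> l * R ^ l" for l
  note g1 = gbraceR_1_eq_suminf[OF R_pos nonneg(2) radius(2) ext(2) g1_lt]
  have c_Suc: "summable (\<lambda>j. c (Suc j))" using g1(1) by (simp add: c_def)
  then have c_sum: "summable c" by (simp add: summable_Suc_iff)
  have "gbraceR 1 G\<kappa> R = ereal (\<Sum>j. c (Suc j))" using g1(2) by (simp add: c_def)
  also have "(\<Sum>j. c (Suc j)) = (\<Sum>l. c l)" using suminf_split_head[OF c_sum] c_def[of 0] by simp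
  finally have g1_eq: "gbraceR 1 G\<kappa> R = ereal (\<Sum>l. c l)" .
  have "\<exists>A. \<forall>l\<ge>1. \<kappa> l * R ^ l \<le> A * real l powr (-s)"
    by (rule kappa_coeff_bound[OF R_pos Delta_par nonneg(2) radius(2) holo(2) ext(2) s_prop(1) dn_pos,
          where b = "\<lambda>n. Gamma (real n - s) * a\<^sub>s / Gamma (- s)", OF _ asym_above])
  then obtain A where A: "\<And>l. l \<ge> 1 \<Longrightarrow> \<kappa> l * R ^ l \<le> A * real l powr (-s)" by blast
  \<comment> \<open>Order 2 is the least order n for which the error exponent n - \<delta> can
    exceed 1.\<close>
  obtain e where "e \<in> O[nearR R \<eta> \<phi>](\<lambda>z. (1 - z / complex_of_real R) powr complex_of_real (\<delta>n 2))"
    "\<forall>\<^sub>F z in nearR R \<eta> \<phi>. gbrace 2 G\<theta> z = complex_of_real \<theta>s / (1 - z / complex_of_real R) ^ 2 * (1 + e z)"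
    using asym_theta_n[of 2] by auto
  from theta_coeff_bound[OF R_pos Delta_par radius(1) holo(1) ext(1) pars(1) dn_pos this]
  obtain D d where D: "d > 0" "\<And>l. l \<ge> 1 \<Longrightarrow> \<bar>\<theta> l * R ^ l - \<theta>s\<bar> / l \<le> D * real l powr (-1 - d)" by blast
  interpret cp: compound_poisson c
    by unfold_locales (use nonneg R_pos c_sum in \<open>auto simp: c_def\<close>)
  interpret L: condensation c t \<theta>s A s
  proof unfold_locales
    show "t l \<ge> 0" for l using nonneg R_pos by (simp add: t_def)
    show "c l \<le> A * real l powr (-s)" if "l \<ge> 1" for l using A[OF that] that by (simp add: c_def)
    show "cp.\<mu> < 1" using g1_lt unfolding g1_eq cp.\<mu>_def by (simp add: one_ereal_def)
    show "summable (\<lambda>l. \<bar>(t l - \<theta>s) / l\<bar>)"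
    proof (rule summable_comparison_test'[where N = 1])
      show "summable (\<lambda>l. D * real l powr (-1 - d))" using D(1) by (intro summable_mult) (simp add: summable_real_powr_iff)
      show "norm \<bar>(t l - \<theta>s) / l\<bar> \<le> D * real l powr (-1 - d)" if "l \<ge> 1" for l
        using D(2)[OF that] by (simp add: t_def abs_divide)
    qed
    show "(\<lambda>l. t l - \<theta>s) \<longlonglongrightarrow> 0"
    proof (rule Lim_null_comparison)
      show "\<forall>\<^sub>F l in sequentially. norm (t l - \<theta>s) \<le> D * real l powr (- d)"
        using eventually_ge_at_top[of 1]
      proof eventually_elim
        case (elim l)
        have "real l powr (-1 - d) * l = real l powr (- d)" using elim by (simp add: powr_diff powr_minus field_simps)
        moreover have "\<bar>t l - \<theta>s\<bar> \<le> D * real l powr (-1 - d) * l"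
          using D(2)[OF elim] elim by (simp add: t_def divide_le_eq)
        ultimately show ?case by (simp add: mult.assoc)
      qed
      have "(\<lambda>l. real l powr (- d)) \<longlonglongrightarrow> 0" using D(1) by real_asymp
      then show "(\<lambda>l. D * real l powr (- d)) \<longlonglongrightarrow> 0" by (rule tendsto_mult_right_zero)
    qed
  qed (use pars s_prop in auto)
  have nu: "\<nu> = L.\<nu>" unfolding nu_def g1_eq L.\<nu>_def cp.\<mu>_def by simp
  \<comment> \<open>Holds once \<open>q N N\<close> is positive, which \<open>q_self_pos\<close>
    provides for large \<open>N\<close>; limits need no more.\<close>
  have exp: "\<forall>\<^sub>F N in sequentially. L.E N k N (\<Phi> N) = (\<Sum>\<sigma>\<in>perms N. PN \<theta> \<kappa> N \<sigma> * \<Phi> N (cyclens k {1..N} \<sigma>))" for k \<Phi>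
    using L.q_self_pos
    by eventually_elim (rule PN_expectation[OF L.condensation_axioms R_pos, symmetric], auto simp: t_def c_def)
  show ?thesis
  proof (intro conjI allI impI)
    fix f :: "(nat \<Rightarrow> real) \<Rightarrow> real"
    assume f: "continuous_on (Rm m) f \<and> bounded (f ` Rm m)"
    have eq: "(\<lambda>i. if i \<in> {1..m} then real (cyclens m {1..N} \<sigma> i) / (real N * L.\<nu>) else 0) =
      (\<lambda>i. if i \<in> {1..m} then real (Lcyc N \<sigma> i) / (real N * L.\<nu>) else 0)" for N \<sigma>
      by (auto simp: cyclens_def Lcyc_eq_cyclen)
    have f': "continuous_on (Rm m) f" "bounded (f ` Rm m)" using f by auto
    show "(\<lambda>N. \<Sum>\<sigma>\<in>perms N. PN \<theta> \<kappa> N \<sigma> * f (\<lambda>i. if i \<in> {1..m} then real (Lcyc N \<sigma> i) / (real N * \<nu>) else 0))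
      \<longlonglongrightarrow> (\<integral>\<omega>. f (\<lambda>i. if i \<in> {1..m} then XX \<nu> \<omega> i else 0) \<partial>UBspace \<theta>s m)"
      using Lim_transform_eventually[OF L.joint_limit[OF f'] exp] unfolding eq nu .
  next
    fix g :: "real \<Rightarrow> real"
    assume g: "continuous_on UNIV g \<and> bounded (range g)"
    have eq: "cyclens 1 {1..N} \<sigma> 1 = Lcyc N \<sigma> 1" for N \<sigma>
      by (simp add: cyclens_def Lcyc_eq_cyclen)
    have g': "continuous_on UNIV g" "bounded (range g)" using g by auto
    show "(\<lambda>N. \<Sum>\<sigma>\<in>perms N. PN \<theta> \<kappa> N \<sigma> * g (real (Lcyc N \<sigma> 1) / (real N * \<nu>)))
      \<longlonglongrightarrow> (1 - \<nu>) * g 0 + (\<integral>x. indicator {0<..<1} x * (g x * (\<nu> * \<theta>s * (1 - x) powr (\<theta>s - 1))) \<partial>lborel)"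
      using Lim_transform_eventually[OF L.first_limit[OF g'] exp] unfolding eq nu .
  qed
qed

end
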